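(* Let $T$ be a B-tree with parameter $B$ and let $k_1<k_2<\dots<k_d$ be keys. Set $k_0=-\infty$ and $k_{d+1}=+\infty$. Then one can compute, in parallel in the fork-join I/O model, B-trees $T_1,\dots,T_{d+1}$ where $T_i$ contains exactly the keys of $T$ in the open interval $(k_{i-1},k_i)$, with $O(\log_B d + \log_B n)$ I/O span and $O(d \log_B n)$ I/O work, where $n = \sum_{i} |T_i|$ is the total number of keys in the output trees.
   Context: A B-tree with parameter $B$ over a totally ordered key set is either an empty (external) node, or a node with keys $k_1<\dots<k_b$ and $b+1$ subtrees $T_1,\dots,T_{b+1}$, such that: $\lceil B/2\rceil \le b \le B$ (except at the root, where $2\le b\le B$); each $T_i$ is a B-tree; every key of $T_{i-1}$ is less than $k_i$ and every key of $T_i$ is greater than $k_i$; and all external nodes have the same depth. $|T|$ denotes the number of keys of $T$. Cost model (fork-join I/O model): computation is in the shared-memory fork-join model, where a thread may fork up to $B$ parallel child threads and continues once they all finish. Memory is organized in blocks of $B$ words ($B$ is also the B-tree parameter); reading or writing one block costs one unit, while each processor can hold $O(\log n)$ blocks locally and accessing them is free. The I/O work is the total number of block transfers, and the I/O span is the maximum number of block transfers along any path of the computation DAG.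
   Formalization: The bounds ⌈B/2⌉, B and 2 (root) are put on the number of subtrees, not keys (else no B-tree has exactly one key and the claim fails); B ≥ 3 and d ≥ 1 are assumed; log_B n and the log n in the memory bound are read as max(1, ·), since the literal bounds vanish for n ≤ 1. *)

theory Defs
  imports Complex_Main
begin

section \<open>B-trees\<close>

datatype (keys: 'k) btree = External | Node "'k list" "'k btree list"

fun external_depths :: "'k btree \<Rightarrow> nat set" where
  "external_depths External = {0}"
| "external_depths (Node ks ts) = Suc ` (\<Union>t\<in>set ts. external_depths t)"

text \<open>
  The degree bounds \<open>\<lceil>B/2\<rceil>\<close>, \<open>2\<close> (at the root) and \<open>B\<close> constrain the number of subtrees of a
  node, which is one more than its number of keys. If they constrained the number of keys, no
  B-tree would have exactly one key, nor exactly \<open>B + 1\<close> keys, and the class would not be closed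
  under restriction to an interval. The parameter \<open>lo\<close> is the lower bound for the topmost node.
\<close>

fun btree_node :: "nat \<Rightarrow> nat \<Rightarrow> 'k::linorder btree \<Rightarrow> bool" where
  "btree_node B lo External \<longleftrightarrow> True"
| "btree_node B lo (Node ks ts) \<longleftrightarrow>
     length ts = length ks + 1 \<and> lo \<le> length ts \<and> length ts \<le> B \<and>
     sorted_wrt (<) ks \<and>
     (\<forall>i<length ks. (\<forall>x\<in>keys (ts ! i). x < ks ! i) \<and> (\<forall>x\<in>keys (ts ! (i + 1)). ks ! i < x)) \<and>
     (\<forall>t\<in>set ts. btree_node B (nat \<lceil>real B / 2\<rceil>) t)"

definition btree :: "nat \<Rightarrow> 'k::linorder btree \<Rightarrow> bool" where
  "btree B t \<longleftrightarrow> btree_node B 2 t \<and> (\<exists>h. external_depths t = {h})"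

text \<open>
  The lists below are indexed from 0: for \<open>i \<le> d\<close>, where \<open>d = length ks\<close>, this is the open
  interval between the \<open>i\<close>-th and the \<open>(i+1)\<close>-st element of the sequence \<open>-\<infinity>, ks, +\<infinity>\<close>.
\<close>

definition gap :: "'k::linorder list \<Rightarrow> nat \<Rightarrow> 'k set" where
  "gap ks i = {x. (0 < i \<longrightarrow> ks ! (i - 1) < x) \<and> (i < length ks \<longrightarrow> x < ks ! i)}"

section \<open>The fork-join I/O model\<close>

datatype 'k word = Blank | Num nat | Key 'k

text \<open>Shared memory maps block addresses to blocks (lists of \<open>B\<close> words).\<close>

type_synonym 'k mem = "nat \<Rightarrow> 'k word list"

text \<open>
  A program is a single function, run by every thread, from the contents of the local memory of the
  thread to its next action. Local computation is free and hence arbitrary, but a thread remembers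
  nothing apart from its local memory. The last argument of \<open>Read\<close>, \<open>Write\<close> and \<open>Fork\<close> is what the
  thread keeps in local memory; \<open>Read\<close> puts the block that was read in front of it. The first
  argument of \<open>Fork\<close> lists the initial local memories of the child threads.
\<close>

datatype 'k action =
    Halt
  | Read nat "'k word list"
  | Write nat "'k word list" "'k word list"
  | Fork "'k word list list" "'k word list"

type_synonym 'k program = "'k word list \<Rightarrow> 'k action"

record 'k outcome =
  read_set :: "nat set"
  write_set :: "nat set"
  final_mem :: "'k mem"
  io_work :: nat
  io_span :: nat

text \<open>
  Sibling threads may read common blocks, but no thread may access a block written by a sibling.
  Under this condition all interleavings have the same effect, so it suffices to run each child
  on the memory at the time of the fork and to combine the blocks that were written.
\<close>

definition race_free :: "'k outcome list \<Rightarrow> bool" where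
  "race_free rs \<longleftrightarrow> (\<forall>i<length rs. \<forall>j<length rs. i \<noteq> j \<longrightarrow>
     write_set (rs ! i) \<inter> (read_set (rs ! j) \<union> write_set (rs ! j)) = {})"

definition join_mem :: "'k mem \<Rightarrow> 'k outcome list \<Rightarrow> 'k mem" where
  "join_mem \<mu> rs a =
     (case find (\<lambda>r. a \<in> write_set r) rs of None \<Rightarrow> \<mu> a | Some r \<Rightarrow> final_mem r a)"

text \<open>
  \<open>run B L c V prog \<mu> s r\<close>: a thread started with local memory \<open>s\<close> on shared memory \<open>\<mu>\<close> terminates
  with outcome \<open>r\<close>, where
  \<^item> \<open>B\<close> is the number of words of a block and the maximal number of children of a fork,
  \<^item> \<open>L\<close> is the number of blocks that fit in the local memory of a thread,
  \<^item> \<open>c\<close> is the number of words that can be passed to a child when it is forked,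
  \<^item> \<open>V\<close> is the set of admissible words. Without this restriction an unbounded amount of
    data could be encoded in a single word.
\<close>

inductive run ::
  "nat \<Rightarrow> nat \<Rightarrow> nat \<Rightarrow> 'k word set \<Rightarrow> 'k program \<Rightarrow> 'k mem \<Rightarrow> 'k word list \<Rightarrow> 'k outcome \<Rightarrow> bool"
  for B L c :: nat and V :: "'k word set" and prog :: "'k program"
where
  run_Halt:
    "\<lbrakk>length s \<le> L * B; set s \<subseteq> V; prog s = Halt\<rbrakk> \<Longrightarrow>
     run B L c V prog \<mu> s
       \<lparr>read_set = {}, write_set = {}, final_mem = \<mu>, io_work = 0, io_span = 0\<rparr>"
| run_Read:
    "\<lbrakk>length s \<le> L * B; set s \<subseteq> V; prog s = Read a s'; Num a \<in> V;
      run B L c V prog \<mu> (\<mu> a @ s') r\<rbrakk> \<Longrightarrow>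
     run B L c V prog \<mu> s
       (r\<lparr>read_set := insert a (read_set r), io_work := io_work r + 1, io_span := io_span r + 1\<rparr>)"
| run_Write:
    "\<lbrakk>length s \<le> L * B; set s \<subseteq> V; prog s = Write a b s'; Num a \<in> V;
      length b = B; set b \<subseteq> V;
      run B L c V prog (\<mu>(a := b)) s' r\<rbrakk> \<Longrightarrow>
     run B L c V prog \<mu> s
       (r\<lparr>write_set := insert a (write_set r), io_work := io_work r + 1, io_span := io_span r + 1\<rparr>)"
| run_Fork:
    "\<lbrakk>length s \<le> L * B; set s \<subseteq> V; prog s = Fork cs s';
      length cs \<le> B; \<forall>s\<^sub>c\<in>set cs. length s\<^sub>c \<le> c;
      list_all2 (run B L c V prog \<mu>) cs rs; race_free rs;
      run B L c V prog (join_mem \<mu> rs) s' r\<rbrakk> \<Longrightarrow>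
     run B L c V prog \<mu> s
       (r\<lparr>read_set := read_set r \<union> (\<Union>q\<in>set rs. read_set q),
          write_set := write_set r \<union> (\<Union>q\<in>set rs. write_set q),
          io_work := io_work r + sum_list (map io_work rs),
          io_span := io_span r + Max (insert 0 (set (map io_span rs)))\<rparr>)"

section \<open>Data layout\<close>

definition pad :: "nat \<Rightarrow> 'k word list \<Rightarrow> 'k word list" where
  "pad B ws = ws @ replicate (B - length ws) Blank"

text \<open>
  A node occupies two consecutive blocks, one for its keys and one for the pointers to its
  subtrees; an external node is represented by the pointer \<open>Blank\<close>. All blocks used lie in \<open>P\<close>.
\<close>

inductive stored_tree :: "nat \<Rightarrow> 'k mem \<Rightarrow> nat set \<Rightarrow> 'k word \<Rightarrow> 'k btree \<Rightarrow> bool"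
  for B :: nat and \<mu> :: "'k mem" and P :: "nat set"
where
  "stored_tree B \<mu> P Blank External"
| "\<lbrakk>a \<in> P; a + 1 \<in> P; \<mu> a = pad B (map Key ks); \<mu> (a + 1) = pad B ps;
    list_all2 (stored_tree B \<mu> P) ps ts\<rbrakk> \<Longrightarrow>
   stored_tree B \<mu> P (Num a) (Node ks ts)"

text \<open>A key array is packed densely in the consecutive blocks starting at \<open>a\<close>.\<close>

definition stored_keys :: "nat \<Rightarrow> 'k mem \<Rightarrow> nat set \<Rightarrow> nat \<Rightarrow> 'k list \<Rightarrow> bool" where
  "stored_keys B \<mu> P a ks \<longleftrightarrow> (\<forall>j. j * B < length ks \<longrightarrow>
     a + j \<in> P \<and> \<mu> (a + j) = pad B (take B (drop (j * B) (map Key ks))))"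

end

theory Submission
  imports Defs
begin

text \<open>
  The keys \<open>k\<^sub>1 < \<dots> < k\<^sub>d\<close> cut the tree into \<open>d + 1\<close> gaps, and every gap is extracted by a thread of its
  own. Old subtrees are shared, so that only the nodes along the two boundaries of a gap have to be
  built anew. To trim a tree at a boundary, one descends along the boundary together with the
  neighbouring node of the same height and regroups the subtrees on the way back: since the
  neighbour is complete, there are always enough subtrees for valid nodes, and trimming takes
  \<open>O(1)\<close> transfers per level.

  The threads are found by repeatedly dividing the range of gaps into \<open>B\<close> parts, where a range
  first descends to the place at which it no longer fits into three adjacent nodes. This has span
  \<open>O(log\<^sub>B d + h)\<close> for a tree of height \<open>h\<close>. The work is \<open>O(d h)\<close>, which suffices if \<open>d \<le> n\<close>. It is
  also \<open>O(d + N)\<close>, where \<open>N \<le> n + d\<close> is the number of keys of the tree, which suffices if \<open>n < d\<close>: a range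
  of about \<open>B\<^sup>j\<close> gaps that is split at height \<open>t\<close> pays \<open>O(B t)\<close>, and this is amortized over its gaps
  if \<open>t = O(j)\<close>, and otherwise over the few keys of height \<open>t\<close>.
\<close>

section \<open>Threads as resumable code\<close>

text \<open>Two obstacles shape the proof. A program sees nothing but its local memory, so recursion
  cannot use a stack: a call is a fork with a single child, whose answer comes back through a block
  at an address fixed in advance. Nor can threads coordinate an allocator: every gap owns a
  precomputed interval of addresses, which makes race freedom a matter of disjoint intervals. The
  bound of three nodes is dictated by trimming. As soon as a range meets four subtrees, the first
  two and the last two form disjoint pairs, so each boundary has a complete neighbour of its own.
  The same number drives the amortization: four subtrees have three separators, at most two of which
  are inherited from above, so one is a key of the current height inside the range and can be
  charged. The program cannot know whether \<open>n < d\<close>, as \<open>n\<close> is the size of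
  its output. Hence a single run has to meet both work bounds, and their minimum is carried through
  the induction.\<close>

datatype 'k code =
    Done
  | Rd nat "'k word list \<Rightarrow> 'k code"
  | Wr nat "'k word list" "'k code"
  | Fk "'k word list list" "'k code"

primrec resume :: "'k code \<Rightarrow> 'k word list \<Rightarrow> 'k code" where
  "resume Done b = Done"
| "resume (Rd a f) b = f b"
| "resume (Wr a v k) b = k"
| "resume (Fk cs k) b = k"

text \<open>The trailer stands at the end because reads put blocks in front: only the end of the
  local memory has a position independent of the history. The stored length separates the arguments
  from the history.\<close>

definition frame :: "nat \<Rightarrow> 'k word list \<Rightarrow> 'k word list" where
  "frame B args = args @ [Num B, Num (length args), Blank]"

definition blocks :: "nat \<Rightarrow> 'k word list \<Rightarrow> 'k word list list" where
  "blocks B ws = map (\<lambda>j. take B (drop (j * B) ws)) [0..<length ws div B]"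

primrec act :: "nat \<Rightarrow> 'k word list \<Rightarrow> 'k code \<Rightarrow> 'k action" where
  "act B s Done = Halt"
| "act B s (Rd a f) = Read a s"
| "act B s (Wr a b k) = Write a b (replicate B Blank @ s)"
| "act B s (Fk cs k) = Fork cs (replicate B Blank @ s)"

text \<open>
  The local memory of a thread is its history, newest block first, in front of its frame. A write
  or a fork is recorded as a block of blanks, so that the history determines how far the thread
  has got. A frame ends with \<open>Blank\<close>, whereas the memory of the initial thread ends with a number.
\<close>

definition interp ::
  "(nat \<Rightarrow> 'k word list \<Rightarrow> 'k code) \<Rightarrow> ('k word list \<Rightarrow> 'k action) \<Rightarrow> 'k program" where
  "interp body start s =
     (case rev s of
        Blank # Num l # Num B # ws \<Rightarrow>
          act B s (foldr (\<lambda>b k. resume k b) (blocks B (rev (drop l ws))) (body B (rev (take l ws))))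
      | _ \<Rightarrow> start s)"

lemma blocks_concat:
  assumes "0 < B" "\<forall>b\<in>set bs. length b = B"
  shows "blocks B (concat bs) = bs"
proof -
  have len: "length (concat bs) = length bs * B"
    using assms(2) by (induction bs) auto
  have "take B (drop (j * B) (concat bs)) = bs ! j" if "j < length bs" for j
    using that assms(2)
  proof (induction bs arbitrary: j)
    case (Cons b bs)
    then show ?case by (cases j) auto
  qed simp
  then show ?thesis
    using assms(1) by (intro nth_equalityI) (auto simp: blocks_def len)
qed

lemma interp_frame:
  assumes "0 < B" "\<forall>b\<in>set h. length b = B"
  shows "interp body start (concat h @ frame B args) =
    act B (concat h @ frame B args) (foldr (\<lambda>b k. resume k b) h (body B args))"
  using assms by (simp add: interp_def frame_def blocks_concat)

lemma run_unchanged: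
  assumes "run B L c V prog \<mu> s r" "a \<notin> write_set r"
  shows "final_mem r a = \<mu> a"
  using assms
proof (induction arbitrary: a rule: run.induct)
  case (run_Fork s cs s' \<mu> rs r)
  then have "final_mem r a = join_mem \<mu> rs a" by auto
  moreover have "find (\<lambda>r. a \<in> write_set r) rs = None"
    using run_Fork.prems by (auto simp: find_None_iff)
  ultimately show ?case by (simp add: join_mem_def)
qed auto

section \<open>Weakest preconditions with budgets for steps, work and span\<close>

text \<open>A history fits into local memory because no thread makes more than 20 steps.\<close>

locale machine =
  fixes B L c :: nat and V :: "'k word set"
    and body :: "nat \<Rightarrow> 'k word list \<Rightarrow> 'k code" and start :: "'k word list \<Rightarrow> 'k action"
  assumes B_pos: "0 < B" and L_large: "c + 20 \<le> L" and Blank_V: "Blank \<in> V"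
begin

abbreviation "runs \<equiv> run B L c V (interp body start)"

definition bounded_by :: "nat set \<Rightarrow> nat set \<Rightarrow> nat \<Rightarrow> nat \<Rightarrow> 'k outcome \<Rightarrow> bool" where
  "bounded_by R W w p r \<longleftrightarrow> read_set r \<subseteq> R \<and> write_set r \<subseteq> W \<and> io_work r \<le> w \<and> io_span r \<le> p"

text \<open>\<open>n\<close> is the number of steps still allowed, \<open>w\<close> and
  \<open>p\<close> are the remaining work and span. A fork asks for actual runs of the children, so
  that recursion between threads is left to inductions outside of \<open>wp\<close>.\<close>

primrec wp :: "'k code \<Rightarrow> nat \<Rightarrow> nat set \<Rightarrow> nat set \<Rightarrow> nat \<Rightarrow> nat \<Rightarrow> ('k mem \<Rightarrow> bool) \<Rightarrow> 'k mem \<Rightarrow> bool"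
where
  "wp Done n R W w p Q \<mu> \<longleftrightarrow> Q \<mu>"
| "wp (Rd a f) n R W w p Q \<mu> \<longleftrightarrow> 0 < n \<and> 0 < w \<and> 0 < p \<and> a \<in> R \<and> Num a \<in> V \<and>
     length (\<mu> a) = B \<and> set (\<mu> a) \<subseteq> V \<and> wp (f (\<mu> a)) (n - 1) R W (w - 1) (p - 1) Q \<mu>"
| "wp (Wr a b k) n R W w p Q \<mu> \<longleftrightarrow> 0 < n \<and> 0 < w \<and> 0 < p \<and> a \<in> W \<and> Num a \<in> V \<and>
     length b = B \<and> set b \<subseteq> V \<and> wp k (n - 1) R W (w - 1) (p - 1) Q (\<mu>(a := b))"
| "wp (Fk cs k) n R W w p Q \<mu> \<longleftrightarrow> 0 < n \<and> length cs \<le> B \<and> (\<forall>s\<in>set cs. length s \<le> c) \<and>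
     (\<exists>rs w' p'. list_all2 (runs \<mu>) cs rs \<and> race_free rs \<and> w' \<le> w \<and> p' \<le> p \<and>
        (\<forall>q\<in>set rs. read_set q \<subseteq> R \<and> write_set q \<subseteq> W \<and> io_span q \<le> p') \<and>
        sum_list (map io_work rs) \<le> w' \<and>
        wp k (n - 1) R W (w - w') (p - p') Q (join_mem \<mu> rs))"

definition calls :: "'k word list \<Rightarrow> nat set \<Rightarrow> nat set \<Rightarrow> nat \<Rightarrow> nat \<Rightarrow> ('k mem \<Rightarrow> bool) \<Rightarrow> 'k mem \<Rightarrow> bool"
where
  "calls s R W w p \<Psi> \<mu> \<longleftrightarrow> (\<exists>r. runs \<mu> s r \<and> bounded_by R W w p r \<and> \<Psi> (final_mem r))"

lemma callsI:
  assumes "runs \<mu> s r" "bounded_by R W w p r" "\<Psi> (final_mem r)"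
  shows "calls s R W w p \<Psi> \<mu>"
  using assms unfolding calls_def by blast

lemma wp_resume:
  assumes "wp k n R W w p Q \<mu>" "foldr (\<lambda>b k. resume k b) h (body B args) = k"
    and "length (frame B args) \<le> c" "set (frame B args) \<subseteq> V"
    and "\<forall>b\<in>set h. length b = B \<and> set b \<subseteq> V" "length h + n \<le> 20"
  shows "calls (concat h @ frame B args) R W w p Q \<mu>"
  using assms
proof (induction k arbitrary: h n w p \<mu>)
  let ?s = "\<lambda>h. concat h @ frame B args"
  have space: "length (?s h) \<le> L * B" "set (?s h) \<subseteq> V"
    if "\<forall>b\<in>set h. length b = B \<and> set b \<subseteq> V" "length h \<le> 20" for h
  proof -
    have "length (concat h) = length h * B" using that(1) by (induction h) auto
    moreover have "length h * B \<le> 20 * B" using that(2) by simp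
    \<comment> \<open>The frame is generously counted as \<open>c\<close> blocks instead of
      \<open>c\<close> words; this is why \<open>c + 20\<close> blocks are enough.\<close>
    moreover have "length (frame B args) \<le> c * B"
      using assms(3) B_pos by (metis le_trans mult.right_neutral mult_le_mono2 Suc_leI One_nat_def)
    ultimately have "length (?s h) \<le> 20 * B + c * B" unfolding length_append by linarith
    also have "\<dots> \<le> L * B" using mult_le_mono1[OF L_large, of B] by (simp add: algebra_simps)
    finally show "length (?s h) \<le> L * B" .
    show "set (?s h) \<subseteq> V" using that(1) assms(4) by auto
  qed
  {
    case Done
    have "runs \<mu> (?s h) \<lparr>read_set = {}, write_set = {}, final_mem = \<mu>, io_work = 0, io_span = 0\<rparr>"
      using Done space[of h] B_pos by (intro run.run_Halt) (auto simp: interp_frame)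
    then show ?case by (rule callsI) (use Done.prems(1) in \<open>auto simp: bounded_by_def\<close>)
  next
    case (Rd a f)
    have wp: "wp (f (\<mu> a)) (n - 1) R W (w - 1) (p - 1) Q \<mu>"
      and pos: "0 < n" "0 < w" "0 < p" "a \<in> R" "Num a \<in> V" "length (\<mu> a) = B" "set (\<mu> a) \<subseteq> V"
      using Rd.prems(1) by auto
    have "calls (?s (\<mu> a # h)) R W (w - 1) (p - 1) Q \<mu>"
      using Rd.prems pos by (intro Rd.IH[OF _ wp]) (auto)
    then obtain r where r: "runs \<mu> (\<mu> a @ ?s h) r" "bounded_by R W (w - 1) (p - 1) r" "Q (final_mem r)"
      unfolding calls_def by auto
    have "runs \<mu> (?s h) (r\<lparr>read_set := insert a (read_set r), io_work := io_work r + 1,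
        io_span := io_span r + 1\<rparr>)"
      using Rd.prems r(1) pos space[of h] B_pos
      by (intro run.run_Read) (auto simp: interp_frame)
    then show ?case
      by (rule callsI) (use r(2,3) pos in \<open>auto simp: bounded_by_def\<close>)
  next
    case (Wr a b k)
    have wp: "wp k (n - 1) R W (w - 1) (p - 1) Q (\<mu>(a := b))"
      and pos: "0 < n" "0 < w" "0 < p" "a \<in> W" "Num a \<in> V" "length b = B" "set b \<subseteq> V"
      using Wr.prems(1) by auto
    have "calls (?s (replicate B Blank # h)) R W (w - 1) (p - 1) Q (\<mu>(a := b))"
      using Wr.prems pos Blank_V by (intro Wr.IH[OF wp]) (auto)
    then obtain r where r: "runs (\<mu>(a := b)) (replicate B Blank @ ?s h) r"
        "bounded_by R W (w - 1) (p - 1) r" "Q (final_mem r)"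
      unfolding calls_def by auto
    have "runs \<mu> (?s h) (r\<lparr>write_set := insert a (write_set r), io_work := io_work r + 1,
        io_span := io_span r + 1\<rparr>)"
      using Wr.prems r(1) pos space[of h] B_pos
      by (intro run.run_Write) (auto simp: interp_frame)
    then show ?case
      by (rule callsI) (use r(2,3) pos in \<open>auto simp: bounded_by_def\<close>)
  next
    case (Fk cs k)
    obtain rs w' p' where rs: "list_all2 (runs \<mu>) cs rs" "race_free rs" "w' \<le> w" "p' \<le> p"
        "\<forall>q\<in>set rs. read_set q \<subseteq> R \<and> write_set q \<subseteq> W \<and> io_span q \<le> p'"
        "sum_list (map io_work rs) \<le> w'"
        and wp: "wp k (n - 1) R W (w - w') (p - p') Q (join_mem \<mu> rs)"
      and pos: "0 < n" "length cs \<le> B" "\<forall>s\<in>set cs. length s \<le> c"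
      using Fk.prems(1) by auto
    have "calls (?s (replicate B Blank # h)) R W (w - w') (p - p') Q (join_mem \<mu> rs)"
      using Fk.prems pos Blank_V by (intro Fk.IH[OF wp]) (auto)
    then obtain r where r: "runs (join_mem \<mu> rs) (replicate B Blank @ ?s h) r"
        "bounded_by R W (w - w') (p - p') r" "Q (final_mem r)"
      unfolding calls_def by auto
    have "Max (insert 0 (set (map io_span rs))) \<le> p'"
      using rs(5) by auto
    then have span: "io_span r + Max (insert 0 (set (map io_span rs))) \<le> p"
      using r(2) rs(4) unfolding bounded_by_def by linarith
    have "runs \<mu> (?s h) (r\<lparr>read_set := read_set r \<union> (\<Union>q\<in>set rs. read_set q),
          write_set := write_set r \<union> (\<Union>q\<in>set rs. write_set q),
          io_work := io_work r + sum_list (map io_work rs),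
          io_span := io_span r + Max (insert 0 (set (map io_span rs)))\<rparr>)"
      using Fk.prems r(1) rs(1,2) pos space[of h] B_pos
      by (intro run.run_Fork) (auto simp: interp_frame)
    then show ?case
      by (rule callsI) (use r(2,3) rs(3-6) span in \<open>auto simp: bounded_by_def\<close>)
  }
qed

lemma calls_body:
  assumes "wp (body B args) 20 R W w p Q \<mu>" "length (frame B args) \<le> c" "set (frame B args) \<subseteq> V"
  shows "calls (frame B args) R W w p Q \<mu>"
  using wp_resume[OF assms(1), of "[]"] assms by simp

lemma wp_FkI:
  assumes "list_all2 (runs \<mu>) cs rs" "race_free rs" "w' \<le> w" "p' \<le> p" "0 < n" "length cs \<le> B"
    and "\<And>s. s \<in> set cs \<Longrightarrow> length s \<le> c"
    and "\<And>q. q \<in> set rs \<Longrightarrow> read_set q \<subseteq> R \<and> write_set q \<subseteq> W \<and> io_span q \<le> p'"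
    and "sum_list (map io_work rs) \<le> w'" "wp k (n - 1) R W (w - w') (p - p') Q (join_mem \<mu> rs)"
  shows "wp (Fk cs k) n R W w p Q \<mu>"
  unfolding wp.simps using assms by blast

lemma wp_mono:
  assumes "wp k n R W w p Q \<mu>" "n \<le> n'" "w \<le> w'" "p \<le> p'" "\<And>\<mu>'. Q \<mu>' \<Longrightarrow> Q' \<mu>'"
  shows "wp k n' R W w' p' Q' \<mu>"
  using assms(1-4)
proof (induction k arbitrary: n w p n' w' p' \<mu>)
  case Done
  then show ?case using assms(5) by simp
next
  case (Rd a f)
  have "wp (f (\<mu> a)) (n' - 1) R W (w' - 1) (p' - 1) Q' \<mu>"
    using Rd.prems by (intro Rd.IH[OF rangeI, of _ "n - 1" "w - 1" "p - 1"]) auto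
  then show ?case using Rd.prems by simp
next
  case (Wr a b k)
  have "wp k (n' - 1) R W (w' - 1) (p' - 1) Q' (\<mu>(a := b))"
    by (rule Wr.IH) (use Wr.prems in \<open>auto simp del: fun_upd_apply\<close>)
  then show ?case using Wr.prems by simp
next
  case (Fk cs k)
  obtain rs v q where rs: "list_all2 (runs \<mu>) cs rs" "race_free rs" "v \<le> w" "q \<le> p"
        "\<forall>r\<in>set rs. read_set r \<subseteq> R \<and> write_set r \<subseteq> W \<and> io_span r \<le> q"
        "sum_list (map io_work rs) \<le> v"
    and wp: "wp k (n - 1) R W (w - v) (p - q) Q (join_mem \<mu> rs)"
    using Fk.prems(1) by auto
  have "wp k (n' - 1) R W (w' - v) (p' - q) Q' (join_mem \<mu> rs)"
    using Fk.prems by (intro Fk.IH[OF wp]) auto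
  then show ?case
    using rs Fk.prems by (intro wp_FkI[of _ _ rs v _ q]) auto
qed

lemma wp_call:
  assumes "calls s R' W' w' p' \<Psi> \<mu>" "R' \<subseteq> R" "W' \<subseteq> W" "w' \<le> w" "p' \<le> p" "0 < n" "length s \<le> c"
    and "\<And>\<mu>'. \<Psi> \<mu>' \<Longrightarrow> (\<forall>a. a \<notin> W' \<longrightarrow> \<mu>' a = \<mu> a) \<Longrightarrow>
      wp k (n - 1) R W (w - w') (p - p') Q \<mu>'"
  shows "wp (Fk [s] k) n R W w p Q \<mu>"
proof -
  obtain r where r: "runs \<mu> s r" "bounded_by R' W' w' p' r" "\<Psi> (final_mem r)"
    using assms(1) unfolding calls_def by blast
  have "join_mem \<mu> [r] = final_mem r"
    using run_unchanged[OF r(1)] by (auto simp: join_mem_def)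
  then have "wp k (n - 1) R W (w - w') (p - p') Q (join_mem \<mu> [r])"
    using assms(8)[OF r(3)] run_unchanged[OF r(1)] r(2) by (auto simp: bounded_by_def)
  then show ?thesis
    using r(1,2) assms(2-7) B_pos
    by (intro wp_FkI[of _ _ "[r]" w' _ p']) (auto simp: bounded_by_def race_free_def)
qed

text \<open>No sibling writes a block that a child may read or write, so on these blocks the joined
  memory is the final memory of that child. Postconditions that depend on these blocks only
  therefore survive the join.\<close>

lemma wp_calls:
  assumes calls: "\<And>q. q < length cs \<Longrightarrow> calls (cs ! q) (R' q) (W' q) (w' q) p' (\<Psi> q) \<mu>"
    and disj: "\<And>q q'. q < length cs \<Longrightarrow> q' < length cs \<Longrightarrow> q \<noteq> q' \<Longrightarrow> W' q \<inter> (R' q' \<union> W' q') = {}"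
    and sub: "\<And>q. q < length cs \<Longrightarrow> R' q \<subseteq> R \<and> W' q \<subseteq> W"
    and cost: "(\<Sum>q<length cs. w' q) \<le> w" "p' \<le> p"
    and "0 < n" "length cs \<le> B" "\<forall>s\<in>set cs. length s \<le> c"
    and post: "\<And>\<mu>'. (\<And>q. q < length cs \<Longrightarrow> \<exists>\<mu>q. \<Psi> q \<mu>q \<and> (\<forall>a\<in>R' q \<union> W' q. \<mu>' a = \<mu>q a)) \<Longrightarrow> Q \<mu>'"
  shows "wp (Fk cs Done) n R W w p Q \<mu>"
proof -
  obtain f where f: "\<And>q. q < length cs \<Longrightarrow>
      runs \<mu> (cs ! q) (f q) \<and> bounded_by (R' q) (W' q) (w' q) p' (f q) \<and> \<Psi> q (final_mem (f q))"
    using calls unfolding calls_def by metis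
  define rs where "rs = map f [0..<length cs]"
  have len: "length rs = length cs" and nth: "\<And>q. q < length cs \<Longrightarrow> rs ! q = f q"
    by (simp_all add: rs_def)
  have sets: "read_set (f q) \<subseteq> R' q" "write_set (f q) \<subseteq> W' q" "io_work (f q) \<le> w' q" "io_span (f q) \<le> p'"
    if "q < length cs" for q
    using f[OF that] by (simp_all add: bounded_by_def)
  have "race_free rs"
    unfolding race_free_def len
  proof (intro allI impI)
    fix i j assume ij: "i < length cs" "j < length cs" "i \<noteq> j"
    show "write_set (rs ! i) \<inter> (read_set (rs ! j) \<union> write_set (rs ! j)) = {}"
      using disj[OF ij] sets[OF ij(1)] sets[OF ij(2)] by (auto simp: nth ij)
  qed
  moreover have "list_all2 (runs \<mu>) cs rs"
    using f by (auto simp: list_all2_conv_all_nth len nth)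
  moreover have "sum_list (map io_work rs) \<le> w"
  proof -
    have "sum_list (map io_work rs) = (\<Sum>q<length cs. io_work (f q))"
      by (simp add: rs_def o_def interv_sum_list_conv_sum_set_nat atLeast0LessThan)
    also have "\<dots> \<le> (\<Sum>q<length cs. w' q)" using sets by (intro sum_mono) auto
    finally show ?thesis using cost by simp
  qed
  moreover have "Q (join_mem \<mu> rs)"
  proof (rule post)
    fix q assume q: "q < length cs"
    have "join_mem \<mu> rs a = final_mem (f q) a" if "a \<in> R' q \<union> W' q" for a
    proof (cases "\<exists>j<length cs. a \<in> write_set (f j)")
      case True
      then obtain j where j: "j < length cs" "a \<in> write_set (f j)" by blast
      have uniq: "j = i" if "i < length cs" "a \<in> write_set (f i)" for i
        using disj[of j i] j that sets[of i] sets[of j] by blast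
      have "j = q" using disj[of j q] j q that sets[of j] by blast
      have "\<exists>r. find (\<lambda>r. a \<in> write_set r) rs = Some r"
        using j len nth by (metis (mono_tags, lifting) find_None_iff2 nth_mem option.exhaust)
      then obtain r where r: "find (\<lambda>r. a \<in> write_set r) rs = Some r" by blast
      then obtain i where "i < length cs" "r = rs ! i" "a \<in> write_set r"
        by (auto simp: find_Some_iff len)
      then have "r = f q" using uniq \<open>j = q\<close> nth by metis
      then show ?thesis using r by (simp add: join_mem_def)
    next
      case False
      then have "find (\<lambda>r. a \<in> write_set r) rs = None"
        by (auto simp: find_None_iff rs_def)
      moreover have "final_mem (f q) a = \<mu> a"
        using f[OF q] False q by (auto intro: run_unchanged)
      ultimately show ?thesis by (simp add: join_mem_def)
    qed
    then show "\<exists>\<mu>q. \<Psi> q \<mu>q \<and> (\<forall>a\<in>R' q \<union> W' q. join_mem \<mu> rs a = \<mu>q a)"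
      using f[OF q] by blast
  qed
  moreover have "\<forall>r\<in>set rs. read_set r \<subseteq> R \<and> write_set r \<subseteq> W \<and> io_span r \<le> p'"
    using sets sub by (fastforce simp: rs_def)
  ultimately show ?thesis
    using assms(6-8) cost(2) by (intro wp_FkI[of _ _ rs w _ p']) auto
qed

end

section \<open>Interleaving keys and subtrees\<close>

text \<open>The inorder sequence of a node, from its keys and the inorder sequences of its subtrees.
  The same function merges the key lists of adjacent nodes with their separators.\<close>

fun mix :: "'a list \<Rightarrow> 'a list list \<Rightarrow> 'a list" where
  "mix (k # ks) (x # xs) = x @ k # mix ks xs"
| "mix [] (x # xs) = x"
| "mix ks [] = []"

lemma mix_append:
  "length xs = length ks + 1 \<Longrightarrow> mix (ks @ k # ks') (xs @ ys) = mix ks xs @ k # mix ks' ys"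
proof (induction ks arbitrary: xs)
  case Nil
  then show ?case by (cases xs) auto
next
  case (Cons a ks)
  then show ?case by (cases xs) auto
qed

lemma set_mix: "length xs = length ks + 1 \<Longrightarrow> set (mix ks xs) = set ks \<union> (\<Union>x\<in>set xs. set x)"
proof (induction ks arbitrary: xs)
  case Nil
  then show ?case by (cases xs) auto
next
  case (Cons a ks)
  then show ?case by (cases xs) auto
qed

lemma length_mix:
  "length xs = length ks + 1 \<Longrightarrow> length (mix ks xs) = length ks + sum_list (map length xs)"
proof (induction ks arbitrary: xs)
  case Nil
  then show ?case by (cases xs) auto
next
  case (Cons a ks)
  then show ?case by (cases xs) auto
qed

text \<open>Adjacent nodes with their separators amount to one fat node that has all their keys and
  children. This justifies both opening a row of nodes and grouping subtrees into new nodes.\<close>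

lemma mix_fat:
  assumes "length nds = length ss + 1" "\<forall>(k, x)\<in>set nds. length x = length k + 1"
  shows "mix ss (map (\<lambda>(k, x). mix k x) nds) = mix (mix ss (map fst nds)) (concat (map snd nds))"
    and "length (concat (map snd nds)) = length (mix ss (map fst nds)) + 1"
  using assms
proof (induction ss arbitrary: nds)
  case Nil
  { case 1 then show ?case by (cases nds) auto }
  { case 2 then show ?case by (cases nds) auto }
next
  case (Cons s ss)
  { case 1 then show ?case by (cases nds) (auto simp: Cons.IH mix_append) }
  { case 2 then show ?case using Cons.IH(2)[of "tl nds"] by (cases nds) auto }
qed

lemma mix_rev:
  "length xs = length ks + 1 \<Longrightarrow> mix (rev ks) (rev xs) = rev (mix ks (map rev xs))"
proof (induction ks arbitrary: xs)
  case Nil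
  then show ?case by (cases xs) auto
next
  case (Cons a ks)
  then obtain x xs' where "xs = x # xs'" "length xs' = length ks + 1" by (cases xs) auto
  then show ?case using Cons.IH[of xs'] by (simp add: mix_append)
qed

lemma mix_split:
  assumes "length xs = length ks + 1" "i < length ks"
  shows "mix ks xs = mix (take i ks) (take (Suc i) xs) @ ks ! i # mix (drop (Suc i) ks) (drop (Suc i) xs)"
proof -
  have "mix (take i ks @ ks ! i # drop (Suc i) ks) (take (Suc i) xs @ drop (Suc i) xs) =
      mix (take i ks) (take (Suc i) xs) @ ks ! i # mix (drop (Suc i) ks) (drop (Suc i) xs)"
    by (rule mix_append) (use assms in auto)
  then show ?thesis using assms by (simp add: id_take_nth_drop[symmetric])
qed

section \<open>Cutting a fat node at a boundary\<close>

definition cut_left :: "('a \<Rightarrow> bool) \<Rightarrow> 'a list \<Rightarrow> 'c list \<Rightarrow> 'a list \<times> 'c list" where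
  "cut_left P ks xs = (dropWhile P ks, drop (length (takeWhile P ks)) xs)"

definition cut_right :: "('a \<Rightarrow> bool) \<Rightarrow> 'a list \<Rightarrow> 'c list \<Rightarrow> 'a list \<times> 'c list" where
  "cut_right Q ks xs =
     (takeWhile (\<lambda>k. \<not> Q k) ks, take (Suc (length (takeWhile (\<lambda>k. \<not> Q k) ks))) xs)"

text \<open>By the sortedness premise, \<open>P\<close> is inherited by predecessors in the inorder
  sequence, so everything up to the last dropped key satisfies \<open>P\<close>. The subtree in
  front of the first remaining key stays, since the cut may pass through it; only the keys
  \<open>ks'\<close> are known to violate \<open>P\<close>.\<close>

lemma cut_left:
  assumes "length xs = length ks + 1" "cut_left P ks xs = (ks', xs')"
    and "sorted_wrt (\<lambda>a b. P b \<longrightarrow> P a) (mix ks (map f xs))"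
  shows "length xs' = length ks' + 1"
    and "\<exists>ys. mix ks (map f xs) = ys @ mix ks' (map f xs') \<and> (\<forall>y\<in>set ys. P y)"
    and "\<forall>k\<in>set ks'. \<not> P k"
proof -
  define i where "i = length (takeWhile P ks)"
  have i: "i \<le> length ks" by (simp add: i_def length_takeWhile_le)
  have def: "ks' = drop i ks" "xs' = drop i xs"
    using assms(2) by (auto simp: cut_left_def i_def dropWhile_eq_drop)
  show "length xs' = length ks' + 1" using assms(1) i by (simp add: def)
  show "\<exists>ys. mix ks (map f xs) = ys @ mix ks' (map f xs') \<and> (\<forall>y\<in>set ys. P y)"
  proof (cases i)
    case 0
    then show ?thesis by (auto simp: def)
  next
    case (Suc j)
    have "P (ks ! j)" using Suc takeWhile_nth[of j P ks] set_takeWhileD[of "ks ! j" P ks]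
      by (metis i_def lessI nth_mem)
    moreover have eq: "mix ks (map f xs) = mix (take j ks) (map f (take (Suc j) xs)) @ ks ! j # mix ks' (map f xs')"
      using mix_split[of "map f xs" ks j] assms(1) i Suc by (simp add: def drop_map take_map)
    ultimately show ?thesis
      using assms(3) unfolding eq
      by (intro exI[of _ "mix (take j ks) (map f (take (Suc j) xs)) @ [ks ! j]"]) (auto simp: sorted_wrt_append)
  qed
  show "\<forall>k\<in>set ks'. \<not> P k"
  proof (cases ks')
    case (Cons k ks2)
    then have "\<not> P k" using assms(2) by (auto simp: cut_left_def dropWhile_eq_Cons_conv)
    moreover have "sorted_wrt (\<lambda>a b. P b \<longrightarrow> P a) (mix ks' (map f xs'))"
      using assms(3) \<open>\<exists>ys. _\<close> by (auto simp: sorted_wrt_append)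
    moreover have "set ks2 \<subseteq> set (mix ks2 (map f (tl xs')))"
      using \<open>length xs' = _\<close> Cons by (subst set_mix) auto
    ultimately show ?thesis
      using Cons \<open>length xs' = _\<close> by (cases xs') (auto simp: sorted_wrt_append)
  qed simp
qed

lemma cut_right:
  assumes "length xs = length ks + 1" "cut_right Q ks xs = (ks', xs')"
    and "sorted_wrt (\<lambda>a b. Q a \<longrightarrow> Q b) (mix ks (map f xs))"
  shows "length xs' = length ks' + 1"
    and "\<exists>ys. mix ks (map f xs) = mix ks' (map f xs') @ ys \<and> (\<forall>y\<in>set ys. Q y)"
    and "\<forall>k\<in>set ks'. \<not> Q k"
proof -
  define j where "j = length (takeWhile (\<lambda>k. \<not> Q k) ks)"
  have j: "j \<le> length ks" by (simp add: j_def length_takeWhile_le)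
  have def: "ks' = take j ks" "xs' = take (Suc j) xs"
    using assms(2) by (auto simp: cut_right_def j_def simp flip: takeWhile_eq_take)
  show "length xs' = length ks' + 1" using assms(1) j by (simp add: def)
  show "\<exists>ys. mix ks (map f xs) = mix ks' (map f xs') @ ys \<and> (\<forall>y\<in>set ys. Q y)"
  proof (cases "j = length ks")
    case True
    then show ?thesis using assms(1) by (auto simp: def)
  next
    case False
    then have "j < length ks" using j by simp
    then have "Q (ks ! j)" using nth_length_takeWhile[of "\<lambda>k. \<not> Q k" ks] by (simp add: j_def)
    moreover have eq: "mix ks (map f xs) = mix ks' (map f xs') @ ks ! j # mix (drop (Suc j) ks) (map f (drop (Suc j) xs))"
      using mix_split[of "map f xs" ks j] assms(1) \<open>j < _\<close> by (simp add: def drop_map take_map)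
    ultimately show ?thesis
      using assms(3) unfolding eq by (auto simp: sorted_wrt_append)
  qed
  show "\<forall>k\<in>set ks'. \<not> Q k"
    using assms(2) set_takeWhileD unfolding cut_right_def by fastforce
qed

text \<open>The position of the cut depends on the keys alone, so the program can cut pointers where
  the proof cuts trees.\<close>

lemma list_all2_cut_left:
  assumes "list_all2 R xs ys" "cut_left P ks xs = (ks', xs')"
  shows "\<exists>ys'. cut_left P ks ys = (ks', ys') \<and> list_all2 R xs' ys'"
  using assms by (auto simp: cut_left_def intro: list_all2_dropI)

lemma list_all2_cut_right:
  assumes "list_all2 R xs ys" "cut_right P ks xs = (ks', xs')"
  shows "\<exists>ys'. cut_right P ks ys = (ks', ys') \<and> list_all2 R xs' ys'"
  using assms by (auto simp: cut_right_def intro: list_all2_takeI)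

abbreviation mindeg :: "nat \<Rightarrow> nat" where
  "mindeg B \<equiv> (B + 1) div 2"

section \<open>Grouping subtrees into nodes\<close>

text \<open>
  A node takes as many subtrees as possible, but leaves enough of them for one further node.
\<close>

function chunk :: "nat \<Rightarrow> 'a list \<Rightarrow> 'c list \<Rightarrow> 'a list \<times> ('a list \<times> 'c list) list" where
  "chunk B ks xs =
     (if length xs \<le> B \<or> B < 2 then ([], [(ks, xs)])
      else let n = min B (length xs - mindeg B); (ss, nds) = chunk B (drop n ks) (drop n xs)
        in (ks ! (n - 1) # ss, (take (n - 1) ks, take n xs) # nds))"
  by auto
termination by (relation "measure (\<lambda>(B, ks, xs). length xs)") auto

declare chunk.simps [simp del]

lemma chunk_le: "length xs \<le> B \<Longrightarrow> chunk B ks xs = ([], [(ks, xs)])"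
  by (subst chunk.simps) simp

lemma chunk_gt:
  assumes "B < length xs" "2 \<le> B" "n = min B (length xs - mindeg B)"
    and "chunk B (drop n ks) (drop n xs) = (ss, nds)"
  shows "chunk B ks xs = (ks ! (n - 1) # ss, (take (n - 1) ks, take n xs) # nds)"
  by (subst chunk.simps) (use assms in \<open>simp add: Let_def\<close>)

text \<open>If there are more than \<open>B\<close> subtrees, then besides the
  \<open>mindeg B\<close> reserved ones at least \<open>B + 1 - mindeg B \<ge> mindeg B\<close> are
  available, so the group is large enough; the reserve keeps the rest large enough as well.\<close>

lemma chunk:
  assumes "chunk B ks xs = (ss, nds)" "length xs = length ks + 1" "2 \<le> B"
  shows "mix ss (map fst nds) = ks" "concat (map snd nds) = xs" "length nds = length ss + 1"
    and "\<forall>(k, x)\<in>set nds. length x = length k + 1 \<and> length x \<le> B"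
    and "mindeg B \<le> length xs \<longrightarrow> (\<forall>(k, x)\<in>set nds. mindeg B \<le> length x)"
    and "length xs \<le> B * q \<Longrightarrow> 0 < q \<Longrightarrow> length nds \<le> q"
    and "length xs \<le> B \<longleftrightarrow> nds = [(ks, xs)]"
proof -
  have "mix ss (map fst nds) = ks \<and> concat (map snd nds) = xs \<and> length nds = length ss + 1 \<and>
    (\<forall>(k, x)\<in>set nds. length x = length k + 1 \<and> length x \<le> B) \<and>
    (mindeg B \<le> length xs \<longrightarrow> (\<forall>(k, x)\<in>set nds. mindeg B \<le> length x)) \<and>
    (\<forall>q>0. length xs \<le> B * q \<longrightarrow> length nds \<le> q)"
    using assms
  proof (induction B ks xs arbitrary: ss nds rule: chunk.induct)
    case (1 B ks xs)
    show ?case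
    proof (cases "length xs \<le> B")
      case True
      then have "ss = []" "nds = [(ks, xs)]"
        using 1(2) by (simp_all add: chunk_le)
      then show ?thesis using True 1(3) by auto
    next
      case False
      define m where "m = mindeg B"
      define n where "n = min B (length xs - m)"
      have m: "m \<le> B" "B \<le> 2 * m" "2 * m \<le> B + 1" using 1(4) by (auto simp: m_def)
      obtain ss' nds' where c: "chunk B (drop n ks) (drop n xs) = (ss', nds')"
        by (metis surj_pair)
      have eq: "ss = ks ! (n - 1) # ss'" "nds = (take (n - 1) ks, take n xs) # nds'"
        using chunk_gt[OF _ \<open>2 \<le> B\<close> _ c] False 1(2) by (simp_all add: n_def m_def)
      have n: "0 < n" "n < length xs" "m \<le> n" "m \<le> length xs - n" "n \<le> B"
        using False m \<open>2 \<le> B\<close> by (auto simp: n_def)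
      have "\<not> (length xs \<le> B \<or> B < 2)" "n = min B (length xs - mindeg B)"
        using False \<open>2 \<le> B\<close> by (auto simp: n_def m_def)
      moreover have "length (drop n xs) = length (drop n ks) + 1"
        using n 1(3) by simp
      note IH0 = 1(1)[OF calculation c this \<open>2 \<le> B\<close>, folded m_def, unfolded length_drop]
      have IH: "mix ss' (map fst nds') = drop n ks" "concat (map snd nds') = drop n xs"
        "length nds' = length ss' + 1" "\<forall>(k, x)\<in>set nds'. length x = length k + 1 \<and> length x \<le> B"
        "m \<le> length xs - n \<longrightarrow> (\<forall>(k, x)\<in>set nds'. m \<le> length x)"
        "\<And>q. 0 < q \<Longrightarrow> length xs - n \<le> B * q \<Longrightarrow> length nds' \<le> q"
        using IH0 by blast+
      have "mix ss (map fst nds) = ks"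
        using IH(1) id_take_nth_drop[of "n - 1" ks] n 1(3) unfolding eq by simp
      moreover have "concat (map snd nds) = xs" using IH(2) unfolding eq by simp
      moreover have "length nds = length ss + 1" using IH(3) unfolding eq by simp
      moreover have "\<forall>(k, x)\<in>set nds. length x = length k + 1 \<and> length x \<le> B"
        using IH(4) n 1(3) unfolding eq by simp
      moreover have "\<forall>(k, x)\<in>set nds. m \<le> length x"
        using IH(5) n unfolding eq by simp
      \<comment> \<open>A group has fewer than \<open>B\<close> subtrees only if exactly
        \<open>mindeg B\<close> are left, which fit into one more node. So no additional node arises
        from the reserve.\<close>
      moreover have "length nds \<le> q" if q: "0 < q" "length xs \<le> B * q" for q
      proof -
        obtain q' where q': "q = Suc q'" "0 < q'"
          using q False \<open>2 \<le> B\<close> by (cases q; cases "q - 1") auto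
        have "B \<le> B * q'" using q'(2) by simp
        moreover have "length xs \<le> B + B * q'" using q q'(1) by simp
        ultimately have "length xs - n \<le> B * q'" using m unfolding n_def by linarith
        then show ?thesis using IH(6) q' unfolding eq by simp
      qed
      ultimately show ?thesis unfolding m_def by blast
    qed
  qed
  then show "mix ss (map fst nds) = ks" "concat (map snd nds) = xs" "length nds = length ss + 1"
    "\<forall>(k, x)\<in>set nds. length x = length k + 1 \<and> length x \<le> B"
    "mindeg B \<le> length xs \<longrightarrow> (\<forall>(k, x)\<in>set nds. mindeg B \<le> length x)"
    "length xs \<le> B * q \<Longrightarrow> 0 < q \<Longrightarrow> length nds \<le> q"
    by blast+
  show "length xs \<le> B \<longleftrightarrow> nds = [(ks, xs)]"
  proof
    assume "nds = [(ks, xs)]"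
    then show "length xs \<le> B"
      using \<open>\<forall>(k, x)\<in>set nds. length x = length k + 1 \<and> length x \<le> B\<close> by simp
  qed (use assms(1) in \<open>simp add: chunk_le\<close>)
qed

text \<open>The program groups pointers; since grouping goes by position, the trees behind the
  pointers are partitioned in the same way.\<close>

lemma chunk_transfer:
  assumes "concat (map snd nds) = xs" "list_all2 R xs ys"
  shows "\<exists>nds'. concat (map snd nds') = ys \<and>
    list_all2 (\<lambda>(k, x) (k', y). k = k' \<and> list_all2 R x y) nds nds'"
  using assms
proof (induction nds arbitrary: xs ys)
  case (Cons nd nds)
  then obtain y1 y2 where y: "ys = y1 @ y2" "list_all2 R (snd nd) y1"
      "list_all2 R (concat (map snd nds)) y2"
    by (auto simp: list_all2_append1)
  from Cons.IH[OF refl y(3)] obtain nds' where "concat (map snd nds') = y2"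
      "list_all2 (\<lambda>(k, x) (k', y). k = k' \<and> list_all2 R x y) nds nds'" by blast
  then have "concat (map snd ((fst nd, y1) # nds')) = ys \<and>
      list_all2 (\<lambda>(k, x) (k', y). k = k' \<and> list_all2 R x y) (nd # nds) ((fst nd, y1) # nds')"
    using y by (simp add: case_prod_beta)
  then show ?case by blast
qed simp

section \<open>Shape and inorder sequence of a B-tree\<close>

fun sh :: "nat \<Rightarrow> nat \<Rightarrow> nat \<Rightarrow> 'k btree \<Rightarrow> bool" where
  "sh B lo h External \<longleftrightarrow> h = 0"
| "sh B lo h (Node ks ts) \<longleftrightarrow> 0 < h \<and> length ts = length ks + 1 \<and> lo \<le> length ts \<and> length ts \<le> B \<and>
     (\<forall>t\<in>set ts. sh B (mindeg B) (h - 1) t)"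

fun ino :: "'k btree \<Rightarrow> 'k list" where
  "ino External = []"
| "ino (Node ks ts) = mix ks (map ino ts)"

lemma half_ceiling: "nat \<lceil>real B / 2\<rceil> = mindeg B"
proof -
  have "\<lceil>real B / 2\<rceil> = int ((B + 1) div 2)"
    by (rule ceiling_unique) (cases "even B"; auto elim!: evenE oddE)+
  then show ?thesis by simp
qed

lemma sh_mono: "sh B lo h t \<Longrightarrow> lo' \<le> lo \<Longrightarrow> sh B lo' h t"
  by (cases t) auto

lemma set_ino: "sh B lo h t \<Longrightarrow> set (ino t) = keys t"
proof (induction t arbitrary: lo h)
  case (Node ks ts)
  have "set (ino t) = keys t" if "t \<in> set ts" for t
    using Node that by auto
  then show ?case using Node.prems by (auto simp: set_mix)
qed simp

lemma height_le_length_ino: "sh B lo h t \<Longrightarrow> 2 \<le> lo \<Longrightarrow> 3 \<le> B \<Longrightarrow> h \<le> length (ino t)"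
proof (induction t arbitrary: lo h)
  case (Node ks ts)
  obtain t ts' where ts: "ts = t # ts'" "ks \<noteq> []" using Node.prems by (cases ts; cases ks) auto
  have "h - 1 \<le> length (ino t)"
    using Node.prems ts by (intro Node.IH[of t "mindeg B"]) auto
  moreover have "length (ino (Node ks ts)) = length ks + sum_list (map length (map ino ts))"
    using Node.prems by (simp only: ino.simps, subst length_mix) auto
  ultimately show ?case using ts by (cases ks) auto
qed simp

text \<open>A B-tree compares each key only with the two subtrees next to it. All other comparisons
  follow by transitivity through the separators in between, which is the step
  \<open>above\<close>.\<close>

lemma sorted_mix:
  fixes ks :: "'k::linorder list"
  assumes "length xs = length ks + 1"
  shows "sorted_wrt (<) (mix ks xs) \<longleftrightarrow> sorted_wrt (<) ks \<and> (\<forall>x\<in>set xs. sorted_wrt (<) x) \<and>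
    (\<forall>i<length ks. (\<forall>y\<in>set (xs ! i). y < ks ! i) \<and> (\<forall>y\<in>set (xs ! (i + 1)). ks ! i < y))"
  using assms
proof (induction ks arbitrary: xs)
  case Nil
  then show ?case by (cases xs) auto
next
  case (Cons k ks)
  then obtain x xs' where xs: "xs = x # xs'" "length xs' = length ks + 1" by (cases xs) auto
  let ?adj = "\<lambda>ks xs. \<forall>i<length ks. (\<forall>y\<in>set (xs ! i). y < ks ! i) \<and> (\<forall>y\<in>set (xs ! (i + 1)). ks ! i < y)"
  have adj: "?adj (k # ks) xs \<longleftrightarrow> (\<forall>y\<in>set x. y < k) \<and> (\<forall>y\<in>set (xs' ! 0). k < y) \<and> ?adj ks xs'"
    unfolding xs(1) by (auto simp: less_Suc_eq_0_disj)
  have above: "\<forall>y\<in>set (mix ks xs'). k < y"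
    if "sorted_wrt (<) (k # ks)" "\<forall>y\<in>set (xs' ! 0). k < y" "?adj ks xs'"
  proof -
    have "k < y" if y: "y \<in> set (xs' ! i)" and "i < length xs'" for i y
    proof (cases i)
      case (Suc j)
      then have "ks ! j < y" "k < ks ! j"
        using y \<open>?adj ks xs'\<close> \<open>i < length xs'\<close> \<open>sorted_wrt (<) (k # ks)\<close> xs(2) by auto
      then show ?thesis by simp
    qed (use y \<open>\<forall>y\<in>set (xs' ! 0). k < y\<close> in auto)
    then show ?thesis
      using that(1) xs(2) by (auto simp: set_mix in_set_conv_nth[of _ xs'])
  qed
  have sub: "set (xs' ! 0) \<subseteq> set (mix ks xs')" "set ks \<subseteq> set (mix ks xs')"
    using xs(2) by (auto simp: set_mix intro!: bexI[of _ "xs' ! 0"])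
  have eq: "sorted_wrt (<) (mix (k # ks) xs) \<longleftrightarrow> sorted_wrt (<) x \<and> (\<forall>y\<in>set x. y < k) \<and>
      (\<forall>z\<in>set (mix ks xs'). k < z) \<and> sorted_wrt (<) (mix ks xs')"
    unfolding xs(1) by (simp add: sorted_wrt_append) (meson less_trans)
  show ?case
  proof
    assume l: "sorted_wrt (<) (mix (k # ks) xs)"
    then have "\<forall>y\<in>set (xs' ! 0). k < y" "\<forall>y\<in>set ks. k < y" using eq sub by blast+
    then show "sorted_wrt (<) (k # ks) \<and> (\<forall>x\<in>set xs. sorted_wrt (<) x) \<and> ?adj (k # ks) xs"
      using l unfolding eq adj Cons.IH[OF xs(2)] by (simp add: xs(1))
  next
    assume r: "sorted_wrt (<) (k # ks) \<and> (\<forall>x\<in>set xs. sorted_wrt (<) x) \<and> ?adj (k # ks) xs"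
    then have "\<forall>y\<in>set (mix ks xs'). k < y" using above adj by blast
    then show "sorted_wrt (<) (mix (k # ks) xs)"
      using r unfolding eq adj Cons.IH[OF xs(2)] by (simp add: xs(1))
  qed
qed

lemma external_depths_nonempty: "btree_node B lo t \<Longrightarrow> external_depths t \<noteq> {}"
proof (induction t arbitrary: lo)
  case (Node ks ts)
  obtain t where "t \<in> set ts" using Node.prems by (cases ts) auto
  then have "external_depths t \<noteq> {}" using Node.IH Node.prems by auto
  then show ?case using \<open>t \<in> set ts\<close> by auto
qed simp

text \<open>Separating the shape from the order pays off whenever subtrees are regrouped: the
  inorder sequence does not change, so only the degrees need attention.\<close>

lemma btree_node_iff_sh:
  "btree_node B lo t \<and> external_depths t = {h} \<longleftrightarrow> sh B lo h t \<and> sorted_wrt (<) (ino t)"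
proof (induction t arbitrary: lo h)
  case External
  then show ?case by auto
next
  case (Node ks ts)
  let ?m = "mindeg B"
  show ?case
  proof (cases "length ts = length ks + 1")
    case True
    have depths: "external_depths (Node ks ts) = {h} \<longleftrightarrow> 0 < h \<and> (\<forall>t\<in>set ts. external_depths t = {h - 1})"
      if "\<forall>t\<in>set ts. btree_node B ?m t"
    proof -
      have ne: "\<forall>t\<in>set ts. external_depths t \<noteq> {}" using that external_depths_nonempty by blast
      have "ts \<noteq> []" using True by auto
      show ?thesis
      proof
        assume eq: "external_depths (Node ks ts) = {h}"
        have "x = h - 1" "0 < h" if "t \<in> set ts" "x \<in> external_depths t" for t x
        proof -
          have "Suc x \<in> external_depths (Node ks ts)" using that by auto
          then show "x = h - 1" "0 < h" using eq by auto
        qed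
        then show "0 < h \<and> (\<forall>t\<in>set ts. external_depths t = {h - 1})"
          using ne \<open>ts \<noteq> []\<close> by (metis all_not_in_conv insertI1 insert_iff last_in_set subsetI subset_singletonD)
      next
        assume "0 < h \<and> (\<forall>t\<in>set ts. external_depths t = {h - 1})"
        then show "external_depths (Node ks ts) = {h}" using \<open>ts \<noteq> []\<close> by (cases ts) auto
      qed
    qed
    have sorted: "sorted_wrt (<) (ino (Node ks ts)) \<longleftrightarrow> sorted_wrt (<) ks \<and> (\<forall>t\<in>set ts. sorted_wrt (<) (ino t)) \<and>
      (\<forall>i<length ks. (\<forall>x\<in>keys (ts ! i). x < ks ! i) \<and> (\<forall>x\<in>keys (ts ! (i + 1)). ks ! i < x))"
      if "\<forall>t\<in>set ts. sh B ?m (h - 1) t"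
    proof -
      have "set (ino (ts ! i)) = keys (ts ! i)" if "i < length ts" for i
        using \<open>\<forall>t\<in>set ts. _\<close> that by (meson nth_mem set_ino)
      then show ?thesis using True by (simp add: sorted_mix)
    qed
    show ?thesis
    proof
      assume l: "btree_node B lo (Node ks ts) \<and> external_depths (Node ks ts) = {h}"
      then have ch: "\<forall>t\<in>set ts. btree_node B ?m t" by (simp add: half_ceiling)
      then have "\<forall>t\<in>set ts. sh B ?m (h - 1) t \<and> sorted_wrt (<) (ino t)" "0 < h"
        using depths l Node.IH by blast+
      then show "sh B lo h (Node ks ts) \<and> sorted_wrt (<) (ino (Node ks ts))"
        using sorted l by simp
    next
      assume r: "sh B lo h (Node ks ts) \<and> sorted_wrt (<) (ino (Node ks ts))"
      then have "\<forall>t\<in>set ts. sh B ?m (h - 1) t \<and> sorted_wrt (<) (ino t)"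
        using sorted by auto
      then have "\<forall>t\<in>set ts. btree_node B ?m t \<and> external_depths t = {h - 1}"
        using Node.IH by blast
      then show "btree_node B lo (Node ks ts) \<and> external_depths (Node ks ts) = {h}"
        using depths sorted r by (simp add: half_ceiling)
    qed
  qed auto
qed

lemma btree_iff_sh: "btree B t \<longleftrightarrow> (\<exists>h. sh B 2 h t) \<and> sorted_wrt (<) (ino t)"
  using btree_node_iff_sh[of B 2 t] by (auto simp: btree_def)

text \<open>Trimming at a right boundary is trimming at a left boundary of the mirror image, so one
  correctness proof serves both.\<close>

fun mir :: "'k btree \<Rightarrow> 'k btree" where
  "mir External = External"
| "mir (Node ks ts) = Node (rev ks) (rev (map mir ts))"

lemma mir_mir [simp]: "mir (mir t) = t"
  by (induction t) (auto simp: rev_map o_def map_idI)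

lemma sh_mir [simp]: "sh B lo h (mir t) = sh B lo h t"
  by (induction t arbitrary: lo h) auto

lemma ino_mir: "sh B lo h t \<Longrightarrow> ino (mir t) = rev (ino t)"
proof (induction t arbitrary: lo h)
  case (Node ks ts)
  have "ino (mir t) = rev (ino t)" if "t \<in> set ts" for t
    using Node that by auto
  then have "map ino (rev (map mir ts)) = rev (map rev (map ino ts))" by (simp add: rev_map)
  then show ?case
    using mix_rev[of "map rev (map ino ts)" ks] Node.prems
    by (simp only: mir.simps ino.simps) (simp add: o_def)
qed simp

section \<open>Weighted counts of keys\<close>

text \<open>Each key is paired with the height of its node, which decides how much it is
  charged.\<close>

fun levels :: "nat \<Rightarrow> 'k btree \<Rightarrow> ('k \<times> nat) set" where
  "levels h External = {}"
| "levels h (Node ks ts) = set ks \<times> {h} \<union> (\<Union>t\<in>set ts. levels (h - 1) t)"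

text \<open>An upper bound for sums over \<open>levels\<close> that counts with multiplicity, so
  that its recursion needs no disjointness of subtrees.\<close>

fun weight :: "(nat \<Rightarrow> nat) \<Rightarrow> nat \<Rightarrow> 'k btree \<Rightarrow> nat" where
  "weight \<phi> h External = 0"
| "weight \<phi> h (Node ks ts) = length ks * \<phi> h + sum_list (map (weight \<phi> (h - 1)) ts)"

lemma finite_levels: "finite (levels h t)"
  by (induction t arbitrary: h) auto

lemma sum_Un_le: "finite A \<Longrightarrow> finite C \<Longrightarrow> sum f (A \<union> C) \<le> sum f A + (sum f C :: nat)"
  using sum.union_inter[of A C f] by linarith

lemma sum_UN_list_le:
  "(\<And>t. t \<in> set ts \<Longrightarrow> finite (A t)) \<Longrightarrow>
    sum f (\<Union>t\<in>set ts. A t) \<le> sum_list (map (\<lambda>t. sum f (A t) :: nat) ts)"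
proof (induction ts)
  case (Cons t ts)
  then show ?case
    using sum_Un_le[of "A t" "\<Union>t\<in>set ts. A t" f] by simp
qed simp

lemma sum_levels_le_weight: "(\<Sum>p\<in>levels h t. \<phi> (snd p)) \<le> weight \<phi> h t"
proof (induction t arbitrary: h)
  case (Node ks ts)
  let ?f = "\<lambda>p. \<phi> (snd p)"
  have "sum ?f (levels h (Node ks ts)) \<le> sum ?f (set ks \<times> {h}) + sum ?f (\<Union>t\<in>set ts. levels (h - 1) t)"
    unfolding levels.simps by (intro sum_Un_le) (auto simp: finite_levels)
  also have "sum ?f (set ks \<times> {h}) = card (set ks) * \<phi> h"
    using sum.cartesian_product[of "\<lambda>_. \<phi>" "{h}" "set ks"] by (simp add: case_prod_beta)
  also have "\<dots> \<le> length ks * \<phi> h" by (simp add: card_length)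
  also have "sum ?f (\<Union>t\<in>set ts. levels (h - 1) t) \<le> sum_list (map (\<lambda>t. sum ?f (levels (h - 1) t)) ts)"
    by (intro sum_UN_list_le) (simp add: finite_levels)
  also have "\<dots> \<le> sum_list (map (weight \<phi> (h - 1)) ts)"
    using Node by (intro sum_list_mono) auto
  finally show ?case by simp
qed simp

lemma sum_list_add_const_le:
  fixes f g :: "'a \<Rightarrow> nat"
  shows "\<forall>t\<in>set ts. f t + c \<le> g t \<Longrightarrow> sum_list (map f ts) + length ts * c \<le> sum_list (map g ts)"
  by (induction ts) auto

text \<open>One more than the number of keys is the number of external nodes, which is additive over
  the subtrees.\<close>

lemma length_ino_Node:
  "length ts = length ks + 1 \<Longrightarrow> length (ino (Node ks ts)) + 1 = sum_list (map (\<lambda>t. length (ino t) + 1) ts)"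
  using length_mix[of "map ino ts" ks] by (simp add: sum_list_Suc o_def)

lemma length_ino_ge:
  "sh B (mindeg B) h t \<Longrightarrow> (mindeg B) ^ h \<le> length (ino t) + 1"
proof (induction t arbitrary: h)
  case (Node ks ts)
  let ?m = "mindeg B"
  have "\<forall>t\<in>set ts. ?m ^ (h - 1) \<le> length (ino t) + 1"
    using Node.prems Node.IH by auto
  then have "length ts * ?m ^ (h - 1) \<le> length (ino (Node ks ts)) + 1"
    using sum_list_add_const_le[of ts "\<lambda>_. 0" "?m ^ (h - 1)" "\<lambda>t. length (ino t) + 1"] Node.prems
    by (subst length_ino_Node) auto
  moreover have "?m ^ h \<le> length ts * ?m ^ (h - 1)"
  proof -
    have "?m ^ h = ?m * ?m ^ (h - 1)" using Node.prems by (cases h) auto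
    moreover have "?m \<le> length ts" using Node.prems by simp
    ultimately show ?thesis by (metis mult_le_mono1)
  qed
  ultimately show ?case by simp
qed simp

lemma length_ino_root_ge:
  assumes "sh B 2 h t" "0 < h"
  shows "2 * (mindeg B) ^ (h - 1) \<le> length (ino t) + 1"
proof (cases t)
  case (Node ks ts)
  let ?m = "mindeg B"
  have "\<forall>t\<in>set ts. ?m ^ (h - 1) \<le> length (ino t) + 1"
    using assms(1) Node length_ino_ge by auto
  then have "length ts * ?m ^ (h - 1) \<le> length (ino (Node ks ts)) + 1"
    using sum_list_add_const_le[of ts "\<lambda>_. 0" "?m ^ (h - 1)" "\<lambda>t. length (ino t) + 1"] assms(1) Node
    by (subst length_ino_Node) auto
  moreover have "2 * ?m ^ (h - 1) \<le> length ts * ?m ^ (h - 1)"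
    using assms(1) Node by (intro mult_le_mono1) auto
  ultimately show ?thesis unfolding Node by linarith
qed (use assms in auto)

text \<open>A bound for the total charge on a key of height \<open>s\<close>. Below height 4 keys
  are not charged: a tree with a thin root may have too few keys there to pay a multiple of
  \<open>B\<close>, and the gaps pay for all splits.\<close>

definition key_cost :: "nat \<Rightarrow> nat \<Rightarrow> nat" where
  "key_cost B s = (if 4 \<le> s then B * s\<^sup>2 else 0)"

lemma weight_low: "sh B lo h t \<Longrightarrow> h \<le> 3 \<Longrightarrow> weight (key_cost B) h t = 0"
proof (induction t arbitrary: h lo)
  case (Node ks ts)
  have "weight (key_cost B) (h - 1) t = 0" if "t \<in> set ts" for t
    using Node.prems Node.IH[OF that, of "mindeg B"] that by simp
  then have "map (weight (key_cost B) (h - 1)) ts = map (\<lambda>_. 0) ts" by simp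
  moreover have "key_cost B h = 0" using Node.prems(2) by (simp add: key_cost_def)
  ultimately show ?case by simp
qed simp

text \<open>
  The quadratic term makes the induction work: a node of height \<open>h\<close> receives it from each
  of its at least two children, which pays for its own keys.
\<close>

lemma weight_high:
  "sh B lo h t \<Longrightarrow> mindeg B \<le> lo \<or> 4 \<le> h \<Longrightarrow> 2 \<le> lo \<Longrightarrow> 3 \<le> B \<Longrightarrow> 3 \<le> h \<Longrightarrow>
    weight (key_cost B) h t + 2 * B * (h\<^sup>2 + 4 * h + 6) \<le> 57 * length (ino t)"
proof (induction t arbitrary: h lo)
  case (Node ks ts)
  let ?m = "mindeg B"
  have m: "2 \<le> ?m" "B \<le> 2 * ?m" using Node.prems by auto
  show ?case
  proof (cases "h = 3")
    case True
    \<comment> \<open>The premise on \<open>lo\<close> and \<open>h\<close> rules out a thin root of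
      height 3. Hence \<open>?m ^ 3 \<ge> 4 * ?m \<ge> 2 * B\<close>, the tree has at least
      \<open>B\<close> keys, and these cover the surplus \<open>2 * B * 27\<close>.\<close>
    then have "sh B ?m 3 (Node ks ts)"
      using sh_mono[OF Node.prems(1), of ?m] Node.prems(2) by (simp del: sh.simps)
    then have "?m ^ 3 \<le> length (ino (Node ks ts)) + 1" by (rule length_ino_ge)
    moreover have "2 * 2 * ?m \<le> ?m ^ 3"
      unfolding power3_eq_cube using m by (intro mult_le_mono) auto
    ultimately have "B \<le> length (ino (Node ks ts))" using m Node.prems by linarith
    moreover have "weight (key_cost B) h (Node ks ts) = 0"
      using Node.prems(1) True by (intro weight_low) auto
    ultimately show ?thesis using True by (simp del: weight.simps add: power2_eq_square)
  next
    case False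
    define g where "g = h - 1"
    have g: "h = Suc g" "3 \<le> g" using False Node.prems by (auto simp: g_def)
    define r where "r = length ks - 1"
    have r: "length ks = r + 1" "length ts = r + 2" using Node.prems by (auto simp: r_def)
    let ?e = "2 * B * (g\<^sup>2 + 4 * g + 6)"
    have "\<forall>t\<in>set ts. weight (key_cost B) g t + ?e \<le> 57 * length (ino t)"
      using Node.prems m g Node.IH[of _ ?m g] by simp
    then have "sum_list (map (weight (key_cost B) g) ts) + length ts * ?e
        \<le> sum_list (map (\<lambda>t. 57 * length (ino t)) ts)"
      by (rule sum_list_add_const_le)
    moreover have "sum_list (map (\<lambda>t. 57 * length (ino t)) ts) + 57 * length ks = 57 * length (ino (Node ks ts))"
      using Node.prems length_mix[of "map ino ts" ks] by (simp add: sum_list_const_mult o_def)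
    moreover have "length ks * key_cost B h \<le> (r + 1) * (2 * B * (Suc g)\<^sup>2)"
    proof -
      have "key_cost B h \<le> 2 * B * (Suc g)\<^sup>2" unfolding g(1) key_cost_def by simp
      then show ?thesis unfolding r by (rule mult_le_mono2)
    qed
    moreover have "(r + 1) * (2 * B * (Suc g)\<^sup>2) + 2 * B * (h\<^sup>2 + 4 * h + 6) \<le> length ts * ?e"
    proof -
      \<comment> \<open>The polynomial \<open>p h = h\<^sup>2 + 4 * h + 6\<close> is the solution of
        \<open>2 * p g = (g + 1)\<^sup>2 + p (g + 1)\<close>: two children pay exactly for one key
        and for the surplus of their parent, and every further child pays for more than its
        key.\<close>
      have "(r + 1) * (Suc g)\<^sup>2 + (h\<^sup>2 + 4 * h + 6) \<le> (r + 2) * (g\<^sup>2 + 4 * g + 6)"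
        unfolding g(1) by (simp add: power2_eq_square algebra_simps)
      then have "2 * B * ((r + 1) * (Suc g)\<^sup>2 + (h\<^sup>2 + 4 * h + 6)) \<le> 2 * B * ((r + 2) * (g\<^sup>2 + 4 * g + 6))"
        by (rule mult_le_mono2)
      then show ?thesis unfolding r by (simp add: algebra_simps)
    qed
    moreover have "weight (key_cost B) h (Node ks ts) =
        length ks * key_cost B h + sum_list (map (weight (key_cost B) g) ts)"
      by (simp add: g_def)
    ultimately show ?thesis by linarith
  qed
qed simp

lemma sum_levels_key_cost_le:
  assumes "sh B 2 h t" "3 \<le> B"
  shows "(\<Sum>p\<in>levels h t. key_cost B (snd p)) \<le> 57 * length (ino t)"
proof (rule order_trans[OF sum_levels_le_weight], cases "h \<le> 3")
  case True
  then show "weight (key_cost B) h t \<le> 57 * length (ino t)"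
    using weight_low[OF assms(1)] by simp
next
  case False
  then show "weight (key_cost B) h t \<le> 57 * length (ino t)"
    using weight_high[OF assms(1)] assms(2) by simp
qed

section \<open>The tree of ranges\<close>

text \<open>
  A range of level \<open>D\<close> consists of at most \<open>B ^ D\<close> gaps, from the \<open>i\<close>-th of the gaps \<open>0, \<dots>, d\<close> on.
  The argument \<open>D\<close> of \<open>parts\<close> is the level of the parts, not of the range.
\<close>

definition parts :: "nat \<Rightarrow> nat \<Rightarrow> nat \<Rightarrow> nat \<Rightarrow> nat" where
  "parts B d D i = min B ((d - i) div B ^ D + 1)"

text \<open>If a range of level \<open>Suc D\<close> is split at a height
  \<open>t < 2 * Suc D + 2\<close>, then \<open>t + 1 \<le> 2 * D + 4\<close>, which is the charge
  to each part. Splits at greater heights are charged to keys.\<close>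

primrec range_cost :: "nat \<Rightarrow> nat \<Rightarrow> nat \<Rightarrow> nat \<Rightarrow> nat" where
  "range_cost B d 0 i = 0"
| "range_cost B d (Suc D) i =
     (\<Sum>q<parts B d D i. 2 * D + 4 + range_cost B d D (i + q * B ^ D))"

text \<open>The slack \<open>4 * D + 12\<close> is chosen to reproduce itself: after the charge
  \<open>2 * D + 4\<close> every part has \<open>2 * D + 8\<close> left, and two parts together
  yield \<open>4 * Suc D + 12\<close>.\<close>

lemma range_cost_full:
  assumes "2 \<le> B" "i + B ^ D \<le> d + 1"
  shows "range_cost B d D i + 4 * D + 12 \<le> 16 * B ^ D"
  using assms(2)
proof (induction D arbitrary: i)
  case (Suc D)
  have part: "2 * D + 4 + range_cost B d D (i + q * B ^ D) + (2 * D + 8) \<le> 16 * B ^ D" if "q < B" for q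
  proof -
    have "(q + 1) * B ^ D \<le> B * B ^ D" using that by (intro mult_le_mono1) auto
    then show ?thesis using Suc.IH[of "i + q * B ^ D"] Suc.prems by simp
  qed
  have "range_cost B d (Suc D) i + B * (2 * D + 8) \<le>
      (\<Sum>q<B. 2 * D + 4 + range_cost B d D (i + q * B ^ D)) + B * (2 * D + 8)"
    unfolding range_cost.simps by (intro add_right_mono sum_mono2) (auto simp: parts_def)
  also have "\<dots> = (\<Sum>q<B. 2 * D + 4 + range_cost B d D (i + q * B ^ D) + (2 * D + 8))"
    by (simp add: sum.distrib algebra_simps)
  also have "\<dots> \<le> (\<Sum>q<B. 16 * B ^ D)" using part by (intro sum_mono) auto
  finally have "range_cost B d (Suc D) i + B * (2 * D + 8) \<le> 16 * B ^ Suc D" by simp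
  moreover have "2 * (2 * D + 8) \<le> B * (2 * D + 8)" using assms(1) by (rule mult_le_mono1)
  ultimately show ?case by simp
qed simp

text \<open>All parts except the last are complete, so the incomplete ranges lie on a single chain.
  Its own charges \<open>2 * j + 4\<close> for \<open>j < D\<close> sum up to
  \<open>D\<^sup>2 + 3 * D\<close>.\<close>

lemma range_cost_le:
  assumes "2 \<le> B" "i \<le> d"
  shows "range_cost B d D i \<le> 16 * (d + 1 - i) + D\<^sup>2 + 3 * D"
  using assms(2)
proof (induction D arbitrary: i)
  case (Suc D)
  let ?s = "B ^ D" and ?p = "parts B d D i - 1"
  let ?f = "\<lambda>q. 2 * D + 4 + range_cost B d D (i + q * B ^ D)"
  have p: "parts B d D i = Suc ?p" using assms(1) by (simp add: parts_def)
  have "?p \<le> (d - i) div ?s" by (auto simp: parts_def)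
  then have "?p * ?s \<le> (d - i) div ?s * ?s" by (rule mult_le_mono1)
  also have "\<dots> \<le> d - i" by (rule div_times_less_eq_dividend)
  finally have last: "i + ?p * ?s \<le> d" using Suc.prems by simp
  have full: "?f q \<le> 16 * ?s" if "q < ?p" for q
  proof -
    have "(q + 1) * ?s \<le> ?p * ?s" using that by (intro mult_le_mono1) auto
    then show ?thesis using range_cost_full[OF assms(1), of "i + q * ?s" D d] last by simp
  qed
  have "range_cost B d (Suc D) i = (\<Sum>q<?p. ?f q) + ?f ?p"
    unfolding range_cost.simps by (subst p) simp
  also have "(\<Sum>q<?p. ?f q) \<le> (\<Sum>q<?p. 16 * ?s)" using full by (intro sum_mono) auto
  also have "(\<Sum>q<?p. 16 * ?s) + ?f ?p \<le> 16 * (?p * ?s) + (2 * D + 4 + (16 * (d + 1 - (i + ?p * ?s)) + D\<^sup>2 + 3 * D))"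
    using Suc.IH[OF last] by simp
  also have "\<dots> = 16 * (d + 1 - i) + (Suc D)\<^sup>2 + 3 * Suc D"
    using last by (simp add: power2_eq_square)
  finally show ?case by simp
qed simp

text \<open>Together with \<open>B ^ (D - 1) \<le> d\<close> this makes the quadratic term of
  \<open>range_cost_le\<close> linear in the number of cutting keys.\<close>

lemma square_le_power3: "D\<^sup>2 + 3 * D \<le> 4 * 3 ^ (D - 1)" if "0 < D"
  using that
proof (induction D rule: nat_induct_non_zero)
  case (Suc D)
  have "(Suc D)\<^sup>2 + 3 * Suc D = D\<^sup>2 + 3 * D + (2 * D + 4)" by (simp add: power2_eq_square)
  also have "\<dots> \<le> 3 * (D\<^sup>2 + 3 * D)" using Suc.hyps by (cases D) (auto simp: power2_eq_square)
  also have "\<dots> \<le> 3 * (4 * 3 ^ (D - 1))" using Suc.IH by simp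
  also have "\<dots> = 4 * 3 ^ (Suc D - 1)" using Suc.hyps by (cases D) auto
  finally show ?case .
qed simp

section \<open>The program\<close>

definition keysof :: "'k word list \<Rightarrow> 'k list" where
  "keysof ws = concat (map (\<lambda>w. case w of Key k \<Rightarrow> [k] | _ \<Rightarrow> []) ws)"

text \<open>Padding and pointers to external nodes are both \<open>Blank\<close>, so the number of
  pointers has to be inferred from the number of keys.\<close>

definition parse :: "'k word list \<Rightarrow> 'k list \<times> 'k word list" where
  "parse ws = (keysof ws, take (length (keysof ws) + 1) (drop (length (keysof ws)) ws))"

fun rds :: "nat list \<Rightarrow> ('k word list list \<Rightarrow> 'k code) \<Rightarrow> 'k code" where
  "rds [] f = f []"
| "rds (a # as) f = Rd a (\<lambda>b. rds as (\<lambda>bs. f (b # bs)))"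

fun wrs :: "(nat \<times> 'k word list) list \<Rightarrow> 'k code \<Rightarrow> 'k code" where
  "wrs [] k = k"
| "wrs ((a, b) # ws) k = Wr a b (wrs ws k)"

definition orient :: "bool \<Rightarrow> 'a list \<times> 'b list \<Rightarrow> 'a list \<times> 'b list" where
  "orient \<sigma> n = (if \<sigma> then (rev (fst n), rev (snd n)) else n)"

fun nodes :: "'k word list list \<Rightarrow> ('k list \<times> 'k word list) list" where
  "nodes (b # b' # bs) = (keysof b, take (length (keysof b) + 1) b') # nodes bs"
| "nodes _ = []"

definition read_nodes ::
  "bool \<Rightarrow> 'k word list \<Rightarrow> (('k list \<times> 'k word list) list \<Rightarrow> 'k code) \<Rightarrow> 'k code" where
  "read_nodes \<sigma> ps f =
     rds (concat (map (\<lambda>p. case p of Num a \<Rightarrow> [a, Suc a] | _ \<Rightarrow> []) ps)) (\<lambda>bs. f (map (orient \<sigma>) (nodes bs)))"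

definition node_writes ::
  "nat \<Rightarrow> bool \<Rightarrow> nat \<Rightarrow> ('k list \<times> 'k word list) list \<Rightarrow> (nat \<times> 'k word list) list" where
  "node_writes B \<sigma> a gs = concat (map (\<lambda>q. let (k, c) = orient \<sigma> (gs ! q) in
     [(a + 2 * q, pad B (map Key k)), (a + 2 * q + 1, pad B c)]) [0..<length gs])"

definition node_ptrs :: "nat \<Rightarrow> nat \<Rightarrow> 'k word list" where
  "node_ptrs a n = map (\<lambda>q. Num (a + 2 * q)) [0..<n]"

text \<open>A word that is not a key acts as an infinite bound. The bound itself counts as beyond
  because the gaps are open.\<close>

definition beyond :: "bool \<Rightarrow> 'k::linorder word \<Rightarrow> 'k \<Rightarrow> bool" where
  "beyond \<sigma> b x = (case b of Key k \<Rightarrow> if \<sigma> then k \<le> x else x \<le> k | _ \<Rightarrow> False)"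

definition trim_frame ::
  "nat \<Rightarrow> nat \<Rightarrow> bool \<Rightarrow> 'k word \<Rightarrow> 'k \<Rightarrow> 'k word \<Rightarrow> 'k word \<Rightarrow> 'k word list" where
  "trim_frame B a \<sigma> b s u w = frame B [Num 2, Num a, Num (if \<sigma> then 1 else 0), b, Key s, u, w]"

text \<open>Block \<open>a\<close> receives the answer, the next four blocks the at most two new
  nodes, and the recursive call works from \<open>a + 5\<close> on. This is the origin of 5 blocks
  per level.\<close>

definition regroup_code ::
  "nat \<Rightarrow> nat \<Rightarrow> bool \<Rightarrow> 'k list \<Rightarrow> 'k word list \<Rightarrow> 'k word list \<Rightarrow> 'k code" where
  "regroup_code B a \<sigma> ks ps m =
     (let (ks', ps') = parse m; (ss, gs) = chunk B (ks' @ ks) (ps' @ ps)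
      in wrs (node_writes B \<sigma> (a + 1) gs)
           (Wr a (pad B (map Key ss @ node_ptrs (a + 1) (length gs))) Done))"

text \<open>
  Given adjacent nodes \<open>u\<close> and \<open>w\<close> of equal height, separated by a key \<open>s\<close> that remains, this removes
  the keys beyond \<open>b\<close>. The result is one or two valid nodes of the same height: the child of \<open>u\<close>
  that contains the cut always has a right neighbour from which it can borrow. For \<open>\<sigma>\<close> left and
  right are exchanged.
\<close>

definition trim_code ::
  "nat \<Rightarrow> nat \<Rightarrow> bool \<Rightarrow> 'k::linorder word \<Rightarrow> 'k \<Rightarrow> 'k word \<Rightarrow> 'k word \<Rightarrow> 'k code" where
  "trim_code B a \<sigma> b s u w =
     (if u = Blank then Wr a (pad B [Key s, Blank, Blank]) Done
      else read_nodes \<sigma> [u, w] (\<lambda>nds.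
        let (ks, ps) = cut_left (beyond \<sigma> b) (mix [s] (map fst nds)) (concat (map snd nds))
        in Fk [trim_frame B (a + 5) \<sigma> b (ks ! 0) (ps ! 0) (ps ! 1)]
             (Rd (a + 5) (regroup_code B a \<sigma> (drop 1 ks) (drop 2 ps)))))"

text \<open>Up to three nodes occupy the six blocks from \<open>a\<close> on, a root above them the
  next two. A single group is itself a root and may be small; if there is no separator at all, the
  only subtree is the result.\<close>

definition emit_code ::
  "nat \<Rightarrow> nat \<Rightarrow> nat \<Rightarrow> 'k list \<Rightarrow> 'k word list \<Rightarrow> 'k code" where
  "emit_code B a out ks ps =
     (if ks = [] then Wr out (pad B [hd ps]) Done
      else let (ss, gs) = chunk B ks ps in
        wrs (node_writes B False a gs)
          (if ss = [] then Wr out (pad B [Num a]) Done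
           else wrs (node_writes B False (a + 6) [(ss, node_ptrs a (length gs))])
             (Wr out (pad B [Num (a + 6)]) Done)))"

text \<open>The output slots from \<open>fp\<close> to \<open>fp + d\<close> are followed by one
  interval per gap. The program does not know the height, so room for two trims is reserved with the
  bound \<open>B * fp\<close>, which holds because the height is at most the number of keys.\<close>

definition region :: "nat \<Rightarrow> nat \<Rightarrow> nat \<Rightarrow> nat \<Rightarrow> nat" where
  "region B d fp i = fp + d + 1 + i * (10 * (B * fp) + 40)"

text \<open>The second answer describes the right end in mirror image, hence the reversals.\<close>

definition glue_code ::
  "nat \<Rightarrow> nat \<Rightarrow> nat \<Rightarrow> 'k list \<Rightarrow> 'k word list \<Rightarrow> 'k word list \<Rightarrow> 'k word list \<Rightarrow> 'k code" where
  "glue_code B a out ks ps m m' =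
     (let (ks1, ps1) = parse m; (ks2, ps2) = parse m'
      in emit_code B a out (ks1 @ ks @ rev ks2) (ps1 @ ps @ rev ps2))"

definition carve_code ::
  "nat \<Rightarrow> nat \<Rightarrow> nat \<Rightarrow> nat \<Rightarrow> 'k::linorder word \<Rightarrow> 'k word \<Rightarrow> 'k list \<Rightarrow> 'k word list \<Rightarrow> 'k code" where
  "carve_code B a a' out lo hi ks ps =
     (let n = length ps in
      Fk [trim_frame B (a + 8) False lo (ks ! 0) (ps ! 0) (ps ! 1)]
       (Fk [trim_frame B a' True hi (ks ! (n - 2)) (ps ! (n - 1)) (ps ! (n - 2))]
        (Rd (a + 8) (\<lambda>m.
          Rd a' (glue_code B a out (tl (butlast ks)) (drop 2 (take (n - 2) ps)) m)))))"

definition read_key :: "nat \<Rightarrow> nat \<Rightarrow> bool \<Rightarrow> nat \<Rightarrow> ('k word \<Rightarrow> 'k code) \<Rightarrow> 'k code" where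
  "read_key B kp ok j f = (if ok then Rd (kp + j div B) (\<lambda>b. f (b ! (j mod B))) else f Blank)"

definition range_frame ::
  "nat \<Rightarrow> nat \<Rightarrow> nat \<Rightarrow> nat \<Rightarrow> nat \<Rightarrow> nat \<Rightarrow> 'k word list \<Rightarrow> 'k word list" where
  "range_frame B d kp fp i D ws = frame B ([Num 0, Num d, Num kp, Num fp, Num i, Num D] @ ws)"

definition descend_frame ::
  "nat \<Rightarrow> nat \<Rightarrow> nat \<Rightarrow> nat \<Rightarrow> nat \<Rightarrow> nat \<Rightarrow> 'k word \<Rightarrow> 'k word \<Rightarrow> 'k word list \<Rightarrow> 'k word list" where
  "descend_frame B d kp fp i D lo hi ws =
     frame B ([Num 1, Num d, Num kp, Num fp, Num i, Num D, lo, hi] @ ws)"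

definition range_code ::
  "nat \<Rightarrow> nat \<Rightarrow> nat \<Rightarrow> nat \<Rightarrow> nat \<Rightarrow> nat \<Rightarrow> 'k word list \<Rightarrow> 'k code" where
  "range_code B d kp fp i D ws =
     read_key B kp (0 < i) (i - 1) (\<lambda>lo.
       read_key B kp (i + B ^ D \<le> d) (i + B ^ D - 1) (\<lambda>hi.
         Fk [descend_frame B d kp fp i D lo hi ws] Done))"

text \<open>Every part receives the unopened nodes of the whole range and opens them again: the
  children that made the split necessary would not fit into a frame.\<close>

definition split_code ::
  "nat \<Rightarrow> nat \<Rightarrow> nat \<Rightarrow> nat \<Rightarrow> nat \<Rightarrow> nat \<Rightarrow> 'k word list \<Rightarrow> 'k code" where
  "split_code B d kp fp i D ws =
     Fk (map (\<lambda>q. range_frame B d kp fp (i + q * B ^ D) D ws) [0..<parts B d D i]) Done"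

definition restrict ::
  "'k::linorder word \<Rightarrow> 'k word \<Rightarrow> 'k list \<Rightarrow> 'c list \<Rightarrow> 'k list \<times> 'c list" where
  "restrict lo hi ks xs =
     (let (ks', xs') = cut_left (beyond False lo) ks xs in cut_right (beyond True hi) ks' xs')"

text \<open>
  The range of gaps from the \<open>i\<close>-th on, bounded by \<open>lo\<close> and \<open>hi\<close>, lies within at most three adjacent
  nodes of equal height and their separators, which are listed in \<open>ws\<close>. If it still does so one
  level further down, the thread proceeds there; otherwise the range is split, or, if it is a
  single gap, both of its ends are trimmed independently.
\<close>

definition descend_code ::
  "nat \<Rightarrow> nat \<Rightarrow> nat \<Rightarrow> nat \<Rightarrow> nat \<Rightarrow> nat \<Rightarrow> 'k::linorder word \<Rightarrow> 'k word \<Rightarrow> 'k word list \<Rightarrow> 'k code"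
where
  "descend_code B d kp fp i D lo hi ws =
     (let (ss, ps) = parse ws; a = region B d fp i in
      if ps ! 0 = Blank then
        if 0 < D then split_code B d kp fp i (D - 1) ws
        else let (ks, cs) = restrict lo hi ss ps in emit_code B a (fp + i) ks cs
      else read_nodes False ps (\<lambda>nds.
        let (ks, cs) = restrict lo hi (mix ss (map fst nds)) (concat (map snd nds)) in
        if length cs \<le> 3 then Fk [descend_frame B d kp fp i D lo hi (map Key ks @ cs)] Done
        else if 0 < D then split_code B d kp fp i (D - 1) ws
        else carve_code B a (a + 20 + 5 * (B * fp)) (fp + i) lo hi ks cs))"

fun num :: "'k word \<Rightarrow> nat" where
  "num (Num n) = n"
| "num _ = 0"

definition body :: "nat \<Rightarrow> 'k::linorder word list \<Rightarrow> 'k code" where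
  "body B args =
     (if args = [] then Done else
      let n = \<lambda>j. num (args ! j) in
      if n 0 = 0 then range_code B (n 1) (n 2) (n 3) (n 4) (n 5) (drop 6 args)
      else if n 0 = 1 then
        descend_code B (n 1) (n 2) (n 3) (n 4) (n 5) (args ! 6) (args ! 7) (drop 8 args)
      else trim_code B (n 1) (n 2 = 1) (args ! 3) (hd (keysof [args ! 4])) (args ! 5) (args ! 6))"

lemma body_simps:
  "body B [] = Done"
  "body B ([Num 0, Num d, Num kp, Num fp, Num i, Num D] @ ws) = range_code B d kp fp i D ws"
  "body B ([Num 1, Num d, Num kp, Num fp, Num i, Num D, lo, hi] @ ws) =
    descend_code B d kp fp i D lo hi ws"
  "body B [Num 2, Num a, Num (if \<sigma> then 1 else 0), b, Key s, u, w] = trim_code B a \<sigma> b s u w"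
  by (auto simp: body_def keysof_def numeral_eq_Suc)

text \<open>The choice of \<open>D\<close> lets one range cover all \<open>d + 1\<close> gaps. After
  the join the thread goes on with an empty frame, for which \<open>body\<close> halts.\<close>

definition start :: "'k::linorder word list \<Rightarrow> 'k action" where
  "start s = (let B = num (s ! 0); d = num (s ! 2) in
     Fork [range_frame B d (num (s ! 3)) (num (s ! 4)) 0 (LEAST D. d < B ^ D) [s ! 1]] (frame B []))"

section \<open>Stored trees\<close>

abbreviation plain :: "'k word \<Rightarrow> bool" where
  "plain w \<equiv> (\<forall>k. w \<noteq> Key k)"

lemma keysof_append [simp]: "keysof (xs @ ys) = keysof xs @ keysof ys"
  by (simp add: keysof_def)

lemma keysof_map_Key [simp]: "keysof (map Key ks) = ks"
  by (induction ks) (auto simp: keysof_def)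

lemma keysof_plain: "\<forall>w\<in>set ws. plain w \<Longrightarrow> keysof ws = []"
  by (induction ws) (auto simp: keysof_def split: word.split)

lemma parse_words:
  assumes "\<forall>w\<in>set ps. plain w" "length ps = length ks + 1"
  shows "parse (map Key ks @ ps) = (ks, ps)" "parse (pad B (map Key ks @ ps)) = (ks, ps)"
  using assms by (auto simp: parse_def pad_def keysof_plain)

lemma keysof_pad: "keysof (pad B (map Key ks)) = ks"
  by (simp add: pad_def keysof_plain)

lemma take_pad: "length ps = n \<Longrightarrow> take n (pad B ps) = ps"
  by (simp add: pad_def)

lemma length_pad: "length ws \<le> B \<Longrightarrow> length (pad B ws) = B"
  by (simp add: pad_def)

lemma set_pad_subset: "set ws \<subseteq> V \<Longrightarrow> Blank \<in> V \<Longrightarrow> set (pad B ws) \<subseteq> V"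
  by (auto simp: pad_def)

text \<open>For \<open>\<sigma>\<close> the stored tree is regarded as its own mirror image. The
  blocks are the same; \<open>orient\<close> reverses nodes when they are read or written.\<close>

definition st :: "nat \<Rightarrow> bool \<Rightarrow> 'k mem \<Rightarrow> nat set \<Rightarrow> 'k word \<Rightarrow> 'k btree \<Rightarrow> bool" where
  "st B \<sigma> \<mu> P p t \<longleftrightarrow> stored_tree B \<mu> P p (if \<sigma> then mir t else t)"

abbreviation sts :: "nat \<Rightarrow> bool \<Rightarrow> 'k mem \<Rightarrow> nat set \<Rightarrow> 'k word list \<Rightarrow> 'k btree list \<Rightarrow> bool" where
  "sts B \<sigma> \<mu> P \<equiv> list_all2 (st B \<sigma> \<mu> P)"

lemma st_External [simp]: "st B \<sigma> \<mu> P p External \<longleftrightarrow> p = Blank"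
  by (auto simp: st_def intro: stored_tree.intros elim: stored_tree.cases)

lemma st_Node: "st B \<sigma> \<mu> P p (Node ks ts) \<longleftrightarrow>
    (\<exists>a ps. p = Num a \<and> a \<in> P \<and> a + 1 \<in> P \<and>
      \<mu> a = pad B (map Key (fst (orient \<sigma> (ks, ps)))) \<and> \<mu> (a + 1) = pad B (snd (orient \<sigma> (ks, ps))) \<and>
      list_all2 (st B \<sigma> \<mu> P) ps ts)"
proof -
  have "stored_tree B \<mu> P p (Node ks' ts') \<longleftrightarrow> (\<exists>a ps. p = Num a \<and> a \<in> P \<and> a + 1 \<in> P \<and>
      \<mu> a = pad B (map Key ks') \<and> \<mu> (a + 1) = pad B ps \<and> list_all2 (stored_tree B \<mu> P) ps ts')"
    for ks' ts'
    by (subst stored_tree.simps) auto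
  moreover have "(\<exists>ps. Q ps \<and> list_all2 S ps (rev (map mir ts))) \<longleftrightarrow>
      (\<exists>ps. Q (rev ps) \<and> list_all2 (\<lambda>p t. S p (mir t)) ps ts)" for Q and S :: "'a word \<Rightarrow> 'a btree \<Rightarrow> bool"
    by (metis list_all2_rev1 rev_rev_ident list_all2_map2)
  ultimately show ?thesis
    by (cases \<sigma>) (simp_all add: st_def [abs_def] orient_def)
qed

lemma stored_tree_mono:
  "stored_tree B \<mu> P p t \<Longrightarrow> P \<subseteq> P' \<Longrightarrow> \<forall>a\<in>P. \<mu>' a = \<mu> a \<Longrightarrow> stored_tree B \<mu>' P' p t"
  by (induction rule: stored_tree.induct)
    (auto intro!: stored_tree.intros elim: list.rel_mono_strong)

lemma st_mono: "st B \<sigma> \<mu> P p t \<Longrightarrow> P \<subseteq> P' \<Longrightarrow> \<forall>a\<in>P. \<mu>' a = \<mu> a \<Longrightarrow> st B \<sigma> \<mu>' P' p t"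
  unfolding st_def by (rule stored_tree_mono)

lemma st_ptr: "st B \<sigma> \<mu> P p t \<Longrightarrow> p = Blank \<and> t = External \<or> (\<exists>a\<in>P. p = Num a) \<and> t \<noteq> External"
  by (cases t) (auto simp: st_Node)

fun kids :: "'k btree \<Rightarrow> 'k btree list" where
  "kids External = []"
| "kids (Node ks ts) = ts"

definition opens :: "('k word \<Rightarrow> 'k btree \<Rightarrow> bool) \<Rightarrow> 'k list \<times> 'k word list \<Rightarrow> 'k btree \<Rightarrow> bool" where
  "opens R n t \<longleftrightarrow> t = Node (fst n) (kids t) \<and> list_all2 R (snd n) (kids t)"

lemma opens_nodes:
  assumes "list_all2 (opens R) nds ts"
  shows "\<exists>N. ts = map (case_prod Node) N \<and> map kids ts = map snd N \<and> map fst N = map fst nds \<and>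
    list_all2 R (concat (map snd nds)) (concat (map snd N))"
  using assms
proof (induction rule: list_all2_induct)
  case (Cons n nds t ts)
  then obtain N where "ts = map (case_prod Node) N" "map kids ts = map snd N" "map fst N = map fst nds"
    "list_all2 R (concat (map snd nds)) (concat (map snd N))" by blast
  moreover have "t = Node (fst n) (kids t)" "list_all2 R (snd n) (kids t)"
    using Cons(1) by (auto simp: opens_def)
  ultimately show ?case
    by (intro exI[of _ "(fst n, kids t) # N"]) (auto intro: list_all2_appendI)
qed simp

lemma opens_fat:
  assumes "list_all2 (opens R) nds ts" "length ts = length ss + 1" "\<forall>t\<in>set ts. sh B lo h t"
  shows "list_all2 R (concat (map snd nds)) (concat (map kids ts))"
    and "mix (mix ss (map fst nds)) (map ino (concat (map kids ts))) = mix ss (map ino ts)"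
    and "length (concat (map kids ts)) = length (mix ss (map fst nds)) + 1"
    and "\<forall>t\<in>set (concat (map kids ts)). sh B (mindeg B) (h - 1) t"
    and "set (concat (map fst nds)) \<times> {h} \<union> (\<Union>t\<in>set (concat (map kids ts)). levels (h - 1) t) =
      (\<Union>t\<in>set ts. levels h t)"
proof -
  obtain N where N: "ts = map (case_prod Node) N" "map kids ts = map snd N" "map fst N = map fst nds"
    and R: "list_all2 R (concat (map snd nds)) (concat (map snd N))"
    using opens_nodes[OF assms(1)] by blast
  let ?N = "map (\<lambda>(k, c). (k, map ino c)) N"
  have arity: "\<forall>(k, c)\<in>set N. length c = length k + 1 \<and> (\<forall>t\<in>set c. sh B (mindeg B) (h - 1) t)"
    using assms(3) unfolding N(1) by auto
  have len: "length ?N = length ss + 1" using assms(2) unfolding N(1) by simp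
  have fst: "map fst ?N = map fst nds" unfolding N(3)[symmetric] by auto
  have snd: "concat (map snd ?N) = map ino (concat (map snd N))"
    by (simp add: map_concat o_def case_prod_beta)
  have ino: "map ino ts = map (\<lambda>(k, x). mix k x) ?N" unfolding N(1) by auto
  have ar: "\<forall>(k, x)\<in>set ?N. length x = length k + 1" using arity by auto
  show "list_all2 R (concat (map snd nds)) (concat (map kids ts))" using R N(2) by simp
  show "mix (mix ss (map fst nds)) (map ino (concat (map kids ts))) = mix ss (map ino ts)"
    using mix_fat(1)[OF len ar] unfolding fst snd ino N(2) by simp
  show "length (concat (map kids ts)) = length (mix ss (map fst nds)) + 1"
    using mix_fat(2)[OF len ar] unfolding fst snd N(2) by simp
  show "\<forall>t\<in>set (concat (map kids ts)). sh B (mindeg B) (h - 1) t"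
    using arity unfolding N(2) by auto
  show "set (concat (map fst nds)) \<times> {h} \<union> (\<Union>t\<in>set (concat (map kids ts)). levels (h - 1) t) =
      (\<Union>t\<in>set ts. levels h t)"
    unfolding N(2) N(3)[symmetric] unfolding N(1) by force
qed

text \<open>\<open>lo\<close> is a parameter because a single group may end up as a root below the
  minimal degree; as soon as there are two groups, all of them reach
  \<open>mindeg B\<close>.\<close>

lemma chunk_trees:
  assumes "chunk B ks ps = (ss, gs)" "list_all2 R ps ts" "length ts = length ks + 1" "2 \<le> B"
    and "\<forall>t\<in>set ts. sh B (mindeg B) h t" "lo \<le> length ts" "lo \<le> mindeg B"
  shows "\<exists>tgs. list_all2 (\<lambda>(k, x) (k', y). k = k' \<and> list_all2 R x y) gs tgs \<and>
    mix ss (map ino (map (case_prod Node) tgs)) = mix ks (map ino ts) \<and>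
    (\<forall>t\<in>set (map (case_prod Node) tgs). sh B lo (Suc h) t)"
proof -
  have len: "length ps = length ts" using assms(2) by (rule list_all2_lengthD)
  note ch = chunk[OF assms(1) _ assms(4)]
  have lenps: "length ps = length ks + 1" using len assms(3) by simp
  obtain tgs where tgs: "concat (map snd tgs) = ts"
      "list_all2 (\<lambda>(k, x) (k', y). k = k' \<and> list_all2 R x y) gs tgs"
    using chunk_transfer[OF ch(2)[OF lenps] assms(2)] by blast
  have fst: "map fst tgs = map fst gs"
    using tgs(2) by (induction rule: list_all2_induct) auto
  have lo: "\<forall>(k, x)\<in>set gs. lo \<le> length x"
  proof (cases "length ps \<le> B")
    case True
    then show ?thesis using ch(7)[OF lenps] assms(6) len by simp
  next
    case False
    then have "\<forall>(k, x)\<in>set gs. mindeg B \<le> length x" using ch(5)[OF lenps] by auto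
    then show ?thesis using assms(7) by fastforce
  qed
  have "\<forall>(k, x)\<in>set tgs. length x = length k + 1 \<and> length x \<le> B \<and> lo \<le> length x"
    using tgs(2) ch(4)[OF lenps] lo
    by (induction rule: list_all2_induct) (auto dest: list_all2_lengthD)
  note ar = this
  let ?N = "map (\<lambda>(k, c). (k, map ino c)) tgs"
  have "mix ss (map ino (map (case_prod Node) tgs)) = mix ss (map (\<lambda>(k, x). mix k x) ?N)"
    by (rule arg_cong[where f = "mix ss"]) auto
  also have "\<dots> = mix (mix ss (map fst ?N)) (concat (map snd ?N))"
  proof (rule mix_fat)
    show "length ?N = length ss + 1"
      using ch(3)[OF lenps] list_all2_lengthD[OF tgs(2)] by simp
    show "\<forall>(k, x)\<in>set ?N. length x = length k + 1" using ar by auto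
  qed
  also have "map fst ?N = map fst gs" unfolding fst[symmetric] by auto
  also have "concat (map snd ?N) = map ino ts"
    unfolding tgs(1)[symmetric] by (simp add: map_concat o_def case_prod_beta)
  finally have "mix ss (map ino (map (case_prod Node) tgs)) = mix ks (map ino ts)"
    using ch(1)[OF lenps] by simp
  moreover have "\<forall>t\<in>set (map (case_prod Node) tgs). sh B lo (Suc h) t"
    using ar assms(5) unfolding tgs(1)[symmetric] by auto
  ultimately show ?thesis using tgs(2) by blast
qed

lemma chunk_keys:
  assumes "chunk B ks ps = (ss, gs)" "length ps = length ks + 1" "2 \<le> B" "set ks \<subseteq> A"
  shows "\<forall>(k, x)\<in>set gs. length k \<le> B \<and> length x \<le> B \<and> set k \<subseteq> A" "set ss \<subseteq> A"
proof -
  note ch = chunk[OF assms(1-3)]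
  have sub: "set (mix ss (map fst gs)) \<subseteq> A" unfolding ch(1) by (rule assms(4))
  have mix: "set (mix ss (map fst gs)) = set ss \<union> (\<Union>k\<in>set (map fst gs). set k)"
    using ch(3) by (intro set_mix) simp
  show "set ss \<subseteq> A" using sub mix by blast
  have "length k \<le> B \<and> length x \<le> B \<and> set k \<subseteq> A" if kx: "(k, x) \<in> set gs" for k x
  proof -
    have "k \<in> set (map fst gs)" using kx by force
    then have "set k \<subseteq> A" using sub mix by blast
    moreover have "length x = length k + 1 \<and> length x \<le> B" using ch(4) kx by blast
    ultimately show ?thesis by simp
  qed
  then show "\<forall>(k, x)\<in>set gs. length k \<le> B \<and> length x \<le> B \<and> set k \<subseteq> A" by blast
qed

lemma mix_replace:
  assumes "length tr = length kr" "length ns = length nk + 1"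
  shows "mix (nk @ kr) (ns @ tr) = mix nk ns @ (if kr = [] then [] else hd kr # mix (tl kr) tr)"
  using assms by (cases kr) (auto simp: mix_append)

lemma length_takeWhile_le_prefix: "\<not> P s \<Longrightarrow> length (takeWhile P (xs @ s # ys)) \<le> length xs"
  by (induction xs) auto

lemma node_writes_addrs:
  "map fst (node_writes B \<sigma> a gs) = [a..<a + 2 * length gs]"
proof -
  have "map fst (concat (map (\<lambda>q. let (k, c) = orient \<sigma> (gs ! q) in
     [(a + 2 * q, pad B (map Key k)), (a + 2 * q + 1, pad B c)]) [0..<n])) = [a..<a + 2 * n]" for n
    by (induction n) (auto simp: case_prod_beta Let_def)
  then show ?thesis by (simp add: node_writes_def)
qed

lemma length_node_ptrs [simp]: "length (node_ptrs a n) = n"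
  by (simp add: node_ptrs_def)

lemma in_set_pad: "x \<in> set (pad B ws) \<Longrightarrow> x = Blank \<or> x \<in> set ws"
  by (auto simp: pad_def split: if_splits)

section \<open>Trimming\<close>

locale btree_machine = machine B L c V body start
  for B L c :: nat and V :: "'k::linorder word set" +
  fixes KS :: "'k set" and M :: nat
  assumes V: "V = {Blank} \<union> Key ` KS \<union> Num ` {..M}" and B3: "3 \<le> B" and M: "B \<le> M" "20 \<le> M"
    and c: "20 \<le> c"
begin

lemma V_simps [simp]: "Blank \<in> V" "Key k \<in> V \<longleftrightarrow> k \<in> KS" "Num a \<in> V \<longleftrightarrow> a \<le> M"
  by (auto simp: V)

lemma frame_ok:
  assumes "set args \<subseteq> V" "length args \<le> 13"
  shows "length (frame B args) \<le> c" "set (frame B args) \<subseteq> V"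
  using assms M c by (auto simp: frame_def)

lemma wp_rds:
  assumes "\<forall>a\<in>set as. a \<in> R \<and> a \<le> M \<and> length (\<mu> a) = B \<and> set (\<mu> a) \<subseteq> V"
    and "length as \<le> n" "length as \<le> w" "length as \<le> p"
    and "wp (f (map \<mu> as)) (n - length as) R W (w - length as) (p - length as) Q \<mu>"
  shows "wp (rds as f) n R W w p Q \<mu>"
  using assms
proof (induction as arbitrary: f n w p)
  case (Cons a as)
  have "wp (rds as (\<lambda>bs. f (\<mu> a # bs))) (n - 1) R W (w - 1) (p - 1) Q \<mu>"
    using Cons.prems by (intro Cons.IH) auto
  then show ?case using Cons.prems by simp
qed simp

lemma wp_wrs:
  assumes "distinct (map fst ws)" "\<forall>(a, b)\<in>set ws. a \<in> W \<and> a \<le> M \<and> length b = B \<and> set b \<subseteq> V"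
    and "length ws \<le> n" "length ws \<le> w" "length ws \<le> p"
    and "\<And>\<mu>'. \<forall>(a, b)\<in>set ws. \<mu>' a = b \<Longrightarrow> \<forall>a. a \<notin> fst ` set ws \<longrightarrow> \<mu>' a = \<mu> a \<Longrightarrow>
      wp k (n - length ws) R W (w - length ws) (p - length ws) Q \<mu>'"
  shows "wp (wrs ws k) n R W w p Q \<mu>"
  using assms
proof (induction ws arbitrary: \<mu> n w p)
  case (Cons x ws)
  obtain a b where x: "x = (a, b)" by (cases x)
  have "wp (wrs ws k) (n - 1) R W (w - 1) (p - 1) Q (\<mu>(a := b))"
  proof (rule Cons.IH)
    fix \<mu>' assume \<mu>': "\<forall>(a, b)\<in>set ws. \<mu>' a = b"
      "\<forall>a'. a' \<notin> fst ` set ws \<longrightarrow> \<mu>' a' = (\<mu>(a := b)) a'"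
    have "\<mu>' a = b" using \<mu>'(2) Cons.prems(1) x by auto
    then have "wp k (n - length (x # ws)) R W (w - length (x # ws)) (p - length (x # ws)) Q \<mu>'"
      using \<mu>' x by (intro Cons.prems(6)) auto
    then show "wp k (n - 1 - length ws) R W (w - 1 - length ws) (p - 1 - length ws) Q \<mu>'" by simp
  qed (use Cons.prems in auto)
  then show ?case using Cons.prems x by (simp del: fun_upd_apply)
qed simp

lemma st_V: "st B \<sigma> \<mu> P p t \<Longrightarrow> P \<subseteq> {..M} \<Longrightarrow> p \<in> V"
  using st_ptr by fastforce

lemma sts_V: "sts B \<sigma> \<mu> P ps ts \<Longrightarrow> P \<subseteq> {..M} \<Longrightarrow> set ps \<subseteq> V"
  by (induction rule: list_all2_induct) (auto dest: st_V)

lemma sts_plain: "sts B \<sigma> \<mu> P ps ts \<Longrightarrow> \<forall>w\<in>set ps. plain w"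
  by (induction rule: list_all2_induct) (auto dest: st_ptr)

lemma st_node_blocks:
  assumes "st B \<sigma> \<mu> P p t" "sh B lo h t" "0 < h" "set (ino t) \<subseteq> KS" "P \<subseteq> {..M}"
  obtains a where "p = Num a" "a \<in> P" "a + 1 \<in> P"
    "length (\<mu> a) = B" "set (\<mu> a) \<subseteq> V" "length (\<mu> (a + 1)) = B" "set (\<mu> (a + 1)) \<subseteq> V"
    "opens (st B \<sigma> \<mu> P) (orient \<sigma> (keysof (\<mu> a), take (length (keysof (\<mu> a)) + 1) (\<mu> (a + 1)))) t"
proof -
  obtain ks ts where t: "t = Node ks ts" using assms(2,3) by (cases t) auto
  obtain a ps where a: "p = Num a" "a \<in> P" "a + 1 \<in> P"
      "\<mu> a = pad B (map Key (fst (orient \<sigma> (ks, ps))))" "\<mu> (a + 1) = pad B (snd (orient \<sigma> (ks, ps)))"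
      "sts B \<sigma> \<mu> P ps ts"
    using assms(1) unfolding t st_Node by blast
  have len: "length ps = length ks + 1" "length ps \<le> B"
    using assms(2) list_all2_lengthD[OF a(6)] unfolding t by auto
  have "set ks \<subseteq> KS"
    using assms(2,4) unfolding t by (auto simp: set_mix)
  then have sub: "set (map Key ks) \<subseteq> V" "set ps \<subseteq> V"
    using sts_V[OF a(6) assms(5)] by auto
  have "length (snd (orient \<sigma> (ks, ps))) = length (fst (orient \<sigma> (ks, ps))) + 1"
    using len by (auto simp: orient_def)
  then have "(keysof (\<mu> a), take (length (keysof (\<mu> a)) + 1) (\<mu> (a + 1))) = orient \<sigma> (ks, ps)"
    unfolding a(4,5) by (simp only: keysof_pad take_pad prod.collapse)
  then have "orient \<sigma> (keysof (\<mu> a), take (length (keysof (\<mu> a)) + 1) (\<mu> (a + 1))) = (ks, ps)"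
    by (simp add: orient_def)
  then have "opens (st B \<sigma> \<mu> P) (orient \<sigma> (keysof (\<mu> a), take (length (keysof (\<mu> a)) + 1) (\<mu> (a + 1)))) t"
    using a(6) by (simp add: opens_def t)
  moreover have "length (\<mu> a) = B" "length (\<mu> (a + 1)) = B"
    unfolding a(4,5) using len by (auto simp: orient_def intro!: length_pad)
  moreover have "set (\<mu> a) \<subseteq> V" "set (\<mu> (a + 1)) \<subseteq> V"
    unfolding a(4,5) using sub by (auto simp: orient_def pad_def)
  ultimately show ?thesis using that a by blast
qed

lemma wp_read_nodes:
  assumes "sts B \<sigma> \<mu> P ps ts" "\<forall>t\<in>set ts. sh B lo h t \<and> set (ino t) \<subseteq> KS" "0 < h"
    and "P \<subseteq> R" "P \<subseteq> {..M}" "2 * length ps \<le> n" "2 * length ps \<le> w" "2 * length ps \<le> p"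
    and "\<And>nds. list_all2 (opens (st B \<sigma> \<mu> P)) nds ts \<Longrightarrow>
      wp (f nds) (n - 2 * length ps) R W (w - 2 * length ps) (p - 2 * length ps) Q \<mu>"
  shows "wp (read_nodes \<sigma> ps f) n R W w p Q \<mu>"
proof -
  let ?as = "\<lambda>ps. concat (map (\<lambda>p. case p of Num a \<Rightarrow> [a, Suc a] | _ \<Rightarrow> []) ps)"
  have "length (?as ps) = 2 * length ps \<and>
    (\<forall>a\<in>set (?as ps). a \<in> P \<and> length (\<mu> a) = B \<and> set (\<mu> a) \<subseteq> V) \<and>
    list_all2 (opens (st B \<sigma> \<mu> P)) (map (orient \<sigma>) (nodes (map \<mu> (?as ps)))) ts"
    using assms(1,2)
  proof (induction rule: list_all2_induct)
    case (Cons p ps t ts)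
    have t: "sh B lo h t" "set (ino t) \<subseteq> KS" using Cons.prems by auto
    obtain a where "p = Num a" "a \<in> P" "a + 1 \<in> P"
      "length (\<mu> a) = B" "set (\<mu> a) \<subseteq> V" "length (\<mu> (a + 1)) = B" "set (\<mu> (a + 1)) \<subseteq> V"
      "opens (st B \<sigma> \<mu> P) (orient \<sigma> (keysof (\<mu> a), take (length (keysof (\<mu> a)) + 1) (\<mu> (a + 1)))) t"
      by (rule st_node_blocks[OF Cons.hyps(1) t(1) assms(3) t(2) assms(5)])
    then show ?case using Cons.IH Cons.prems by simp
  qed simp
  then show ?thesis
    unfolding read_nodes_def using assms(4-)
    by (intro wp_rds) (auto simp: subset_iff)
qed

lemma node_ptrs_V: "a + 2 * n \<le> M + 1 \<Longrightarrow> set (node_ptrs a n) \<subseteq> V"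
  by (auto simp: node_ptrs_def)

lemma wp_node_writes:
  assumes rel: "list_all2 (\<lambda>(k, x) (k', y). k = k' \<and> sts B \<sigma> \<mu> P x y) gs tgs"
    and ok: "\<forall>(k, x)\<in>set gs. length k \<le> B \<and> length x \<le> B \<and> set k \<subseteq> KS"
    and mem: "{a..<a + 2 * length gs} \<subseteq> W" "{a..<a + 2 * length gs} \<inter> P = {}" "a + 2 * length gs \<le> M + 1"
      "P \<subseteq> {..M}" "P \<union> {a..<a + 2 * length gs} \<subseteq> P'"
    and len: "2 * length gs \<le> n" "2 * length gs \<le> w" "2 * length gs \<le> p"
    and k: "\<And>\<mu>'. sts B \<sigma> \<mu>' P' (node_ptrs a (length gs)) (map (case_prod Node) tgs) \<Longrightarrow>
        \<forall>x. x \<notin> {a..<a + 2 * length gs} \<longrightarrow> \<mu>' x = \<mu> x \<Longrightarrow>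
      wp k (n - 2 * length gs) R W (w - 2 * length gs) (p - 2 * length gs) Q \<mu>'"
  shows "wp (wrs (node_writes B \<sigma> a gs) k) n R W w p Q \<mu>"
proof -
  let ?ws = "node_writes B \<sigma> a gs"
  have addrs: "fst ` set ?ws = {a..<a + 2 * length gs}"
    using arg_cong[OF node_writes_addrs[of B \<sigma> a gs], of set] by simp
  have lws: "length ?ws = 2 * length gs"
    using arg_cong[OF node_writes_addrs[of B \<sigma> a gs], of length] by simp
  have sub: "\<forall>(k, x)\<in>set gs. set x \<subseteq> V"
    using rel by (induction rule: list_all2_induct) (auto dest!: sts_V[OF _ mem(4)])
  show ?thesis
  proof (rule wp_wrs)
    show "distinct (map fst ?ws)" by (simp add: node_writes_addrs)
    have "x \<in> W \<and> x \<le> M \<and> length b = B \<and> set b \<subseteq> V" if xb: "(x, b) \<in> set ?ws" for x b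
    proof -
      obtain q where q: "q < length gs" "b = pad B (map Key (fst (orient \<sigma> (gs ! q)))) \<or>
          b = pad B (snd (orient \<sigma> (gs ! q)))"
        using xb unfolding node_writes_def by (auto simp: case_prod_beta Let_def)
      obtain k y where g: "gs ! q = (k, y)" by fastforce
      then have "(k, y) \<in> set gs" using q(1) by (metis nth_mem)
      then have ky: "length k \<le> B" "length y \<le> B" "set k \<subseteq> KS" "set y \<subseteq> V" using ok sub by auto
      then have "set (map Key k) \<subseteq> V" by (auto simp: V)
      then have "length b = B \<and> set b \<subseteq> V"
        using q(2) ky unfolding g by (cases \<sigma>) (auto simp: orient_def intro!: length_pad dest!: in_set_pad)
      moreover have "x \<in> {a..<a + 2 * length gs}"
        using xb unfolding addrs[symmetric] by (metis fst_conv image_eqI)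
      ultimately show ?thesis using mem(1,3) by auto
    qed
    then show "\<forall>(x, b)\<in>set ?ws. x \<in> W \<and> x \<le> M \<and> length b = B \<and> set b \<subseteq> V"
      by blast
  next
    fix \<mu>' assume \<mu>': "\<forall>(x, b)\<in>set ?ws. \<mu>' x = b" "\<forall>x. x \<notin> fst ` set ?ws \<longrightarrow> \<mu>' x = \<mu> x"
    have "st B \<sigma> \<mu>' P' (Num (a + 2 * q)) (case_prod Node (tgs ! q))" if q: "q < length gs" for q
    proof -
      obtain k x where g: "gs ! q = (k, x)" by fastforce
      obtain y where t: "tgs ! q = (k, y)" "sts B \<sigma> \<mu> P x y"
        using list_all2_nthD[OF rel q] g by (auto split: prod.splits)
      have "(a + 2 * q, pad B (map Key (fst (orient \<sigma> (k, x))))) \<in> set ?ws"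
        "(a + 2 * q + 1, pad B (snd (orient \<sigma> (k, x)))) \<in> set ?ws"
        using q g unfolding node_writes_def by (force simp: case_prod_beta Let_def)+
      then have "\<mu>' (a + 2 * q) = pad B (map Key (fst (orient \<sigma> (k, x))))"
        "\<mu>' (a + 2 * q + 1) = pad B (snd (orient \<sigma> (k, x)))"
        using \<mu>'(1) by auto
      moreover have "sts B \<sigma> \<mu>' P' x y"
        using t(2) by (rule list_all2_mono) (rule st_mono, use mem \<mu>'(2) addrs in auto)
      ultimately show ?thesis
        using q mem(5) unfolding t(1) prod.case st_Node by (intro exI[of _ "a + 2 * q"] exI[of _ x]) auto
    qed
    then have "sts B \<sigma> \<mu>' P' (node_ptrs a (length gs)) (map (case_prod Node) tgs)"
      using list_all2_lengthD[OF rel] by (auto simp: list_all2_conv_all_nth node_ptrs_def)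
    then show "wp k (n - length ?ws) R W (w - length ?ws) (p - length ?ws) Q \<mu>'"
      using k \<mu>'(2) unfolding addrs lws by blast
  qed (use len lws in auto)
qed

end

section \<open>Trimming two adjacent nodes at a boundary\<close>

context btree_machine
begin

definition trimmed ::
  "nat \<Rightarrow> bool \<Rightarrow> nat set \<Rightarrow> nat \<Rightarrow> 'k list \<Rightarrow> nat \<Rightarrow> 'k mem \<Rightarrow> bool" where
  "trimmed a \<sigma> P h xs m \<mu> \<longleftrightarrow> (\<exists>nk np ns. \<mu> a = pad B (map Key nk @ np) \<and>
     sts B \<sigma> \<mu> (P \<union> {a..<a + m}) np ns \<and> length ns = length nk + 1 \<and> length nk \<le> 1 \<and>
     (\<forall>t\<in>set ns. sh B (mindeg B) h t) \<and> mix nk (map ino ns) = xs)"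

lemma trimmed_mailbox:
  assumes "trimmed a \<sigma> P h xs m \<mu>" "set xs \<subseteq> KS" "P \<subseteq> {..M}" "a + m \<le> M + 1"
  obtains nk np ns where "length (\<mu> a) = B" "set (\<mu> a) \<subseteq> V" "parse (\<mu> a) = (nk, np)"
    "sts B \<sigma> \<mu> (P \<union> {a..<a + m}) np ns" "length ns = length nk + 1" "length nk \<le> 1"
    "\<forall>t\<in>set ns. sh B (mindeg B) h t" "mix nk (map ino ns) = xs"
proof -
  obtain nk np ns where n: "\<mu> a = pad B (map Key nk @ np)"
    "sts B \<sigma> \<mu> (P \<union> {a..<a + m}) np ns" "length ns = length nk + 1" "length nk \<le> 1"
    "\<forall>t\<in>set ns. sh B (mindeg B) h t" "mix nk (map ino ns) = xs"
    using assms(1) unfolding trimmed_def by blast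
  have len: "length np = length nk + 1" using list_all2_lengthD[OF n(2)] n(3) by simp
  have "P \<union> {a..<a + m} \<subseteq> {..M}" using assms(3,4) by auto
  then have "set np \<subseteq> V" using sts_V n(2) by blast
  moreover have "set nk \<subseteq> KS"
    using assms(2) n(3,6) set_mix[of "map ino ns" nk] by auto
  ultimately have "set (\<mu> a) \<subseteq> V" unfolding n(1) by (auto simp: pad_def)
  moreover have "length (\<mu> a) = B" unfolding n(1) using len n(4) B3 by (intro length_pad) auto
  moreover have "parse (\<mu> a) = (nk, np)"
    unfolding n(1) using parse_words(2)[OF sts_plain[OF n(2)] len] .
  ultimately show ?thesis using that n by blast
qed

text \<open>After the cut at least \<open>mindeg B + 1\<close> subtrees remain: those of
  \<open>w\<close> and one of \<open>u\<close>. The recursive call replaces the first two by one or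
  two of the same height, so at least \<open>mindeg B\<close> and at most \<open>2 * B\<close> are
  left, enough for one or two valid nodes. A level costs 10 transfers: 4 reads for the nodes, 1 for
  the answer from below, at most 4 writes for new nodes and 1 for the answer.\<close>

lemma trim:
  assumes "sh B (mindeg B) h u" "sh B (mindeg B) h w"
    and "st B \<sigma> \<mu> P pu u" "st B \<sigma> \<mu> P pw w" "P \<subseteq> {..<a}" "a + 5 * (h + 1) \<le> M"
    and "set (ino u @ s # ino w) \<subseteq> KS" "b \<in> V"
    and "sorted_wrt (\<lambda>x y. beyond \<sigma> b y \<longrightarrow> beyond \<sigma> b x) (ino u @ s # ino w)" "\<not> beyond \<sigma> b s"
  shows "calls (trim_frame B a \<sigma> b s pu pw) (P \<union> {a..<a + 5 * (h + 1)}) {a..<a + 5 * (h + 1)}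
    (10 * h + 1) (10 * h + 1)
    (trimmed a \<sigma> P h (filter (\<lambda>x. \<not> beyond \<sigma> b x) (ino u @ s # ino w)) (5 * (h + 1))) \<mu>"
  using assms
proof (induction h arbitrary: \<mu> a u w s pu pw)
  case 0
  have ext: "u = External" "w = External" using "0.prems"(1,2) by (cases u; cases w; auto)+
  then have p: "pu = Blank" "pw = Blank" using "0.prems"(3,4) by auto
  let ?args = "[Num 2, Num a, Num (if \<sigma> then 1 else 0), b, Key s, pu, pw]"
  have ok: "length (frame B ?args) \<le> c" "set (frame B ?args) \<subseteq> V"
    using "0.prems"(6-8) M ext p by (intro frame_ok; auto)+
  have len: "length (pad B [Key s, Blank, Blank]) = B" using B3 by (simp add: length_pad)
  have "trimmed a \<sigma> P 0 [s] 5 (\<mu>(a := pad B [Key s, Blank, Blank]))"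
    unfolding trimmed_def by (rule exI[of _ "[s]"], rule exI[of _ "[Blank, Blank]"], rule exI[of _ "[External, External]"]) simp
  then show ?case
    unfolding trim_frame_def
    by (intro calls_body ok) (use len "0.prems" ext p in \<open>auto simp: body_simps trim_code_def pad_def simp del: fun_upd_apply\<close>)
next
  case (Suc h)
  let ?m = "mindeg B" and ?P = "beyond \<sigma> b"
  let ?keep = "filter (\<lambda>x. \<not> ?P x)"
  let ?I = "{a..<a + 5 * (Suc h + 1)}"
  note prems = Suc.prems
  have m: "2 \<le> ?m" "?m \<le> B" using B3 by auto
  have PM: "P \<subseteq> {..M}" using prems(5,6) by auto
  have "u \<noteq> External" using prems(1) by auto
  then have pu: "pu \<noteq> Blank" using st_ptr[OF prems(3)] by auto
  let ?args = "[Num 2, Num a, Num (if \<sigma> then 1 else 0), b, Key s, pu, pw]"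
  have ok: "length (frame B ?args) \<le> c" "set (frame B ?args) \<subseteq> V"
    using prems(6-8) M st_V[OF prems(3) PM] st_V[OF prems(4) PM] by (intro frame_ok; auto)+
  let ?Q = "trimmed a \<sigma> P (Suc h) (?keep (ino u @ s # ino w)) (5 * (Suc h + 1))"
  have "wp (trim_code B a \<sigma> b s pu pw) 20 (P \<union> ?I) ?I (10 * Suc h + 1) (10 * Suc h + 1) ?Q \<mu>"
    unfolding trim_code_def using pu
  proof (simp only: if_False, intro wp_read_nodes[where ts = "[u, w]"])
    fix nds assume nds: "list_all2 (opens (st B \<sigma> \<mu> P)) nds [u, w]"
    have shs: "\<forall>t\<in>set [u, w]. sh B ?m (Suc h) t" using prems(1,2) by simp
    define kk where "kk = mix [s] (map fst nds)"
    define cs where "cs = concat (map snd nds)"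
    define tc where "tc = concat (map kids [u, w])"
    have "length [u, w] = length [s] + 1" by simp
    note fat = opens_fat[OF nds this shs, folded kk_def cs_def tc_def]
    have xs: "mix kk (map ino tc) = ino u @ s # ino w" using fat(2) by simp
    obtain ks ps where cut: "cut_left ?P kk cs = (ks, ps)" by fastforce
    obtain ts where ts: "cut_left ?P kk tc = (ks, ts)" "sts B \<sigma> \<mu> P ps ts"
      using list_all2_cut_left[OF fat(1) cut] by blast
    note cl = cut_left[OF fat(3) ts(1), where f = ino, unfolded xs, OF prems(9)]
    obtain nu nw where nds_eq: "nds = [nu, nw]" "opens (st B \<sigma> \<mu> P) nu u" "opens (st B \<sigma> \<mu> P) nw w"
      using nds by (auto simp: list_all2_Cons2)
    have kk_eq: "kk = fst nu @ s # fst nw" by (simp add: kk_def nds_eq)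
    have "ks \<noteq> []"
      using ts(1) prems(10) unfolding cut_left_def kk_eq by (auto simp: dropWhile_eq_Nil_conv)
    then obtain k0 kr where ks: "ks = k0 # kr" by (cases ks) auto
    have lu: "length (kids u) = length (fst nu) + 1" and lw: "?m \<le> length (kids w)"
      and lb: "length (kids u) \<le> B" "length (kids w) \<le> B"
      using nds_eq(2,3) prems(1,2) by (cases u; cases w; auto simp: opens_def)+
    \<comment> \<open>The separator \<open>s\<close> is not beyond \<open>b\<close>, so the cut
      leaves at least the last child of \<open>u\<close>.\<close>
    have "length ts \<ge> length (kids w) + 1"
      using ts(1) length_takeWhile_le_prefix[of ?P s "fst nu" "fst nw", OF prems(10)] lu
      by (auto simp: cut_left_def kk_eq tc_def)
    moreover have "length ts \<le> length (kids u) + length (kids w)"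
      using ts(1) by (auto simp: cut_left_def tc_def)
    ultimately have lts: "?m + 1 \<le> length ts" "length ts \<le> 2 * B" using lw lb by auto
    obtain u' w' tr where tr: "ts = u' # w' # tr" "length tr = length kr"
      using cl(1) lts m ks by (cases ts; cases "tl ts") auto
    obtain pu' pw' pr where pr: "ps = pu' # pw' # pr" "st B \<sigma> \<mu> P pu' u'" "st B \<sigma> \<mu> P pw' w'"
        "sts B \<sigma> \<mu> P pr tr"
      using ts(2) unfolding tr(1) by (auto simp: list_all2_Cons2)
    have tcs: "set ts \<subseteq> set tc" using ts(1) by (auto simp: cut_left_def dest: in_set_dropD)
    then have shts: "\<forall>t\<in>set ts. sh B ?m h t" using fat(4) by auto
    obtain ys where ys: "ino u @ s # ino w = ys @ mix ks (map ino ts)" "\<forall>y\<in>set ys. ?P y"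
      using cl(2) by blast
    define tail where "tail = (if kr = [] then [] else hd kr # mix (tl kr) (map ino tr))"
    have tail: "mix ks (map ino ts) = (ino u' @ k0 # ino w') @ tail"
      using mix_replace[of "map ino tr" kr "[ino u', ino w']" "[k0]"] tr by (simp add: ks tail_def)
    have "\<not> ?P k0" using cl(3) ks by simp
    have sorted: "sorted_wrt (\<lambda>x y. ?P y \<longrightarrow> ?P x) (ys @ (ino u' @ k0 # ino w') @ tail)"
      using prems(9) unfolding ys(1) tail .
    have tailP: "\<forall>x\<in>set tail. \<not> ?P x"
      using sorted \<open>\<not> ?P k0\<close> by (auto simp: sorted_wrt_append)
    have filt: "?keep (ino u @ s # ino w) = ?keep (ino u' @ k0 # ino w') @ tail"
      unfolding ys(1) tail using ys(2) tailP by (simp add: filter_empty_conv filter_id_conv)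
    have KS': "set (ino u' @ k0 # ino w') \<subseteq> KS" "set tail \<subseteq> KS"
      using prems(7) unfolding ys(1) tail by auto
    have hd: "ks ! 0 = k0" "ps ! 0 = pu'" "ps ! 1 = pw'" "drop 1 ks = kr" "drop 2 ps = pr"
      by (simp_all add: ks pr(1))
    let ?J = "{a + 5..<a + 5 + 5 * (h + 1)}"
    have call: "calls (trim_frame B (a + 5) \<sigma> b k0 pu' pw') (P \<union> ?J) ?J (10 * h + 1) (10 * h + 1)
      (trimmed (a + 5) \<sigma> P h (?keep (ino u' @ k0 # ino w')) (5 * (h + 1))) \<mu>"
      using shts tr pr prems(5,6,8) KS'(1) sorted \<open>\<not> ?P k0\<close>
      by (intro Suc.IH) (auto simp: sorted_wrt_append)
    have flen: "length (trim_frame B (a + 5) \<sigma> b k0 pu' pw') \<le> c"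
      using c by (simp add: trim_frame_def frame_def)
    show "wp (let (ks, ps) = cut_left ?P (mix [s] (map fst nds)) (concat (map snd nds))
        in Fk [trim_frame B (a + 5) \<sigma> b (ks ! 0) (ps ! 0) (ps ! 1)]
             (Rd (a + 5) (regroup_code B a \<sigma> (drop 1 ks) (drop 2 ps))))
      (20 - 2 * length [pu, pw]) (P \<union> ?I) ?I (10 * Suc h + 1 - 2 * length [pu, pw])
      (10 * Suc h + 1 - 2 * length [pu, pw]) ?Q \<mu>"
      unfolding kk_def[symmetric] cs_def[symmetric] cut Let_def prod.case
      hd
    proof (rule wp_call[OF call _ _ _ _ _ flen])
      fix \<mu>1 assume \<mu>1: "trimmed (a + 5) \<sigma> P h (?keep (ino u' @ k0 # ino w')) (5 * (h + 1)) \<mu>1"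
        "\<forall>x. x \<notin> ?J \<longrightarrow> \<mu>1 x = \<mu> x"
      let ?P1 = "P \<union> ?J"
      obtain nk np ns where mb: "length (\<mu>1 (a + 5)) = B" "set (\<mu>1 (a + 5)) \<subseteq> V" "parse (\<mu>1 (a + 5)) = (nk, np)"
        "sts B \<sigma> \<mu>1 ?P1 np ns" "length ns = length nk + 1" "length nk \<le> 1"
        "\<forall>t\<in>set ns. sh B ?m h t" "mix nk (map ino ns) = ?keep (ino u' @ k0 # ino w')"
      proof (rule trimmed_mailbox[OF \<mu>1(1)])
        show "set (?keep (ino u' @ k0 # ino w')) \<subseteq> KS" using KS'(1) by auto
      qed (use PM prems(6) in auto)
      have rest: "sts B \<sigma> \<mu>1 ?P1 pr tr"
        using pr(4) by (rule list_all2_mono) (rule st_mono, use prems(5) \<mu>1(2) in auto)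
      then have all: "sts B \<sigma> \<mu>1 ?P1 (np @ pr) (ns @ tr)"
        using mb(4) by (rule list_all2_appendI[rotated])
      obtain ss gs where ch: "chunk B (nk @ kr) (np @ pr) = (ss, gs)" by fastforce
      have lall: "length (ns @ tr) = length (nk @ kr) + 1" using mb(5) tr(2) by simp
      have lpr: "length (np @ pr) = length (nk @ kr) + 1" using list_all2_lengthD[OF all] lall by simp
      have le: "length (ns @ tr) \<le> 2 * B" "?m \<le> length (ns @ tr)"
        using mb(5,6) lts tr(1) by auto
      have shall: "\<forall>t\<in>set (ns @ tr). sh B ?m h t" using mb(7) shts tr(1) by auto
      have B2: "2 \<le> B" using B3 by simp
      obtain tgs where tgs: "list_all2 (\<lambda>(k, x) (k', y). k = k' \<and> sts B \<sigma> \<mu>1 ?P1 x y) gs tgs"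
          "mix ss (map ino (map (case_prod Node) tgs)) = mix (nk @ kr) (map ino (ns @ tr))"
          "\<forall>t\<in>set (map (case_prod Node) tgs). sh B ?m (Suc h) t"
        using chunk_trees[OF ch all lall B2 shall le(2) order_refl] by blast
      let ?nodes = "map (case_prod Node) tgs"
      note chs = chunk[OF ch lpr B2]
      have gs2: "length gs \<le> 2" using chs(6)[of 2] le(1) list_all2_lengthD[OF all] by simp
      have inorder: "mix (nk @ kr) (map ino (ns @ tr)) = ?keep (ino u @ s # ino w)"
        using mix_replace[of "map ino tr" kr "map ino ns" nk] mb(5,8) tr(2) filt by (simp add: tail_def)
      have kset: "set (nk @ kr) \<subseteq> KS"
      proof -
        have "set (nk @ kr) \<subseteq> set (?keep (ino u @ s # ino w))"
          unfolding inorder[symmetric] using lall by (subst set_mix) auto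
        also have "\<dots> \<subseteq> set (ino u @ s # ino w)" by (rule filter_is_subset)
        finally have "set (nk @ kr) \<subseteq> set (ino u @ s # ino w)" .
        from this prems(7) show ?thesis by (rule subset_trans)
      qed
      note gok = chunk_keys(1)[OF ch lpr B2 kset] and sset = chunk_keys(2)[OF ch lpr B2 kset]
      have "wp (wrs (node_writes B \<sigma> (a + 1) gs) (Wr a (pad B (map Key ss @ node_ptrs (a + 1) (length gs))) Done))
        14 (P \<union> ?I) ?I 5 5 ?Q \<mu>1"
      proof (rule wp_node_writes[OF tgs(1) gok, where P' = "?P1 \<union> {a + 1..<a + 5}"])
        fix \<mu>2 assume \<mu>2: "sts B \<sigma> \<mu>2 (?P1 \<union> {a + 1..<a + 5}) (node_ptrs (a + 1) (length gs)) ?nodes"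
          "\<forall>x. x \<notin> {a + 1..<a + 1 + 2 * length gs} \<longrightarrow> \<mu>2 x = \<mu>1 x"
        let ?b = "pad B (map Key ss @ node_ptrs (a + 1) (length gs))"
        have bl: "length ?b = B" using chs(3) gs2 B3 by (intro length_pad) simp
        have bV: "set ?b \<subseteq> V"
          using node_ptrs_V[of "a + 1" "length gs"] gs2 prems(6) sset by (auto simp: pad_def)
        have "?P1 \<union> {a + 1..<a + 5} \<subseteq> P \<union> ?I" by auto
        moreover have "a \<notin> ?P1 \<union> {a + 1..<a + 5}" using prems(5) by auto
        ultimately have "sts B \<sigma> (\<mu>2(a := ?b)) (P \<union> ?I) (node_ptrs (a + 1) (length gs)) ?nodes"
          using \<mu>2(1) by (elim list_all2_mono st_mono) auto
        then have "?Q (\<mu>2(a := ?b))"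
          unfolding trimmed_def using chs(3) gs2 tgs(2,3) inorder list_all2_lengthD[OF tgs(1)]
          by (intro exI[of _ ss] exI[of _ "node_ptrs (a + 1) (length gs)"] exI[of _ "?nodes"]) simp
        then show "wp (Wr a ?b Done) (14 - 2 * length gs) (P \<union> ?I) ?I (5 - 2 * length gs) (5 - 2 * length gs) ?Q \<mu>2"
          using bl bV gs2 prems(6) by (simp del: fun_upd_apply)
      qed (use gs2 prems(5,6) in auto)
      then show "wp (Rd (a + 5) (regroup_code B a \<sigma> kr pr))
         (20 - 2 * length [pu, pw] - 1) (P \<union> ?I) ?I (10 * Suc h + 1 - 2 * length [pu, pw] - (10 * h + 1))
         (10 * Suc h + 1 - 2 * length [pu, pw] - (10 * h + 1)) ?Q \<mu>1"
        using mb(1-3) prems(6) ch by (simp add: regroup_code_def)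
    qed auto
  qed (use prems PM in auto)
  then show ?case
    unfolding trim_frame_def by (intro calls_body ok) (simp only: body_simps)
qed

end

section \<open>Assembling the tree of a gap\<close>

text \<open>The middle of a gap between its two trimmed ends, including the adjacent keys. Its
  subtrees are shared without being opened.\<close>

definition bridge :: "'a list \<Rightarrow> 'a list list \<Rightarrow> 'a list" where
  "bridge ks xs = hd ks # concat (map2 (\<lambda>x k. x @ [k]) xs (tl ks))"

lemma mix_bridge:
  assumes "length c1 = length k1 + 1" "length ks = length xs + 1" "length c2 = length k2 + 1"
  shows "mix (k1 @ ks @ k2) (c1 @ xs @ c2) = mix k1 c1 @ bridge ks xs @ mix k2 c2"
proof -
  obtain k ks' where ks: "ks = k # ks'" "length ks' = length xs" using assms(2) by (cases ks) auto
  have "c2 \<noteq> []" using assms(3) by auto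
  have "mix (ks' @ k2) (xs @ c2) = concat (map2 (\<lambda>x k. x @ [k]) xs ks') @ mix k2 c2"
    using ks(2) by (induction ks' xs rule: list_induct2) auto
  then show ?thesis using mix_append[OF assms(1)] by (simp add: ks(1) bridge_def)
qed

lemma beyond_mono:
  "beyond False b x \<Longrightarrow> y \<le> x \<Longrightarrow> beyond False b y" "beyond True b x \<Longrightarrow> x \<le> y \<Longrightarrow> beyond True b y"
  by (auto simp: beyond_def split: word.splits)

definition inside :: "'k::linorder word \<Rightarrow> 'k word \<Rightarrow> 'k \<Rightarrow> bool" where
  "inside lo hi x \<longleftrightarrow> \<not> beyond False lo x \<and> \<not> beyond True hi x"

lemma list_both_ends:
  assumes "4 \<le> length xs"
  obtains a b ys c d where "xs = a # b # ys @ [c, d]"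
proof -
  obtain a b zs where xs: "xs = a # b # zs" using assms by (cases xs; cases "tl xs") auto
  then have "2 \<le> length zs" using assms by simp
  then obtain zs' d where "zs = zs' @ [d]" by (cases zs rule: rev_cases) auto
  moreover then obtain ys c where "zs' = ys @ [c]" using \<open>2 \<le> length zs\<close> by (cases zs' rule: rev_cases) auto
  ultimately show ?thesis using that xs by simp
qed

context btree_machine
begin

lemma wp_emit:
  assumes ts: "sts B False \<mu> P ps ts" "length ts = length ks + 1" "length ts \<le> 3 * B"
    and sh: "\<forall>t\<in>set ts. sh B (mindeg B) h t" and ks: "set ks \<subseteq> KS"
    and P: "P \<subseteq> {..M}" "{a..<a + 8} \<inter> P = {}" "out \<notin> P \<union> {a..<a + 8}" "a + 8 \<le> M" "out \<le> M"
    and W: "{a..<a + 8} \<subseteq> W" "out \<in> W"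
    and post: "\<And>\<mu>' p t h'. \<mu>' out = pad B [p] \<Longrightarrow> st B False \<mu>' (P \<union> {a..<a + 8}) p t \<Longrightarrow> sh B 2 h' t \<Longrightarrow>
      ino t = mix ks (map ino ts) \<Longrightarrow> Q \<mu>'"
  shows "wp (emit_code B a out ks ps) 9 R W 9 9 Q \<mu>"
proof (cases "ks = []")
  case True
  then obtain t where t: "ts = [t]" using ts(2) by (cases ts) auto
  then obtain p where p: "ps = [p]" "st B False \<mu> P p t"
    using ts(1) by (auto simp: list_all2_Cons2)
  have "sh B (mindeg B) h t" using sh t by simp
  then have "sh B 2 h t" by (rule sh_mono) (use B3 in simp)
  moreover have "st B False (\<mu>(out := pad B [p])) (P \<union> {a..<a + 8}) p t"
    using p(2) P(3) by (elim st_mono) auto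
  ultimately have "Q (\<mu>(out := pad B [p]))"
    using t True by (intro post) auto
  moreover have "length (pad B [p]) = B" "set (pad B [p]) \<subseteq> V"
    using B3 st_V[OF p(2) P(1)] by (auto simp: pad_def)
  ultimately show ?thesis using True p(1) W P(5) by (simp add: emit_code_def del: fun_upd_apply)
next
  case False
  let ?m = "mindeg B"
  have B2: "2 \<le> B" using B3 by simp
  have m: "2 \<le> ?m" "?m \<le> B" using B3 by auto
  have lps: "length ps = length ks + 1" using list_all2_lengthD[OF ts(1)] ts(2) by simp
  obtain ss gs where ch: "chunk B ks ps = (ss, gs)" by fastforce
  note chs = chunk[OF ch lps B2]
  have gs3: "length gs \<le> 3" using chs(6)[of 3] ts(3) list_all2_lengthD[OF ts(1)] by (simp add: mult.commute)
  \<comment> \<open>A single group becomes the root, where two subtrees are enough. Several groups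
    become children of a new root; they arise only from more than \<open>B\<close> subtrees, and
    then all of them reach \<open>mindeg B\<close>.\<close>
  define lo where "lo = (if ss = [] then 2 else ?m)"
  have lo: "lo \<le> length ts" "lo \<le> ?m"
  proof -
    have "?m \<le> length ps" if "ss \<noteq> []"
    proof (rule ccontr)
      assume "\<not> ?m \<le> length ps"
      then have "gs = [(ks, ps)]" using chs(7) m by simp
      then show False using chs(3) that by simp
    qed
    then show "lo \<le> length ts" "lo \<le> ?m"
      using False ts(2) lps m by (cases ks; simp add: lo_def)+
  qed
  obtain tgs where tgs: "list_all2 (\<lambda>(k, x) (k', y). k = k' \<and> sts B False \<mu> P x y) gs tgs"
      "mix ss (map ino (map (case_prod Node) tgs)) = mix ks (map ino ts)"
      "\<forall>t\<in>set (map (case_prod Node) tgs). sh B lo (Suc h) t"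
    using chunk_trees[OF ch ts(1,2) B2 sh lo] by blast
  let ?nodes = "map (case_prod Node) tgs"
  have ltgs: "length tgs = length gs" using list_all2_lengthD[OF tgs(1)] by simp
  note gok = chunk_keys(1)[OF ch lps B2 ks] and sset = chunk_keys(2)[OF ch lps B2 ks]
  let ?I = "{a..<a + 8}"
  have np: "\<forall>x\<in>P. a \<le> x \<longrightarrow> a + 8 \<le> x"
    using P(2) by (metis atLeastLessThan_iff disjoint_iff not_le)
  have blk: "length (pad B [Num x]) = B" "set (pad B [Num x]) \<subseteq> V" if "x \<le> M" for x
    using B3 that by (auto simp: pad_def)
  have "wp (wrs (node_writes B False a gs)
      (if ss = [] then Wr out (pad B [Num a]) Done
       else wrs (node_writes B False (a + 6) [(ss, node_ptrs a (length gs))]) (Wr out (pad B [Num (a + 6)]) Done)))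
    9 R W 9 9 Q \<mu>"
  proof (rule wp_node_writes[OF tgs(1) gok, where P' = "P \<union> {a..<a + 6}"])
    fix \<mu>1 assume \<mu>1: "sts B False \<mu>1 (P \<union> {a..<a + 6}) (node_ptrs a (length gs)) ?nodes"
      "\<forall>x. x \<notin> {a..<a + 2 * length gs} \<longrightarrow> \<mu>1 x = \<mu> x"
    show "wp (if ss = [] then Wr out (pad B [Num a]) Done
       else wrs (node_writes B False (a + 6) [(ss, node_ptrs a (length gs))]) (Wr out (pad B [Num (a + 6)]) Done))
      (9 - 2 * length gs) R W (9 - 2 * length gs) (9 - 2 * length gs) Q \<mu>1"
    proof (cases "ss = []")
      case True
      then obtain t where t: "?nodes = [t]"
        using chs(3) ltgs by (cases tgs) auto
      have "st B False \<mu>1 (P \<union> {a..<a + 6}) (Num a) t"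
        using \<mu>1(1) t chs(3) True by (simp add: node_ptrs_def)
      then have "st B False (\<mu>1(out := pad B [Num a])) (P \<union> ?I) (Num a) t"
        by (rule st_mono) (use P(3) in auto)
      then have "Q (\<mu>1(out := pad B [Num a]))"
        using tgs(2,3) t True by (intro post[of _ "Num a" t "Suc h"]) (auto simp: lo_def)
      then show ?thesis
        using True gs3 W P(4,5) blk[of a] by (simp del: fun_upd_apply)
    next
      case False
      let ?g = "[(ss, node_ptrs a (length gs))]" and ?t = "[(ss, ?nodes)]"
      have "2 \<le> length gs" using chs(3) False by (cases ss) auto
      have "wp (wrs (node_writes B False (a + 6) ?g) (Wr out (pad B [Num (a + 6)]) Done))
        (9 - 2 * length gs) R W (9 - 2 * length gs) (9 - 2 * length gs) Q \<mu>1"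
      proof (rule wp_node_writes[where tgs = ?t and P = "P \<union> {a..<a + 6}" and P' = "P \<union> ?I"])
        fix \<mu>2 assume \<mu>2: "sts B False \<mu>2 (P \<union> ?I) (node_ptrs (a + 6) (length ?g)) (map (case_prod Node) ?t)"
        have "st B False \<mu>2 (P \<union> ?I) (Num (a + 6)) (Node ss ?nodes)"
          using \<mu>2 by (simp add: node_ptrs_def)
        then have "st B False (\<mu>2(out := pad B [Num (a + 6)])) (P \<union> ?I) (Num (a + 6)) (Node ss ?nodes)"
          by (rule st_mono) (use P(3) in auto)
        moreover have "sh B 2 (Suc (Suc h)) (Node ss ?nodes)"
          using tgs(3) False \<open>2 \<le> length gs\<close> gs3 B3 chs(3) ltgs by (auto simp: lo_def)
        moreover have "(\<mu>2(out := pad B [Num (a + 6)])) out = pad B [Num (a + 6)]" by simp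
        moreover have "ino (Node ss ?nodes) = mix ks (map ino ts)"
          using tgs(2) by simp
        ultimately have "Q (\<mu>2(out := pad B [Num (a + 6)]))" using post by blast
        then show "wp (Wr out (pad B [Num (a + 6)]) Done) (9 - 2 * length gs - 2 * length ?g) R W
            (9 - 2 * length gs - 2 * length ?g) (9 - 2 * length gs - 2 * length ?g) Q \<mu>2"
          using gs3 W P(4,5) blk[of "a + 6"] by (simp del: fun_upd_apply)
      next
        show "list_all2 (\<lambda>(k, x) (k', y). k = k' \<and> sts B False \<mu>1 (P \<union> {a..<a + 6}) x y) ?g ?t"
          using \<mu>1(1) by simp
        show "\<forall>(k, x)\<in>set ?g. length k \<le> B \<and> length x \<le> B \<and> set k \<subseteq> KS"
          using sset gs3 chs(3) B3 by simp
      qed (use gs3 P(1,3-) np W in auto)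
      then show ?thesis using False by simp
    qed
  qed (use gs3 P(1,3-) np W in auto)
  then show ?thesis using False by (simp add: emit_code_def ch)
qed

text \<open>Two trims of \<open>10 * h + 1\<close>, two reads of their answers and at most 9 writes
  for the result give \<open>20 * h + 13\<close>. A trim replaces two subtrees by at most two, so
  the bound \<open>3 * B\<close> on their number persists.\<close>

lemma wp_carve:
  assumes ts: "sts B False \<mu> P ps ts" "length ts = length ks + 1" "4 \<le> length ts" "length ts \<le> 3 * B"
    and sh: "\<forall>t\<in>set ts. sh B (mindeg B) h t"
    and xs: "set (mix ks (map ino ts)) \<subseteq> KS" "sorted_wrt (<) (mix ks (map ino ts))"
    and lohi: "lo \<in> V" "hi \<in> V" "\<forall>k\<in>set ks. inside lo hi k"
    and P: "P \<subseteq> {..<a}" "out \<notin> P" "out < a" "a + 8 + 5 * (h + 1) \<le> a'" "a' + 5 * (h + 1) \<le> M"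
    and RW: "P \<subseteq> R" "{a..<a' + 5 * (h + 1)} \<subseteq> R" "{a..<a' + 5 * (h + 1)} \<subseteq> W" "out \<in> W"
    and post: "\<And>\<mu>' p t h'. \<mu>' out = pad B [p] \<Longrightarrow> st B False \<mu>' (P \<union> {a..<a' + 5 * (h + 1)}) p t \<Longrightarrow>
      sh B 2 h' t \<Longrightarrow> ino t = filter (inside lo hi) (mix ks (map ino ts)) \<Longrightarrow> Q \<mu>'"
  shows "wp (carve_code B a a' out lo hi ks ps) 13 R W (20 * h + 13) (20 * h + 13) Q \<mu>"
proof -
  let ?m = "mindeg B"
  let ?L = "beyond False lo" and ?H = "beyond True hi"
  let ?keepL = "filter (\<lambda>x. \<not> ?L x)" and ?keepH = "filter (\<lambda>x. \<not> ?H x)"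
  obtain u1 w1 tm w2 u2 where t: "ts = u1 # w1 # tm @ [w2, u2]" using list_both_ends[OF ts(3)] .
  obtain pu1 pw1 pm pw2 pu2 where p: "ps = pu1 # pw1 # pm @ [pw2, pu2]"
    using list_both_ends[of ps] list_all2_lengthD[OF ts(1)] ts(3) by metis
  have lpm: "length pm = length tm" using list_all2_lengthD[OF ts(1)] by (simp add: p t)
  have stp: "st B False \<mu> P pu1 u1" "st B False \<mu> P pw1 w1" "sts B False \<mu> P pm tm"
    "st B False \<mu> P pw2 w2" "st B False \<mu> P pu2 u2"
    using ts(1) lpm unfolding p t by (auto simp: list_all2_append)
  obtain s1 km s2 where k: "ks = s1 # km @ [s2]"
  proof -
    obtain s1 ks' where ks': "ks = s1 # ks'" using ts(2) t by (cases ks) auto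
    then obtain km s2 where "ks' = km @ [s2]" using ts(2) t by (cases ks' rule: rev_cases) auto
    then show ?thesis using that ks' by simp
  qed
  have lkm: "length km = length tm + 1" using ts(2) by (simp add: k t)
  let ?x1 = "ino u1 @ s1 # ino w1" and ?x2 = "ino w2 @ s2 # ino u2"
  let ?br = "bridge km (map ino tm)"
  have mixall: "mix ks (map ino ts) = ?x1 @ ?br @ ?x2"
    using mix_bridge[of "[ino u1, ino w1]" "[s1]" km "map ino tm" "[ino w2, ino u2]" "[s2]"] lkm
    by (simp add: k t)
  have sorted: "sorted_wrt (<) (?x1 @ ?br @ ?x2)" using xs(2) unfolding mixall .
  have inKS: "set ?x1 \<subseteq> KS" "set ?br \<subseteq> KS" "set ?x2 \<subseteq> KS" using xs(1) unfolding mixall by auto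
  have s12: "inside lo hi s1" "inside lo hi s2" using lohi(3) by (auto simp: k)
  have mono: "beyond False lo x" if "beyond False lo y" "x < y" for x y
    using beyond_mono(1) that by (metis less_imp_le)
  have mono': "beyond True hi y" if "beyond True hi x" "x < y" for x y
    using beyond_mono(2) that by (metis less_imp_le)
  \<comment> \<open>Since \<open>s1\<close> and \<open>s2\<close> lie inside, the left end can only
    violate \<open>lo\<close>, the right end only \<open>hi\<close>, and the middle neither of
    them.\<close>
  have filt: "filter (inside lo hi) (mix ks (map ino ts)) =
    ?keepL ?x1 @ ?br @ ?keepH ?x2"
  proof -
    have lt: "\<forall>x\<in>set ?x1. x < s2" "\<forall>x\<in>set ?br. s1 < x \<and> x < s2" "\<forall>x\<in>set ?x2. s1 < x"
      using sorted by (auto simp: sorted_wrt_append)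
    have 1: "inside lo hi x \<longleftrightarrow> \<not> ?L x" if "x \<in> set ?x1" for x
      using lt(1) that s12 mono' unfolding inside_def by blast
    have 2: "inside lo hi x" if "x \<in> set ?br" for x
      using lt(2) that s12 mono' mono unfolding inside_def by blast
    have 3: "inside lo hi x \<longleftrightarrow> \<not> ?H x" if "x \<in> set ?x2" for x
      using lt(3) that s12 mono unfolding inside_def by blast
    show ?thesis unfolding mixall filter_append[of _ "ino u1 @ s1 # ino w1"] filter_append[of _ ?br]
      using 1 2 3 by (metis (no_types, lifting) filter_cong filter_True)
  qed
  have shs: "sh B ?m h u1" "sh B ?m h w1" "sh B ?m h w2" "sh B ?m h u2" "\<forall>t\<in>set tm. sh B ?m h t"
    using sh by (auto simp: t)
  let ?J = "{a + 8..<a + 8 + 5 * (h + 1)}" and ?J' = "{a'..<a' + 5 * (h + 1)}"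
  have call1: "calls (trim_frame B (a + 8) False lo s1 pu1 pw1) (P \<union> ?J) ?J (10 * h + 1) (10 * h + 1)
    (trimmed (a + 8) False P h (?keepL ?x1) (5 * (h + 1))) \<mu>"
  proof (rule trim)
    show "sorted_wrt (\<lambda>x y. ?L y \<longrightarrow> ?L x) ?x1"
      using sorted mono by (auto simp: sorted_wrt_append elim!: sorted_wrt_mono_rel[rotated])
  qed (use shs stp P inKS lohi s12 in \<open>auto simp: inside_def\<close>)
  have call2: "calls (trim_frame B a' True hi s2 pu2 pw2) (P \<union> ?J') ?J' (10 * h + 1) (10 * h + 1)
    (trimmed a' True P h (?keepH (rev ?x2)) (5 * (h + 1))) \<mu>1"
    if "\<forall>x\<in>P. \<mu>1 x = \<mu> x" for \<mu>1
  proof -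
    have rev: "rev ?x2 = ino (mir u2) @ s2 # ino (mir w2)"
      using ino_mir shs by (simp add: ino_mir[OF shs(3)] ino_mir[OF shs(4)])
    have "sorted_wrt (\<lambda>x y. ?H y \<longrightarrow> ?H x) (rev ?x2)"
      unfolding sorted_wrt_rev using sorted mono'
      by (auto simp: sorted_wrt_append elim!: sorted_wrt_mono_rel[rotated])
    moreover have "set (rev ?x2) \<subseteq> KS" using inKS(3) by simp
    moreover have "st B True \<mu>1 P pu2 (mir u2)" "st B True \<mu>1 P pw2 (mir w2)"
      using stp(4,5) that by (auto simp: st_def elim: stored_tree_mono)
    ultimately show ?thesis
      unfolding rev using shs P lohi s12 by (intro trim) (auto simp: inside_def)
  qed
  have flen: "length (trim_frame B x \<sigma> b s u w) \<le> c" for x \<sigma> b s u w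
    using c by (simp add: trim_frame_def frame_def)
  have n: "length ps = length tm + 4" by (simp add: p lpm)
  have code: "ks ! 0 = s1" "ps ! 0 = pu1" "ps ! 1 = pw1" "ks ! (length ps - 2) = s2"
    "ps ! (length ps - 1) = pu2" "ps ! (length ps - 2) = pw2" "tl (butlast ks) = km"
    "drop 2 (take (length ps - 2) ps) = pm"
    using lkm lpm unfolding n by (auto simp: k p nth_append butlast_append)
  show ?thesis unfolding carve_code_def Let_def code
  proof (rule wp_call[OF call1 _ _ _ _ _ flen])
    fix \<mu>1 assume \<mu>1: "trimmed (a + 8) False P h (?keepL ?x1) (5 * (h + 1)) \<mu>1"
      "\<forall>x. x \<notin> ?J \<longrightarrow> \<mu>1 x = \<mu> x"
    have agree1: "\<forall>x\<in>P. \<mu>1 x = \<mu> x" using \<mu>1(2) P(1) by auto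
    show "wp (Fk [trim_frame B a' True hi s2 pu2 pw2]
        (Rd (a + 8) (\<lambda>m. Rd a' (glue_code B a out km pm m))))
      (13 - 1) R W (20 * h + 13 - (10 * h + 1)) (20 * h + 13 - (10 * h + 1)) Q \<mu>1"
    proof (rule wp_call[OF call2[OF agree1] _ _ _ _ _ flen])
      fix \<mu>2 assume \<mu>2: "trimmed a' True P h (?keepH (rev ?x2)) (5 * (h + 1)) \<mu>2"
        "\<forall>x. x \<notin> ?J' \<longrightarrow> \<mu>2 x = \<mu>1 x"
      have PM: "P \<subseteq> {..M}" using P by auto
      let ?P = "P \<union> ?J \<union> ?J'"
      obtain nk np ns where mb: "length (\<mu>1 (a + 8)) = B" "set (\<mu>1 (a + 8)) \<subseteq> V" "parse (\<mu>1 (a + 8)) = (nk, np)"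
        "sts B False \<mu>1 (P \<union> ?J) np ns" "length ns = length nk + 1" "length nk \<le> 1"
        "\<forall>t\<in>set ns. sh B ?m h t" "mix nk (map ino ns) = ?keepL ?x1"
      proof (rule trimmed_mailbox[OF \<mu>1(1) _ PM])
        show "set (?keepL ?x1) \<subseteq> KS" using inKS(1) by auto
      qed (use P in auto)
      obtain nk' np' ns' where mb': "length (\<mu>2 a') = B" "set (\<mu>2 a') \<subseteq> V" "parse (\<mu>2 a') = (nk', np')"
        "sts B True \<mu>2 (P \<union> ?J') np' ns'" "length ns' = length nk' + 1" "length nk' \<le> 1"
        "\<forall>t\<in>set ns'. sh B ?m h t" "mix nk' (map ino ns') = ?keepH (rev ?x2)"
      proof (rule trimmed_mailbox[OF \<mu>2(1) _ PM])
        show "set (?keepH (rev ?x2)) \<subseteq> KS" using inKS(3) by auto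
      qed (use P in auto)
      have "\<mu>2 (a + 8) = \<mu>1 (a + 8)" using \<mu>2(2) P(4) by auto
      have agree2: "\<mu>2 x = \<mu>1 x" if "x \<in> P \<union> ?J" for x using \<mu>2(2) P(1,4) that by auto
      have l1: "sts B False \<mu>2 ?P np ns"
        using mb(4) by (rule list_all2_mono) (rule st_mono, use agree2 in auto)
      have l2: "sts B False \<mu>2 ?P pm tm"
        using stp(3) by (rule list_all2_mono) (rule st_mono, use agree1 agree2 in auto)
      have "sts B False \<mu>2 ?P np' (map mir ns')"
        unfolding list_all2_map2 using mb'(4)
        by (rule list_all2_mono) (auto simp: st_def elim: stored_tree_mono)
      then have l3: "sts B False \<mu>2 ?P (rev np') (rev (map mir ns'))" by simp
      let ?ts = "ns @ tm @ rev (map mir ns')" and ?ks = "nk @ km @ rev nk'"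
      have all: "sts B False \<mu>2 ?P (np @ pm @ rev np') ?ts"
        using l1 l2 l3 by (intro list_all2_appendI)
      have "map ino (rev (map mir ns')) = rev (map rev (map ino ns'))"
        using ino_mir[OF bspec[OF mb'(7)]] by (simp add: rev_map)
      then have "mix (rev nk') (map ino (rev (map mir ns'))) = rev (mix nk' (map ino ns'))"
        using mix_rev[of "map rev (map ino ns')" nk'] mb'(5) by (simp only: length_map) (simp add: o_def)
      also have "\<dots> = ?keepH ?x2" unfolding mb'(8) by (simp only: rev_filter rev_rev_ident)
      finally have right: "mix (rev nk') (map ino (rev (map mir ns'))) = ?keepH ?x2" .
      have inorder: "mix ?ks (map ino ?ts) = filter (inside lo hi) (mix ks (map ino ts))"
        using mix_bridge[of "map ino ns" nk km "map ino tm" "map ino (rev (map mir ns'))" "rev nk'"]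
          mb(5,8) mb'(5) lkm right filt by simp
      have len: "length ?ts = length ?ks + 1" using mb(5) mb'(5) lkm by simp
      have "wp (emit_code B a out ?ks (np @ pm @ rev np')) 9 R W 9 9 Q \<mu>2"
      proof (rule wp_emit[OF all len])
        show "length ?ts \<le> 3 * B" using mb(5,6) mb'(5,6) ts(4) by (simp add: t)
        show "\<forall>t\<in>set ?ts. sh B ?m h t" using mb(7) mb'(7) shs(5) by auto
        have "set ?ks \<subseteq> set (mix ?ks (map ino ?ts))" using len by (subst set_mix) auto
        also have "\<dots> \<subseteq> set (mix ks (map ino ts))" unfolding inorder by (rule filter_is_subset)
        finally have "set ?ks \<subseteq> set (mix ks (map ino ts))" .
        from this xs(1) show "set ?ks \<subseteq> KS" by (rule subset_trans)
      next
        fix \<mu>' p t h'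
        assume r: "\<mu>' out = pad B [p]" "st B False \<mu>' (?P \<union> {a..<a + 8}) p t" "sh B 2 h' t" "ino t = mix ?ks (map ino ?ts)"
        have "{a..<a + 8} \<union> ?J \<union> ?J' \<subseteq> {a..<a' + 5 * (h + 1)}" using P(4) by auto
        then have "st B False \<mu>' (P \<union> {a..<a' + 5 * (h + 1)}) p t"
          using r(2) by (elim st_mono) auto
        from r(1) this r(3) show "Q \<mu>'" by (rule post) (use r(4) inorder in simp)
      qed (use P RW in auto)
      then show "wp (Rd (a + 8) (\<lambda>m. Rd a' (glue_code B a out km pm m)))
        (13 - 1 - 1) R W (20 * h + 13 - (10 * h + 1) - (10 * h + 1)) (20 * h + 13 - (10 * h + 1) - (10 * h + 1)) Q \<mu>2"
        using mb(1-3) mb'(1-3) \<open>\<mu>2 (a + 8) = \<mu>1 (a + 8)\<close> P RW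
        by (simp add: glue_code_def subset_iff)
    qed (use P RW in auto)
  qed (use P RW in auto)
qed

end

text \<open>The outermost remaining subtrees may still contain keys outside of the bounds, so the
  inorder sequences agree only after filtering.\<close>

lemma restrict:
  fixes ks :: "'k::linorder list"
  assumes "restrict lo hi ks xs = (ks', xs')" "length xs = length ks + 1"
    and "sorted_wrt (<) (mix ks (map f xs))"
  shows "length xs' = length ks' + 1" "\<forall>k\<in>set ks'. inside lo hi k"
    and "sorted_wrt (<) (mix ks' (map f xs'))" "set xs' \<subseteq> set xs" "length xs' \<le> length xs"
    and "set (mix ks' (map f xs')) \<subseteq> set (mix ks (map f xs))"
    and "set ks' \<subseteq> set ks"
    and "filter (inside lo hi) (mix ks' (map f xs')) = filter (inside lo hi) (mix ks (map f xs))"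
proof -
  let ?L = "beyond False lo" and ?H = "beyond True hi"
  obtain ks1 xs1 where c1: "cut_left ?L ks xs = (ks1, xs1)" by fastforce
  have c2: "cut_right ?H ks1 xs1 = (ks', xs')" using assms(1) c1 by (simp add: restrict_def)
  have s1: "sorted_wrt (\<lambda>a b. ?L b \<longrightarrow> ?L a) (mix ks (map f xs))"
    using assms(3) by (rule sorted_wrt_mono_rel[rotated]) (meson beyond_mono(1) less_imp_le)
  note l = cut_left[OF assms(2) c1 s1]
  obtain ys where ys: "mix ks (map f xs) = ys @ mix ks1 (map f xs1)" "\<forall>y\<in>set ys. ?L y" using l(2) by blast
  have s1': "sorted_wrt (<) (mix ks1 (map f xs1))" using assms(3) unfolding ys(1) by (simp add: sorted_wrt_append)
  have s2: "sorted_wrt (\<lambda>a b. ?H a \<longrightarrow> ?H b) (mix ks1 (map f xs1))"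
    using s1' by (rule sorted_wrt_mono_rel[rotated]) (meson beyond_mono(2) less_imp_le)
  note r = cut_right[OF l(1) c2 s2]
  obtain zs where zs: "mix ks1 (map f xs1) = mix ks' (map f xs') @ zs" "\<forall>z\<in>set zs. ?H z" using r(2) by blast
  show "length xs' = length ks' + 1" by (rule r(1))
  have sub1: "set ks' \<subseteq> set ks1" "set ks1 \<subseteq> set ks"
    using c2 c1 by (auto simp: cut_right_def cut_left_def dest: set_takeWhileD set_dropWhileD)
  then show "set ks' \<subseteq> set ks" by simp
  show "\<forall>k\<in>set ks'. inside lo hi k" using l(3) r(3) sub1 by (auto simp: inside_def)
  show "sorted_wrt (<) (mix ks' (map f xs'))" using s1' unfolding zs(1) by (simp add: sorted_wrt_append)
  show "set xs' \<subseteq> set xs" "length xs' \<le> length xs"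
    using c1 c2 by (auto simp: cut_left_def cut_right_def dest: in_set_takeD in_set_dropD)
  show "set (mix ks' (map f xs')) \<subseteq> set (mix ks (map f xs))" unfolding ys(1) zs(1) by auto
  show "filter (inside lo hi) (mix ks' (map f xs')) = filter (inside lo hi) (mix ks (map f xs))"
    unfolding ys(1) zs(1) using ys(2) zs(2) by (simp add: inside_def filter_empty_conv)
qed

lemma list_all2_restrict:
  assumes "list_all2 R xs ys" "restrict lo hi ks xs = (ks', xs')"
  shows "\<exists>ys'. restrict lo hi ks ys = (ks', ys') \<and> list_all2 R xs' ys'"
proof -
  obtain k1 x1 where c: "cut_left (beyond False lo) ks xs = (k1, x1)" by fastforce
  obtain y1 where "cut_left (beyond False lo) ks ys = (k1, y1)" "list_all2 R x1 y1"
    using list_all2_cut_left[OF assms(1) c] by blast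
  moreover then obtain y2 where "cut_right (beyond True hi) k1 y1 = (ks', y2)" "list_all2 R xs' y2"
    using list_all2_cut_right[of R x1 y1] assms(2) c by (fastforce simp: restrict_def)
  ultimately show ?thesis by (simp add: restrict_def)
qed

section \<open>Splitting a tree\<close>

text \<open>The minimum counts the levels \<open>j\<close> with \<open>1 \<le> j \<le> D\<close> and
  \<open>2 * j + 2 \<le> s\<close>. At each of them a key of height \<open>s\<close> pays at most
  once, namely \<open>s + 1\<close> for each of up to \<open>B\<close> parts.\<close>

definition level_cost :: "nat \<Rightarrow> nat \<Rightarrow> nat \<Rightarrow> nat" where
  "level_cost B D s = B * (s + 1) * min D ((s - 2) div 2)"

lemma level_cost_mono: "level_cost B D s \<le> level_cost B (Suc D) s"
  unfolding level_cost_def by (intro mult_le_mono2) auto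

lemma level_cost_step:
  "2 * Suc D + 2 \<le> s \<Longrightarrow> level_cost B D s + B * (s + 1) \<le> level_cost B (Suc D) s"
proof -
  assume "2 * Suc D + 2 \<le> s"
  then have "Suc D \<le> (s - 2) div 2" by presburger
  then show ?thesis by (simp add: level_cost_def min_def)
qed

lemma level_cost_le: "level_cost B D s \<le> key_cost B s"
proof (cases "4 \<le> s")
  case True
  have "level_cost B D s \<le> B * ((s + 1) * ((s - 2) div 2))"
    unfolding level_cost_def mult.assoc by (intro mult_le_mono2) auto
  also have "(s + 1) * ((s - 2) div 2) \<le> (2 * s) * ((s - 2) div 2)"
    using True by (intro mult_le_mono1) simp
  also have "\<dots> \<le> s * s" unfolding mult.commute[of 2] mult.assoc by (intro mult_le_mono2) linarith
  finally show ?thesis using True by (simp add: key_cost_def power2_eq_square)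
qed (auto simp: level_cost_def)

locale splitting = btree_machine B L c V KS M
  for B L c :: nat and V :: "'k::linorder word set" and KS M +
  fixes T :: "'k btree" and hT :: nat and keys_arr :: "'k list" and \<mu>0 :: "'k mem" and kp fp :: nat
  assumes shT: "sh B 2 hT T" and sortedT: "sorted_wrt (<) (ino T)" and T_KS: "set (ino T) \<subseteq> KS"
    and ks: "keys_arr \<noteq> []" "sorted_wrt (<) keys_arr" "set keys_arr \<subseteq> KS"
    and stored_arr: "stored_keys B \<mu>0 {..<fp} kp keys_arr"
    and hT: "hT \<le> B * fp" and M_region: "region B (length keys_arr) fp (length keys_arr + 1) \<le> M"
    and kp: "kp \<le> M"
begin

abbreviation "d \<equiv> length keys_arr"

definition lo_key :: "nat \<Rightarrow> 'k word" where
  "lo_key i = (if 0 < i then Key (keys_arr ! (i - 1)) else Blank)"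

definition hi_key :: "nat \<Rightarrow> 'k word" where
  "hi_key e = (if e \<le> d then Key (keys_arr ! (e - 1)) else Blank)"

definition rng :: "nat \<Rightarrow> nat \<Rightarrow> 'k \<Rightarrow> bool" where
  "rng i D = inside (lo_key i) (hi_key (i + B ^ D))"

definition reg :: "nat \<Rightarrow> nat set" where
  "reg i = insert (fp + i) {region B d fp i..<region B d fp (i + 1)}"

definition regs :: "nat \<Rightarrow> nat \<Rightarrow> nat set" where
  "regs i D = (\<Union>j\<in>{i..<min (i + B ^ D) (d + 1)}. reg j)"

definition gap_done :: "nat \<Rightarrow> 'k mem \<Rightarrow> bool" where
  "gap_done i \<mu> \<longleftrightarrow> (\<exists>p t h. \<mu> (fp + i) = pad B [p] \<and> st B False \<mu> ({..<fp} \<union> reg i) p t \<and> sh B 2 h t \<and>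
     sorted_wrt (<) (ino t) \<and> set (ino t) = set (ino T) \<inter> gap keys_arr i)"

definition gaps_done :: "nat \<Rightarrow> nat \<Rightarrow> 'k mem \<Rightarrow> bool" where
  "gaps_done i D \<mu> \<longleftrightarrow> (\<forall>j\<in>{i..<min (i + B ^ D) (d + 1)}. gap_done j \<mu>)"

text \<open>What the keys in the range may still be charged at level \<open>D\<close> and
  below.\<close>

definition pot :: "nat \<Rightarrow> nat \<Rightarrow> nat" where
  "pot i D = (\<Sum>p\<in>{p\<in>levels hT T. rng i D (fst p)}. level_cost B D (snd p))"

text \<open>
  The second bound is linear in the number of gaps and keys. A split at a node of height \<open>t\<close> costs
  every part \<open>O(t)\<close>; if this is more than the level of the range, then it is paid by a key of
  height \<open>t\<close> in the range.
\<close>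

definition work :: "nat \<Rightarrow> nat \<Rightarrow> nat \<Rightarrow> nat" where
  "work i D t = min (30 * (1 + range_cost B d D i) * (t + 2))
     (30 * (t + 1) + 30 * range_cost B d D i + 30 * pot i D)"

text \<open>Stated for the initial memory, because blocks below \<open>fp\<close> are never written
  and a window thus stays valid in all later threads. The nodes cover the range but may exceed it;
  the last conjunct preserves the heights needed for charging keys.\<close>

definition window :: "nat \<Rightarrow> nat \<Rightarrow> nat \<Rightarrow> 'k list \<Rightarrow> 'k word list \<Rightarrow> 'k btree list \<Rightarrow> bool" where
  "window i D t ss ps ts \<longleftrightarrow> sts B False \<mu>0 {..<fp} ps ts \<and>
     length ts = length ss + 1 \<and> length ts \<le> 3 \<and> (\<forall>u\<in>set ts. sh B 1 t u) \<and> t \<le> hT \<and>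
     sorted_wrt (<) (mix ss (map ino ts)) \<and> set (mix ss (map ino ts)) \<subseteq> set (ino T) \<and>
     {x \<in> set (ino T). rng i D x} \<subseteq> set (mix ss (map ino ts)) \<and>
     (\<Union>u\<in>set ts. levels t u) \<subseteq> levels hT T"

section \<open>Ranges, their regions and their parts\<close>

lemma gap_eq: "i \<le> d \<Longrightarrow> gap keys_arr i = {x. rng i 0 x}"
  by (auto simp: gap_def rng_def inside_def beyond_def lo_key_def hi_key_def not_le)

lemma region_mono: "i \<le> j \<Longrightarrow> region B d fp i \<le> region B d fp j"
  by (simp add: region_def)

lemma region_Suc: "region B d fp (i + 1) = region B d fp i + 10 * (B * fp) + 40"
  by (simp add: region_def)

lemma fp_region: "j \<le> d \<Longrightarrow> fp + j < region B d fp i"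
  by (simp add: region_def)

lemma reg_disjoint:
  assumes "i \<le> d" "j \<le> d" "i \<noteq> j"
  shows "reg i \<inter> reg j = {}"
proof -
  have "reg i \<inter> reg j = {}" if "i < j" "j \<le> d" for i j
  proof -
    have "region B d fp (i + 1) \<le> region B d fp j" using that by (intro region_mono) auto
    then show ?thesis using that fp_region[of i j] fp_region[of j i] by (auto simp: reg_def)
  qed
  then show ?thesis using assms by (cases i j rule: linorder_cases) (auto simp: Int_commute)
qed

lemma reg_above: "a \<in> reg i \<Longrightarrow> fp \<le> a"
  using fp_region[of 0 i] by (auto simp: reg_def)

lemma fp_le_M: "{..<fp} \<subseteq> {..M}" "d \<le> M"
  using M_region by (auto simp: region_def)

lemma keys_mono: "i \<le> j \<Longrightarrow> j < d \<Longrightarrow> keys_arr ! i \<le> keys_arr ! j"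
  using sorted_wrt_nth_less[OF ks(2), of i j] by (cases "i = j") auto

lemma rng_sub:
  assumes "i \<le> i'" "i' + B ^ D' \<le> i + B ^ D" "i' \<le> d" "rng i' D' x"
  shows "rng i D x"
proof -
  have "0 < B ^ D'" using B3 by simp
  have "\<not> beyond False (lo_key i) x"
  proof (cases "0 < i")
    case True
    then have "keys_arr ! (i - 1) \<le> keys_arr ! (i' - 1)" using assms by (intro keys_mono) auto
    then show ?thesis using assms(1,4) True by (auto simp: rng_def inside_def beyond_def lo_key_def)
  qed (simp add: beyond_def lo_key_def)
  moreover have "\<not> beyond True (hi_key (i + B ^ D)) x"
  proof (cases "i + B ^ D \<le> d")
    case True
    then have "keys_arr ! (i' + B ^ D' - 1) \<le> keys_arr ! (i + B ^ D - 1)"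
      by (intro keys_mono) (use True assms(1-3) \<open>0 < B ^ D'\<close> in linarith)+
    then show ?thesis using assms(2,4) True by (auto simp: rng_def inside_def beyond_def hi_key_def)
  qed (simp add: beyond_def hi_key_def)
  ultimately show ?thesis by (simp add: rng_def inside_def)
qed

lemma rng_disjoint:
  assumes "i + B ^ D \<le> i'" "i' \<le> d" "rng i D x" "rng i' D' x"
  shows False
proof -
  have "0 < B ^ D" using B3 by simp
  then have "keys_arr ! (i + B ^ D - 1) \<le> keys_arr ! (i' - 1)"     by (intro keys_mono) (use assms(1,2) in linarith)+
  moreover have "0 < i'" "i + B ^ D \<le> d" using assms(1,2) \<open>0 < B ^ D\<close> by linarith+
  ultimately show False
    using assms(3,4) by (auto simp: rng_def inside_def beyond_def lo_key_def hi_key_def)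
qed

lemma part:
  assumes "i \<le> d" "q < parts B d D i"
  shows "i + q * B ^ D \<le> d" "i + q * B ^ D + B ^ D \<le> i + B ^ Suc D"
proof -
  have "q \<le> (d - i) div B ^ D" "q + 1 \<le> B" using assms(2) unfolding parts_def by linarith+
  from this(1) have q1: "q * B ^ D \<le> (d - i) div B ^ D * B ^ D" by (rule mult_le_mono1)
  from \<open>q + 1 \<le> B\<close> have q2: "(q + 1) * B ^ D \<le> B * B ^ D" by (rule mult_le_mono1)
  show "i + q * B ^ D \<le> d"
    using q1 assms(1) div_times_less_eq_dividend[of "d - i" "B ^ D"] by linarith
  show "i + q * B ^ D + B ^ D \<le> i + B ^ Suc D"
    using q2 by (simp add: algebra_simps)
qed

lemma parts_le: "parts B d D i \<le> B" "0 < parts B d D i"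
  using B3 by (auto simp: parts_def)

lemma part_cover:
  assumes "i \<le> j" "j < i + B ^ Suc D" "j \<le> d"
  shows "\<exists>q<parts B d D i. i + q * B ^ D \<le> j \<and> j < i + q * B ^ D + B ^ D"
proof (intro exI conjI)
  let ?q = "(j - i) div B ^ D"
  have s: "0 < B ^ D" using B3 by simp
  have "j - i < B * B ^ D" using assms by simp
  then have "?q < B" using s by (simp add: less_mult_imp_div_less)
  moreover have "?q \<le> (d - i) div B ^ D" using assms(3) by (intro div_le_mono) auto
  ultimately show "?q < parts B d D i" by (simp add: parts_def)
  have "?q * B ^ D \<le> j - i" by (rule div_times_less_eq_dividend)
  then show "i + ?q * B ^ D \<le> j" using assms(1) by linarith
  have "j - i < ?q * B ^ D + B ^ D" using s by (metis add.commute dividend_less_div_times)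
  then show "j < i + ?q * B ^ D + B ^ D" using assms(1) by simp
qed

text \<open>The parts are disjoint, so no key is charged twice at the same level. If the height is
  large for the level, the key \<open>x\<close> provides a further
  \<open>B * (s + 1)\<close>.\<close>

lemma pot_split:
  assumes "i \<le> d"
    and "2 * Suc D + 2 \<le> s \<Longrightarrow> \<exists>x. (x, s) \<in> levels hT T \<and> rng i (Suc D) x"
  shows "(\<Sum>q<parts B d D i. pot (i + q * B ^ D) D) + (if 2 * Suc D + 2 \<le> s then B * (s + 1) else 0)
    \<le> pot i (Suc D)"
proof -
  let ?S = "\<lambda>q. {p\<in>levels hT T. rng (i + q * B ^ D) D (fst p)}"
  let ?A = "{p\<in>levels hT T. rng i (Suc D) (fst p)}"
  let ?f = "\<lambda>p. level_cost B D (snd p)" and ?g = "\<lambda>p. level_cost B (Suc D) (snd p)"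
  have fin: "finite ?A" using finite_levels[of hT T] by simp
  have sub: "(\<Union>q<parts B d D i. ?S q) \<subseteq> ?A"
    using part[OF assms(1)] by (auto intro: rng_sub[rotated 3])
  have less: "?S q \<inter> ?S q' = {}" if "q < q'" "q' < parts B d D i" for q q'
  proof -
    have "(q + 1) * B ^ D \<le> q' * B ^ D" using that by (intro mult_le_mono1) auto
    then have "i + q * B ^ D + B ^ D \<le> i + q' * B ^ D" by simp
    then show ?thesis using rng_disjoint part(1)[OF assms(1) that(2)] by fast
  qed
  have "?S q \<inter> ?S q' = {}" if "q < parts B d D i" "q' < parts B d D i" "q \<noteq> q'" for q q'
    using less[of q q'] less[of q' q] that by (cases q q' rule: linorder_cases) (simp_all add: Int_commute)
  then have "(\<Sum>q<parts B d D i. pot (i + q * B ^ D) D) = sum ?f (\<Union>q<parts B d D i. ?S q)"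
    unfolding pot_def by (intro sum.UNION_disjoint[symmetric]) (auto simp: finite_levels)
  also have "\<dots> \<le> sum ?f ?A" using fin sub by (rule sum_mono2) simp
  finally have 1: "(\<Sum>q<parts B d D i. pot (i + q * B ^ D) D) \<le> sum ?f ?A" .
  show ?thesis
  proof (cases "2 * Suc D + 2 \<le> s")
    case True
    then obtain x where x: "(x, s) \<in> ?A" using assms(2) by auto
    have "sum ?f ?A + B * (s + 1) = sum ?f (?A - {(x, s)}) + (?f (x, s) + B * (s + 1))"
      using sum.remove[OF fin x, of ?f] by simp
    also have "\<dots> \<le> sum ?g (?A - {(x, s)}) + ?g (x, s)"
      using level_cost_step[OF True] by (intro add_mono sum_mono level_cost_mono) simp
    also have "\<dots> = pot i (Suc D)" using sum.remove[OF fin x, of ?g] by (simp add: pot_def)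
    finally show ?thesis using 1 True by simp
  next
    case False
    have "sum ?f ?A \<le> sum ?g ?A" by (intro sum_mono level_cost_mono)
    then show ?thesis using 1 False by (simp add: pot_def)
  qed
qed

text \<open>For the first bound it is enough that every part contributes at least 1 to
  \<open>range_cost\<close>. For the second, the terms \<open>30 * (t + 1)\<close> of the parts are
  covered by their charges \<open>2 * D + 4\<close> if \<open>t\<close> is small and by a key of
  height \<open>t\<close> otherwise; the range's own \<open>30 * (t + 1)\<close> is left over for
  the remaining 8.\<close>

lemma work_split:
  assumes "i \<le> d"
    and "2 * Suc D + 2 \<le> t \<Longrightarrow> \<exists>x. (x, t) \<in> levels hT T \<and> rng i (Suc D) x"
  shows "(\<Sum>q<parts B d D i. work (i + q * B ^ D) D t) + 8 \<le> work i (Suc D) t"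
proof -
  let ?p = "parts B d D i"
  let ?E = "\<lambda>q. range_cost B d D (i + q * B ^ D)" and ?F = "\<lambda>q. pot (i + q * B ^ D) D"
  have E: "range_cost B d (Suc D) i = ?p * (2 * D + 4) + sum ?E {..<?p}"
    by (simp add: sum.distrib)
  have "(\<Sum>q<?p. work (i + q * B ^ D) D t) \<le> (\<Sum>q<?p. 30 * (1 + ?E q) * (t + 2))"
    unfolding work_def by (intro sum_mono) simp
  also have "\<dots> = 30 * (?p + sum ?E {..<?p}) * (t + 2)"
    by (simp add: sum.distrib flip: sum_distrib_left sum_distrib_right)
  also have "\<dots> + 8 \<le> 30 * (?p + sum ?E {..<?p}) * (t + 2) + 30 * (t + 2)" by simp
  also have "\<dots> = 30 * (1 + ?p + sum ?E {..<?p}) * (t + 2)" by (simp add: algebra_simps)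
  also have "\<dots> \<le> 30 * (1 + range_cost B d (Suc D) i) * (t + 2)"
    unfolding E by (intro mult_le_mono1 mult_le_mono2) simp
  finally have 1: "(\<Sum>q<?p. work (i + q * B ^ D) D t) + 8 \<le> 30 * (1 + range_cost B d (Suc D) i) * (t + 2)"
    by simp
  have "(\<Sum>q<?p. work (i + q * B ^ D) D t) \<le> (\<Sum>q<?p. 30 * (t + 1) + 30 * ?E q + 30 * ?F q)"
    unfolding work_def by (intro sum_mono) simp
  also have "\<dots> = 30 * (?p * (t + 1)) + 30 * sum ?E {..<?p} + 30 * sum ?F {..<?p}"
    by (simp add: sum.distrib algebra_simps flip: sum_distrib_left)
  also have "\<dots> \<le> 30 * range_cost B d (Suc D) i + 30 * pot i (Suc D)"
  proof (cases "2 * Suc D + 2 \<le> t")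
    case True
    have "?p * (t + 1) \<le> B * (t + 1)" using parts_le(1) by (rule mult_le_mono1)
    then show ?thesis using pot_split[OF assms] True unfolding E by simp
  next
    case False
    then have "?p * (t + 1) \<le> ?p * (2 * D + 4)" by (intro mult_le_mono2) simp
    then show ?thesis using pot_split[OF assms] False unfolding E by simp
  qed
  finally have "(\<Sum>q<?p. work (i + q * B ^ D) D t) + 8 \<le>
      30 * (t + 1) + 30 * range_cost B d (Suc D) i + 30 * pot i (Suc D)" by simp
  then show ?thesis using 1 by (simp only: work_def min.bounded_iff)
qed

lemma work_descend: "work i D t + 30 \<le> work i D (Suc t)"
  by (simp add: work_def min_def)

lemma work_ge: "30 * (t + 1) \<le> work i D t"
proof -
  have "30 * 1 * (t + 1) \<le> 30 * (1 + range_cost B d D i) * (t + 2)" by (intro mult_le_mono) auto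
  then show ?thesis by (simp add: work_def)
qed

lemma gap_done_agree:
  assumes "gap_done i \<mu>q" "\<forall>a\<in>{..<fp} \<union> reg i. \<mu> a = \<mu>q a"
  shows "gap_done i \<mu>"
proof -
  have "fp + i \<in> reg i" by (simp add: reg_def)
  then show ?thesis using assms unfolding gap_done_def by (metis UnI2 order_refl st_mono)
qed

end

lemma set_mix_Nil: "\<forall>x\<in>set xs. x = [] \<Longrightarrow> length xs = length ks + 1 \<Longrightarrow> set (mix ks xs) = set ks"
  by (auto simp: set_mix)

section \<open>Induction over levels of ranges and heights of nodes\<close>

context splitting
begin

abbreviation good :: "'k mem \<Rightarrow> bool" where
  "good \<mu> \<equiv> \<forall>a<fp. \<mu> a = \<mu>0 a"

abbreviation scope :: "nat \<Rightarrow> nat \<Rightarrow> nat set" where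
  "scope i D \<equiv> {..<fp} \<union> regs i D"

abbreviation range_at :: "nat \<Rightarrow> nat \<Rightarrow> 'k list \<Rightarrow> 'k word list \<Rightarrow> 'k word list" where
  "range_at i D ss ps \<equiv> range_frame B d kp fp i D (map Key ss @ ps)"

abbreviation descend_at :: "nat \<Rightarrow> nat \<Rightarrow> 'k list \<Rightarrow> 'k word list \<Rightarrow> 'k word list" where
  "descend_at i D ss ps \<equiv>
     descend_frame B d kp fp i D (lo_key i) (hi_key (i + B ^ D)) (map Key ss @ ps)"

text \<open>The budgets are smaller by 2 than in \<open>ranges\<close>, where up to two bounds of
  the range are read first.\<close>

definition descends :: "nat \<Rightarrow> nat \<Rightarrow> bool" where
  "descends D t \<longleftrightarrow> (\<forall>i ss ps ts \<mu>. i \<le> d \<longrightarrow> window i D t ss ps ts \<longrightarrow> good \<mu> \<longrightarrow>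
     calls (descend_at i D ss ps)
       (scope i D) (regs i D) (work i D t - 2) (30 * (D + t + 2) - 2) (gaps_done i D) \<mu>)"

definition ranges :: "nat \<Rightarrow> nat \<Rightarrow> bool" where
  "ranges D t \<longleftrightarrow> (\<forall>i ss ps ts \<mu>. i \<le> d \<longrightarrow> window i D t ss ps ts \<longrightarrow> good \<mu> \<longrightarrow>
     calls (range_at i D ss ps)
       (scope i D) (regs i D) (work i D t) (30 * (D + t + 2)) (gaps_done i D) \<mu>)"

lemma lohi_V: "i \<le> d \<Longrightarrow> lo_key i \<in> V" "0 < e \<Longrightarrow> hi_key e \<in> V"
  by (auto simp: lo_key_def hi_key_def intro!: subsetD[OF ks(3) nth_mem])

lemma window_words:
  assumes "window i D t ss ps ts"
  shows "parse (map Key ss @ ps) = (ss, ps)" "set ss \<subseteq> KS" "set ps \<subseteq> V" "length ps \<le> 3"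
    "length ss \<le> 2" "length ps = length ts"
proof -
  have w: "sts B False \<mu>0 {..<fp} ps ts" "length ts = length ss + 1" "length ts \<le> 3"
    "set (mix ss (map ino ts)) \<subseteq> set (ino T)"
    using assms by (auto simp: window_def)
  have l: "length ps = length ts" using list_all2_lengthD[OF w(1)] .
  show "parse (map Key ss @ ps) = (ss, ps)"
    using parse_words(1)[OF sts_plain[OF w(1)]] l w(2) by simp
  have "set ss \<subseteq> set (mix ss (map ino ts))" using w(2) by (subst set_mix) auto
  then show "set ss \<subseteq> KS" using w(4) T_KS by blast
  show "set ps \<subseteq> V" using sts_V[OF w(1) fp_le_M(1)] .
  show "length ps \<le> 3" "length ss \<le> 2" "length ps = length ts" using l w(2,3) by auto
qed

lemma wp_read_key:
  assumes "ok \<Longrightarrow> j < d" "good \<mu>" "{..<fp} \<subseteq> R" "0 < n" "0 < w" "0 < p"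
    and "wp (f (if ok then Key (keys_arr ! j) else Blank)) (n - 1) R W (w - 1) (p - 1) Q \<mu>"
  shows "wp (read_key B kp ok j f) n R W w p Q \<mu>"
proof (cases ok)
  case True
  define q r where "q = j div B" and "r = j mod B"
  have j: "j < d" "q * B + r = j" "r < B" using assms(1) True B3 by (auto simp: q_def r_def)
  then have "q * B < d" by linarith
  then have a: "kp + q < fp" "\<mu>0 (kp + q) = pad B (take B (drop (q * B) (map Key keys_arr)))"
    using stored_arr unfolding stored_keys_def by auto
  have "length (take B (drop (q * B) (map Key keys_arr))) \<le> B" by simp
  then have len: "length (\<mu>0 (kp + q)) = B" unfolding a(2) by (rule length_pad)
  have sub: "set (\<mu>0 (kp + q)) \<subseteq> V"
  proof -
    have "set (map Key keys_arr) \<subseteq> V" using ks(3) unfolding V by auto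
    moreover have "set (take B (drop (q * B) (map Key keys_arr))) \<subseteq> set (map Key keys_arr)"
      by (meson order_trans set_take_subset set_drop_subset)
    ultimately show ?thesis unfolding a(2) by (intro set_pad_subset V_simps(1)) (rule subset_trans)
  qed
  have "r < d - q * B" using j by linarith
  then have "\<mu>0 (kp + q) ! r = Key (keys_arr ! j)"
    unfolding a(2) pad_def using j by (simp add: nth_append)
  moreover have "\<mu> (kp + q) = \<mu>0 (kp + q)" using a(1) assms(2) by simp
  moreover have "kp + q \<in> R" "kp + q \<le> M" using a(1) assms(3) fp_le_M(1) by auto
  ultimately show ?thesis
    using True assms(4-7) len sub by (simp add: read_key_def flip: q_def r_def)
next
  case False
  have "wp (f Blank) (n - 1) R W (w - 1) (p - 1) Q \<mu>"
    using assms(7) False by simp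
  then have "wp (f Blank) n R W w p Q \<mu>" by (rule wp_mono) auto
  then show ?thesis using False by (simp add: read_key_def)
qed

lemma ranges_if_descends:
  assumes "descends D t" "D \<le> d"
  shows "ranges D t"
  unfolding ranges_def
proof (intro allI impI)
  fix i ss ps ts \<mu> assume i: "i \<le> d" and win: "window i D t ss ps ts" and good: "good \<mu>"
  let ?ws = "map Key ss @ ps"
  let ?R = "scope i D"
  have BD: "0 < B ^ D" using B3 by simp
  note ww = window_words[OF win]
  have call: "calls (descend_at i D ss ps)
       ?R (regs i D) (work i D t - 2) (30 * (D + t + 2) - 2) (gaps_done i D) \<mu>"
    using assms(1) i win good unfolding descends_def by blast
  have flen: "length (descend_at i D ss ps) \<le> c"
    using ww(4,5) c by (simp add: descend_frame_def frame_def)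
  have w: "30 \<le> work i D t" using work_ge[of t i D] by simp
  have "wp (range_code B d kp fp i D ?ws) 20 ?R (regs i D) (work i D t) (30 * (D + t + 2)) (gaps_done i D) \<mu>"
    unfolding range_code_def
  proof (rule wp_read_key)
    show "wp (read_key B kp (i + B ^ D \<le> d) (i + B ^ D - 1)
        (\<lambda>hi. Fk [descend_frame B d kp fp i D (if 0 < i then Key (keys_arr ! (i - 1)) else Blank) hi ?ws] Done))
      (20 - 1) ?R (regs i D) (work i D t - 1) (30 * (D + t + 2) - 1) (gaps_done i D) \<mu>"
    proof (rule wp_read_key)
      have "wp (Fk [descend_at i D ss ps] Done)
        (20 - 1 - 1) ?R (regs i D) (work i D t - 1 - 1) (30 * (D + t + 2) - 1 - 1) (gaps_done i D) \<mu>"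
        by (rule wp_call[OF call _ _ _ _ _ flen]) auto
      then show "wp (Fk [descend_frame B d kp fp i D (if 0 < i then Key (keys_arr ! (i - 1)) else Blank)
            (if i + B ^ D \<le> d then Key (keys_arr ! (i + B ^ D - 1)) else Blank) ?ws] Done)
        (20 - 1 - 1) ?R (regs i D) (work i D t - 1 - 1) (30 * (D + t + 2) - 1 - 1) (gaps_done i D) \<mu>"
        by (simp only: lo_key_def hi_key_def)
    next
      show "i + B ^ D \<le> d \<Longrightarrow> i + B ^ D - 1 < d" using BD by linarith
    qed (use good w in auto)
  qed (use i good w in auto)
  moreover have "set ([Num 0, Num d, Num kp, Num fp, Num i, Num D] @ ?ws) \<subseteq> V"
    using ww(2,3) i assms(2) fp_le_M M_region kp by (auto simp: region_def)
  ultimately show "calls (range_at i D ss ps)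
       ?R (regs i D) (work i D t) (30 * (D + t + 2)) (gaps_done i D) \<mu>"
    unfolding range_frame_def using ww(4,5)
    by (intro calls_body frame_ok) (simp_all only: body_simps, simp_all)
qed

lemma window_part:
  assumes "window i (Suc D) t ss ps ts" "i \<le> d" "q < parts B d D i"
  shows "window (i + q * B ^ D) D t ss ps ts"
  using assms(1) rng_sub[of i "i + q * B ^ D" D "Suc D"] part[OF assms(2,3)]
  unfolding window_def by fastforce

lemma wp_split:
  assumes rng: "ranges D t" and i: "i \<le> d" and win: "window i (Suc D) t ss ps ts" and good: "good \<mu>"
    and key: "2 * Suc D + 2 \<le> t \<Longrightarrow> \<exists>x. (x, t) \<in> levels hT T \<and> rng i (Suc D) x"
  shows "wp (split_code B d kp fp i D (map Key ss @ ps)) 1 (scope i (Suc D)) (regs i (Suc D))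
    (work i (Suc D) t - 8) (30 * (D + t + 2)) (gaps_done i (Suc D)) \<mu>"
proof -
  let ?p = "parts B d D i" and ?i = "\<lambda>q. i + q * B ^ D"
  let ?cs = "map (\<lambda>q. range_at (?i q) D ss ps) [0..<?p]"
  note ww = window_words[OF win]
  have sub: "regs (?i q) D \<subseteq> regs i (Suc D)" if "q < ?p" for q
    using part[OF i that] by (fastforce simp: regs_def)
  have disj: "regs (?i q) D \<inter> (scope (?i q') D \<union> regs (?i q') D) = {}"
    if "q < ?p" "q' < ?p" "q \<noteq> q'" for q q'
  proof -
    have apart: "?i a + B ^ D \<le> ?i b" if "a < b" for a b
    proof -
      have "(a + 1) * B ^ D \<le> b * B ^ D" using that by (intro mult_le_mono1) auto
      then show ?thesis by simp
    qed
    have "regs (?i q) D \<inter> regs (?i q') D = {}"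
    proof (rule equals0I)
      fix a assume "a \<in> regs (?i q) D \<inter> regs (?i q') D"
      then obtain j j' where j: "j \<in> {?i q..<min (?i q + B ^ D) (d + 1)}" "a \<in> reg j"
          "j' \<in> {?i q'..<min (?i q' + B ^ D) (d + 1)}" "a \<in> reg j'"
        unfolding regs_def by blast
      have "j \<noteq> j'"
        using j(1,3) apart[of q q'] apart[of q' q] \<open>q \<noteq> q'\<close> by (cases "q < q'") auto
      then show False using reg_disjoint[of j j'] j by auto
    qed
    moreover have "regs (?i q) D \<inter> {..<fp} = {}"
      using reg_above by (fastforce simp: regs_def)
    ultimately show ?thesis by blast
  qed
  show ?thesis unfolding split_code_def
  proof (rule wp_calls[where R' = "\<lambda>q. scope (?i q) D" and W' = "\<lambda>q. regs (?i q) D"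
        and w' = "\<lambda>q. work (?i q) D t" and p' = "30 * (D + t + 2)" and \<Psi> = "\<lambda>q. gaps_done (?i q) D"])
    fix q assume "q < length ?cs"
    then have q: "q < ?p" by simp
    show "calls (?cs ! q) (scope (?i q) D) (regs (?i q) D) (work (?i q) D t) (30 * (D + t + 2)) (gaps_done (?i q) D) \<mu>"
      using rng[unfolded ranges_def, rule_format, OF part(1)[OF i q] window_part[OF win i q], of \<mu>] good q
      by simp
    show "scope (?i q) D \<subseteq> scope i (Suc D) \<and> regs (?i q) D \<subseteq> regs i (Suc D)"
      using sub[OF q] by blast
  next
    fix q q' assume "q < length ?cs" "q' < length ?cs" "q \<noteq> q'"
    then show "regs (?i q) D \<inter> (scope (?i q') D \<union> regs (?i q') D) = {}"
      using disj by simp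
  next
    show "(\<Sum>q<length ?cs. work (?i q) D t) \<le> work i (Suc D) t - 8"
      using work_split[OF i key] by simp
    show "length ?cs \<le> B" using parts_le by simp
    show "\<forall>s\<in>set ?cs. length s \<le> c"
      using ww(4,5) c by (auto simp: range_frame_def frame_def)
  next
    fix \<mu>' assume \<mu>': "\<And>q. q < length ?cs \<Longrightarrow>
        \<exists>\<mu>q. gaps_done (?i q) D \<mu>q \<and> (\<forall>a\<in>scope (?i q) D \<union> regs (?i q) D. \<mu>' a = \<mu>q a)"
    show "gaps_done i (Suc D) \<mu>'" unfolding gaps_done_def
    proof
      fix j assume j: "j \<in> {i..<min (i + B ^ Suc D) (d + 1)}"
      then obtain q where q: "q < ?p" "?i q \<le> j" "j < ?i q + B ^ D"
        using part_cover[of i j D] by auto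
      then obtain \<mu>q where \<mu>q: "gaps_done (?i q) D \<mu>q" "\<forall>a\<in>scope (?i q) D. \<mu>' a = \<mu>q a"
        using \<mu>'[of q] by auto
      have jq: "j \<in> {?i q..<min (?i q + B ^ D) (d + 1)}" using q j by simp
      then have "reg j \<subseteq> regs (?i q) D" unfolding regs_def by blast
      then have agree: "\<forall>a\<in>{..<fp} \<union> reg j. \<mu>' a = \<mu>q a" using \<mu>q(2) by blast
      have "gap_done j \<mu>q" using \<mu>q(1) jq unfolding gaps_done_def by blast
      then show "gap_done j \<mu>'" using agree by (rule gap_done_agree)
    qed
  qed auto
qed

lemma regs_0: "i \<le> d \<Longrightarrow> regs i 0 = reg i"
  by (simp add: regs_def)

lemma gaps_done_0: "i \<le> d \<Longrightarrow> gaps_done i 0 = gap_done i"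
  by (auto simp: gaps_done_def)

lemma gap_doneI:
  assumes "i \<le> d" "window i 0 t ss ps ts" "\<mu> (fp + i) = pad B [p]" "st B False \<mu> ({..<fp} \<union> reg i) p u"
    and "sh B 2 h u" "ino u = filter (rng i 0) (mix ss (map ino ts))"
  shows "gap_done i \<mu>"
proof -
  have w: "sorted_wrt (<) (mix ss (map ino ts))" "set (mix ss (map ino ts)) \<subseteq> set (ino T)"
     "{x \<in> set (ino T). rng i 0 x} \<subseteq> set (mix ss (map ino ts))"
    using assms(2) by (auto simp: window_def)
  have "sorted_wrt (<) (ino u)" unfolding assms(6) using w(1) by (rule sorted_wrt_filter)
  moreover have "set (ino u) = set (ino T) \<inter> gap keys_arr i"
    unfolding assms(6) gap_eq[OF assms(1)] using w(2,3) by auto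
  ultimately show ?thesis using assms(3-5) unfolding gap_done_def by blast
qed

lemma descend_frame_ok:
  assumes "window i D t ss ps ts" "i \<le> d" "D \<le> d"
    and "wp (descend_code B d kp fp i D (lo_key i) (hi_key (i + B ^ D)) (map Key ss @ ps)) 20 R W w p Q \<mu>"
  shows "calls (descend_at i D ss ps) R W w p Q \<mu>"
proof -
  note ww = window_words[OF assms(1)]
  have "0 < B ^ D" using B3 by simp
  then have "set ([Num 1, Num d, Num kp, Num fp, Num i, Num D, lo_key i, hi_key (i + B ^ D)] @ map Key ss @ ps) \<subseteq> V"
    using ww(2,3) assms(2,3) fp_le_M M_region kp lohi_V by (auto simp: region_def)
  then show ?thesis
    unfolding descend_frame_def using ww(4,5) assms(4)
    by (intro calls_body frame_ok) (simp_all only: body_simps, simp_all)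
qed

text \<open>Below the lowest nodes all subtrees are external, so the range contains no keys of the
  tree except the at most two separators in the frame.\<close>

lemma descends_0:
  assumes "D \<le> d" "0 < D \<Longrightarrow> ranges (D - 1) 0"
  shows "descends D 0"
  unfolding descends_def
proof (intro allI impI)
  fix i ss ps ts \<mu> assume i: "i \<le> d" and win: "window i D 0 ss ps ts" and good: "good \<mu>"
  let ?R = "scope i D" and ?hi = "hi_key (i + B ^ D)"
  note ww = window_words[OF win]
  have w: "sts B False \<mu>0 {..<fp} ps ts" "length ts = length ss + 1"
    "\<forall>u\<in>set ts. sh B 1 0 u" "sorted_wrt (<) (mix ss (map ino ts))" "length ts \<le> 3"
    using win by (auto simp: window_def)
  have ext: "\<forall>u\<in>set ts. u = External" using w(3) by (metis not_less_zero sh.elims(2))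
  have "ps ! 0 = Blank"
    using list_all2_nthD[OF w(1), of 0] ext w(2) ww(6) by (auto dest!: st_ptr)
  have w30: "30 \<le> work i D 0" using work_ge[of 0 i D] by simp
  have "wp (descend_code B d kp fp i D (lo_key i) ?hi (map Key ss @ ps)) 20 ?R (regs i D)
      (work i D 0 - 2) (30 * (D + 0 + 2) - 2) (gaps_done i D) \<mu>"
  proof (cases D)
    case (Suc D')
    have "wp (split_code B d kp fp i D' (map Key ss @ ps)) 1 (scope i (Suc D')) (regs i (Suc D'))
      (work i (Suc D') 0 - 8) (30 * (D' + 0 + 2)) (gaps_done i (Suc D')) \<mu>"
      using assms(2) Suc i win good by (intro wp_split) auto
    then have "wp (split_code B d kp fp i D' (map Key ss @ ps)) 20 ?R (regs i D)
      (work i D 0 - 2) (30 * (D + 0 + 2) - 2) (gaps_done i D) \<mu>"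
      unfolding Suc by (rule wp_mono) auto
    then show ?thesis using Suc \<open>ps ! 0 = Blank\<close> by (simp add: descend_code_def ww(1))
  next
    case 0
    obtain k cs where r: "restrict (lo_key i) ?hi ss ps = (k, cs)" by fastforce
    obtain us where us: "restrict (lo_key i) ?hi ss ts = (k, us)" "sts B False \<mu>0 {..<fp} cs us"
      using list_all2_restrict[OF w(1) r] by blast
    note re = restrict[OF us(1) w(2,4)]
    let ?a = "region B d fp i"
    have "?a + 8 \<le> region B d fp (i + 1)" using region_Suc[of i] by simp
    moreover have "region B d fp (i + 1) \<le> M"
      using region_mono[of "i + 1" "d + 1"] i M_region by simp
    ultimately have aM: "?a + 8 \<le> M" "{?a..<?a + 8} \<subseteq> reg i" by (auto simp: reg_def)
    have ext': "\<forall>u\<in>set us. u = External" using ext re(4) by blast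
    have set_k: "set (mix k (map ino us)) = set k" using ext' re(1) by (intro set_mix_Nil) auto
    then have "filter (inside (lo_key i) ?hi) (mix k (map ino us)) = mix k (map ino us)"
      using re(2) by (intro filter_True) auto
    then have inorder: "mix k (map ino us) = filter (rng i 0) (mix ss (map ino ts))"
      using re(8) 0 by (simp add: rng_def)
    have "sts B False \<mu> {..<fp} cs us"
      using us(2) by (rule list_all2_mono) (rule st_mono, use good in auto)
    then have "wp (emit_code B ?a (fp + i) k cs) 9 ?R (regs i D) 9 9 (gaps_done i D) \<mu>"
    proof (rule wp_emit[OF _ re(1)])
      show "length us \<le> 3 * B" using re(5) w(5) B3 by simp
      show "\<forall>t\<in>set us. sh B (mindeg B) 0 t" using ext' by auto
      show "set k \<subseteq> KS" using re(7) ww(2) by blast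
      show "{?a..<?a + 8} \<subseteq> regs i D" "fp + i \<in> regs i D"
        using aM 0 regs_0[OF i] by (auto simp: reg_def)
      show "{?a..<?a + 8} \<inter> {..<fp} = {}" "fp + i \<notin> {..<fp} \<union> {?a..<?a + 8}" "fp + i \<le> M"
        using fp_region[of 0 i] fp_region[OF i, of i] aM(1) by auto
    next
      fix \<mu>' p u h'
      assume r: "\<mu>' (fp + i) = pad B [p]" "st B False \<mu>' ({..<fp} \<union> {?a..<?a + 8}) p u" "sh B 2 h' u"
        "ino u = mix k (map ino us)"
      have "st B False \<mu>' ({..<fp} \<union> reg i) p u"
        using r(2) by (rule st_mono) (use aM(2) in auto)
      from gap_doneI[OF i win[unfolded 0] r(1) this r(3)] show "gaps_done i D \<mu>'"
        using 0 gaps_done_0[OF i] r(4) inorder by simp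
    qed (use fp_le_M aM in auto)
    then have "wp (emit_code B ?a (fp + i) k cs) 20 ?R (regs i D)
        (work i D 0 - 2) (30 * (D + 0 + 2) - 2) (gaps_done i D) \<mu>"
      by (rule wp_mono) (use w30 in auto)
    then show ?thesis using 0 r \<open>ps ! 0 = Blank\<close> by (simp add: descend_code_def ww(1))
  qed
  then show "calls (descend_at i D ss ps) ?R (regs i D)
      (work i D 0 - 2) (30 * (D + 0 + 2) - 2) (gaps_done i D) \<mu>"
    using win i assms(1) by (intro descend_frame_ok)
qed

lemma descends_Suc:
  assumes "D \<le> d" "descends D t" "0 < D \<Longrightarrow> ranges (D - 1) (Suc t)"
  shows "descends D (Suc t)"
  unfolding descends_def
proof (intro allI impI)
  fix i ss ps ts \<mu> assume i: "i \<le> d" and win: "window i D (Suc t) ss ps ts" and good: "good \<mu>"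
  let ?R = "scope i D" and ?hi = "hi_key (i + B ^ D)" and ?m = "mindeg B"
  let ?w = "work i D (Suc t) - 2" and ?p = "30 * (D + Suc t + 2) - 2"
  note ww = window_words[OF win]
  have w: "sts B False \<mu>0 {..<fp} ps ts" "length ts = length ss + 1"
    "\<forall>u\<in>set ts. sh B 1 (Suc t) u" "sorted_wrt (<) (mix ss (map ino ts))" "length ts \<le> 3"
    "Suc t \<le> hT" "set (mix ss (map ino ts)) \<subseteq> set (ino T)"
    "{x \<in> set (ino T). rng i D x} \<subseteq> set (mix ss (map ino ts))" "(\<Union>u\<in>set ts. levels (Suc t) u) \<subseteq> levels hT T"
    using win by (auto simp: window_def)
  have w30: "30 * (Suc t + 1) \<le> work i D (Suc t)" by (rule work_ge)
  have lohi: "lo_key i \<in> V" "?hi \<in> V" using lohi_V i B3 by auto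
  have "ts \<noteq> []" using w(2) by auto
  then have "ts ! 0 \<noteq> External" using w(3) by (metis length_greater_0_conv nat.distinct(1) nth_mem sh.simps(1))
  then have "ps ! 0 \<noteq> Blank"
    using list_all2_nthD[OF w(1), of 0] \<open>ts \<noteq> []\<close> ww(6) by (auto dest!: st_ptr)
  have stm: "sts B False \<mu> {..<fp} ps ts"
    using w(1) by (rule list_all2_mono) (rule st_mono, use good in auto)
  have inoKS: "set (ino u) \<subseteq> KS" if "u \<in> set ts" for u
  proof -
    have "set (ino u) \<subseteq> set (mix ss (map ino ts))" using that w(2) by (subst set_mix) auto
    then show ?thesis using w(7) T_KS by (meson subset_trans)
  qed
  define final where "final nds = (let (k, cs) = restrict (lo_key i) ?hi (mix ss (map fst nds)) (concat (map snd nds)) in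
        if length cs \<le> 3 then Fk [descend_at i D k cs] Done
        else if 0 < D then split_code B d kp fp i (D - 1) (map Key ss @ ps)
        else carve_code B (region B d fp i) (region B d fp i + 20 + 5 * (B * fp)) (fp + i) (lo_key i) ?hi k cs)" for nds
  have "wp (read_nodes False ps final) 20 ?R (regs i D) ?w ?p (gaps_done i D) \<mu>"
  \<comment> \<open>Written as \<open>2 * length ps + \<dots>\<close>, the budgets leave a remainder
    that does not depend on the number of nodes read; 6 covers the maximum of three nodes.\<close>
  proof (rule wp_mono[OF wp_read_nodes[OF stm, where lo = 1 and h = "Suc t" and n = 20 and
          w = "2 * length ps + (?w - 6)" and p = "2 * length ps + (?p - 6)"]])
    fix nds assume nds: "list_all2 (opens (st B False \<mu> {..<fp})) nds ts"
    define kk where "kk = mix ss (map fst nds)"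
    define cc where "cc = concat (map snd nds)"
    define tc where "tc = concat (map kids ts)"
    note fat = opens_fat[OF nds w(2,3), folded kk_def cc_def tc_def]
    obtain k cs where r: "restrict (lo_key i) ?hi kk cc = (k, cs)" by fastforce
    obtain us where us: "restrict (lo_key i) ?hi kk tc = (k, us)" "sts B False \<mu> {..<fp} cs us"
      using list_all2_restrict[OF fat(1) r] by blast
    have lus: "length cs = length us" using list_all2_lengthD[OF us(2)] .
    have us0: "sts B False \<mu>0 {..<fp} cs us"
      using us(2) by (rule list_all2_mono) (rule st_mono, use good in auto)
    note re = restrict[OF us(1) fat(3), where f = ino, unfolded fat(2), OF w(4)]
    have shus: "\<forall>u\<in>set us. sh B ?m t u" using fat(4) re(4) by auto
    have filt: "filter (rng i D) (mix k (map ino us)) = filter (rng i D) (mix ss (map ino ts))"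
      using re(8) by (simp add: rng_def)
    have "wp (final nds) 14 ?R (regs i D) (?w - 6) (?p - 6) (gaps_done i D) \<mu>"
    proof (cases "length cs \<le> 3")
      case True
      have "window i D t k cs us"
        unfolding window_def
      proof (intro conjI)
        show "\<forall>u\<in>set us. sh B 1 t u"
        proof
          fix u assume "u \<in> set us"
          then have "sh B ?m t u" using shus by blast
          then show "sh B 1 t u" by (rule sh_mono) (use B3 in simp)
        qed
        have "{x \<in> set (ino T). rng i D x} \<subseteq> set (filter (rng i D) (mix ss (map ino ts)))" using w(8) by auto
        also have "\<dots> \<subseteq> set (mix k (map ino us))" unfolding filt[symmetric] by (rule filter_is_subset)
        finally show "{x \<in> set (ino T). rng i D x} \<subseteq> set (mix k (map ino us))" .
        have "(\<Union>u\<in>set us. levels t u) \<subseteq> (\<Union>u\<in>set tc. levels t u)" using re(4) by blast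
        also have "\<dots> \<subseteq> (\<Union>u\<in>set ts. levels (Suc t) u)" using fat(5) by auto
        finally show "(\<Union>u\<in>set us. levels t u) \<subseteq> levels hT T" using w(9) by blast
      qed (use us0 re True lus w in auto)
      then have call: "calls (descend_at i D k cs)
        ?R (regs i D) (work i D t - 2) (30 * (D + t + 2) - 2) (gaps_done i D) \<mu>"
        using assms(2) i good unfolding descends_def by blast
      have flen: "length (descend_at i D k cs) \<le> c"
        using True re(1) lus c by (simp add: descend_frame_def frame_def)
      have "wp (Fk [descend_at i D k cs] Done) 14 ?R (regs i D)
          (?w - 6) (?p - 6) (gaps_done i D) \<mu>"
        by (rule wp_call[OF call _ _ _ _ _ flen]) (use work_descend[of i D t] in auto)
      then show ?thesis using True r unfolding final_def kk_def cc_def by simp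
    next
      case False
      have keyset: "set kk \<subseteq> set ss \<union> set (concat (map fst nds))"
        using w(2) list_all2_lengthD[OF nds] unfolding kk_def by (subst set_mix) auto
      have k3: "3 \<le> length k" using False lus re(1) by simp
      have "sorted_wrt (<) k"
        using re(3) sorted_mix[of "map ino us" k] re(1) by simp
      \<comment> \<open>Three distinct separators cannot all be among the two old ones. A new one
        comes from an opened node, hence has height \<open>Suc t\<close>, and is charged for the
        split.\<close>
      then have "card (set k) = length k"
        by (intro distinct_card) (simp add: strict_sorted_iff)
      moreover have "card (set ss) \<le> 2" using card_length[of ss] ww(5) by linarith
      ultimately have "\<not> set k \<subseteq> set ss" using k3 card_mono[of "set ss" "set k"] by auto
      then obtain x where x: "x \<in> set k" "x \<in> set (concat (map fst nds))"
        using re(7) keyset by blast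
      have key: "(x, Suc t) \<in> levels hT T" "rng i D x"
        using fat(5) w(9) x re(2) by (auto simp: rng_def)
      show ?thesis
      proof (cases D)
        case (Suc D')
        have "wp (split_code B d kp fp i D' (map Key ss @ ps)) 1 (scope i (Suc D')) (regs i (Suc D'))
          (work i (Suc D') (Suc t) - 8) (30 * (D' + Suc t + 2)) (gaps_done i (Suc D')) \<mu>"
          using assms(3) Suc i win good key by (intro wp_split) auto
        then have "wp (split_code B d kp fp i D' (map Key ss @ ps)) 14 ?R (regs i D) (?w - 6) (?p - 6) (gaps_done i D) \<mu>"
          unfolding Suc by (rule wp_mono) auto
        then show ?thesis using False r Suc unfolding final_def kk_def cc_def by simp
      next
        case 0
        let ?a = "region B d fp i" and ?a' = "region B d fp i + 20 + 5 * (B * fp)"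
        have tX: "5 * (t + 1) \<le> 5 * (B * fp)" using w(6) hT by simp
        have "region B d fp (i + 1) \<le> M"
          using region_mono[of "i + 1" "d + 1"] i M_region by simp
        then have aM: "?a' + 5 * (t + 1) \<le> M" "{?a..<?a' + 5 * (t + 1)} \<subseteq> reg i"
          using tX region_Suc[of i] by (auto simp: reg_def)
        have "wp (carve_code B ?a ?a' (fp + i) (lo_key i) ?hi k cs) 13 ?R (regs i D) (20 * t + 13) (20 * t + 13) (gaps_done i D) \<mu>"
        proof (rule wp_carve[OF us(2) re(1)])
          show "4 \<le> length us" using False lus by simp
          have "length (concat (map kids ts)) \<le> length ts * B"
            using w(3)
          proof (induction ts)
            case (Cons u us)
            then have "length (kids u) \<le> B" by (cases u) auto
            then show ?case using Cons by simp
          qed simp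
          also have "\<dots> \<le> 3 * B" using w(5) by (rule mult_le_mono1)
          finally show "length us \<le> 3 * B" using re(5) unfolding tc_def by simp
          show "set (mix k (map ino us)) \<subseteq> KS" using re(6) w(7) T_KS by blast
          show "{..<fp} \<subseteq> {..<?a}" "fp + i < ?a"
            using fp_region[of 0 i] fp_region[OF i, of i] by auto
          show "?a + 8 + 5 * (t + 1) \<le> ?a'" using tX by simp
          show "{?a..<?a' + 5 * (t + 1)} \<subseteq> ?R" "{?a..<?a' + 5 * (t + 1)} \<subseteq> regs i D" "fp + i \<in> regs i D"
            using aM(2) 0 regs_0[OF i] by (auto simp: reg_def)
        next
          fix \<mu>' p u h'
          assume res: "\<mu>' (fp + i) = pad B [p]" "st B False \<mu>' ({..<fp} \<union> {?a..<?a' + 5 * (t + 1)}) p u" "sh B 2 h' u"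
            "ino u = filter (inside (lo_key i) ?hi) (mix k (map ino us))"
          have "st B False \<mu>' ({..<fp} \<union> reg i) p u"
            using res(2) by (rule st_mono) (use aM(2) in auto)
          from gap_doneI[OF i win[unfolded 0] res(1) this res(3)] show "gaps_done i D \<mu>'"
            using 0 gaps_done_0[OF i] res(4) filt by (simp add: rng_def)
        qed (use shus re(2,3) lohi aM in auto)
        then have "wp (carve_code B ?a ?a' (fp + i) (lo_key i) ?hi k cs) 14 ?R (regs i D) (?w - 6) (?p - 6) (gaps_done i D) \<mu>"
          by (rule wp_mono) (use w30 in auto)
        then show ?thesis using False r 0 unfolding final_def kk_def cc_def by simp
      qed
    qed
    then show "wp (final nds) (20 - 2 * length ps) ?R (regs i D) (2 * length ps + (?w - 6) - 2 * length ps)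
        (2 * length ps + (?p - 6) - 2 * length ps) (gaps_done i D) \<mu>"
      by (rule wp_mono) (use ww(4) in auto)
  qed (use ww(4) w(3) inoKS fp_le_M w30 in auto)
  then have "wp (descend_code B d kp fp i D (lo_key i) ?hi (map Key ss @ ps)) 20 ?R (regs i D) ?w ?p (gaps_done i D) \<mu>"
    using \<open>ps ! 0 \<noteq> Blank\<close> unfolding descend_code_def ww(1) Let_def prod.case final_def by simp
  then show "calls (descend_at i D ss ps) ?R (regs i D) ?w ?p (gaps_done i D) \<mu>"
    using win i assms(1) by (intro descend_frame_ok)
qed

text \<open>A lexicographic induction: descending lowers the height at the same level, splitting
  lowers the level at the same height.\<close>

lemma ranges: "D \<le> d \<Longrightarrow> ranges D t"
proof (induction D arbitrary: t)
  case 0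
  have "descends 0 t" for t by (induction t) (auto intro: descends_0 descends_Suc)
  then show ?case using 0 by (rule ranges_if_descends)
next
  case (Suc D)
  have "descends (Suc D) t" for t
    using Suc by (induction t) (auto intro!: descends_0 descends_Suc)
  then show ?case using Suc.prems by (rule ranges_if_descends)
qed

end

text \<open>The constant of the theorem also limits the words passed to a child. Runs are
  constructed with small frames and relaxed to that constant at the end.\<close>

lemma run_mono:
  assumes "run B L c V prog \<mu> s r" "c \<le> c'"
  shows "run B L c' V prog \<mu> s r"
  using assms(1)
proof (induction rule: run.induct)
  case (run_Fork s cs s' \<mu> rs r)
  have "list_all2 (run B L c' V prog \<mu>) cs rs"
    by (rule list_all2_mono[OF run_Fork.IH(1)]) simp
  moreover have "\<forall>x\<in>set cs. length x \<le> c'" using run_Fork.hyps(5) assms(2) by (meson order_trans)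
  ultimately show ?case using run_Fork by (intro run.run_Fork)
qed (intro run.intros; assumption)+

context splitting
begin

lemma start_run:
  assumes rp: "st B False \<mu>0 {..<fp} rp T" and len: "\<And>a. length (\<mu>0 a) = B"
    and D: "D = (LEAST D. d < B ^ D)" "D \<le> d"
  shows "\<exists>r. runs \<mu>0 [Num B, rp, Num d, Num kp, Num fp] r \<and> io_work r \<le> work 0 D hT \<and>
    io_span r \<le> 30 * (D + hT + 2) \<and> (\<forall>j\<le>d. gap_done j (final_mem r))"
proof -
  let ?s = "[Num B, rp, Num d, Num kp, Num fp]"
  have "d < B ^ d" using B3 by (intro less_le_trans[OF less_exp[of d]] power_mono) auto
  then have D': "d < B ^ D" unfolding D(1) by (rule LeastI)
  have sh1: "sh B 1 hT T" using shT by (rule sh_mono) simp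
  have "window 0 D hT [] [rp] [T]"
    using rp sh1 sortedT by (simp add: window_def)
  then have "calls (range_frame B d kp fp 0 D [rp]) ({..<fp} \<union> regs 0 D) (regs 0 D) (work 0 D hT)
      (30 * (D + hT + 2)) (gaps_done 0 D) \<mu>0"
    using ranges[OF D(2), of hT] unfolding ranges_def by fastforce
  then obtain r where r: "runs \<mu>0 (range_frame B d kp fp 0 D [rp]) r"
      "io_work r \<le> work 0 D hT" "io_span r \<le> 30 * (D + hT + 2)" "gaps_done 0 D (final_mem r)"
    unfolding calls_def bounded_by_def by blast
  have join: "join_mem \<mu>0 [r] = final_mem r"
    using run_unchanged[OF r(1)] by (auto simp: join_mem_def)
  have "calls (frame B []) {} {} 0 0 (\<lambda>\<mu>. \<mu> = final_mem r) (final_mem r)"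
    by (intro calls_body frame_ok) (auto simp: body_simps)
  then obtain r' where r': "runs (final_mem r) (frame B []) r'" "io_work r' = 0" "io_span r' = 0"
      "final_mem r' = final_mem r"
    unfolding calls_def bounded_by_def by auto
  have prog: "interp body start ?s = Fork [range_frame B d kp fp 0 D [rp]] (frame B [])"
    by (simp add: interp_def start_def D(1) Let_def numeral_eq_Suc)
  have run: "runs \<mu>0 ?s (r'\<lparr>read_set := read_set r' \<union> (\<Union>q\<in>set [r]. read_set q),
          write_set := write_set r' \<union> (\<Union>q\<in>set [r]. write_set q),
          io_work := io_work r' + sum_list (map io_work [r]),
          io_span := io_span r' + Max (insert 0 (set (map io_span [r])))\<rparr>)" (is "runs _ _ ?r")
  proof (rule run.run_Fork[where cs = "[range_frame B d kp fp 0 D [rp]]" and s' = "frame B []"])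
    have "5 \<le> L * 1" using L_large c by simp
    also have "\<dots> \<le> L * B" using B_pos by (intro mult_le_mono2) simp
    finally show "length ?s \<le> L * B" by simp
    show "set ?s \<subseteq> V" using st_V[OF rp fp_le_M(1)] M fp_le_M kp M_region by (auto simp: region_def)
    show "\<forall>s\<^sub>c\<in>set [range_frame B d kp fp 0 D [rp]]. length s\<^sub>c \<le> c"
      using c by (simp add: range_frame_def frame_def)
    show "runs (join_mem \<mu>0 [r]) (frame B []) r'" using r'(1) join by simp
  qed (use B3 r prog in \<open>auto simp: race_free_def\<close>)
  have "\<forall>j\<le>d. gap_done j (final_mem r)"
    using r(4) D' unfolding gaps_done_def by auto
  then show ?thesis
    using r(2,3) r'(2-4) by (intro exI[of _ ?r] conjI run) auto
qed

lemma pot_le: "pot i D \<le> 57 * length (ino T)"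
proof -
  have "pot i D \<le> (\<Sum>p\<in>{p\<in>levels hT T. rng i D (fst p)}. key_cost B (snd p))"
    unfolding pot_def by (intro sum_mono level_cost_le)
  also have "\<dots> \<le> (\<Sum>p\<in>levels hT T. key_cost B (snd p))"
    by (intro sum_mono2 finite_levels) auto
  also have "\<dots> \<le> 57 * length (ino T)" using shT B3 by (rule sum_levels_key_cost_le)
  finally show ?thesis .
qed

end

section \<open>Bounds\<close>

lemma stored_tree_keys:
  "stored_tree B \<mu> P p t \<Longrightarrow> keys t \<subseteq> {k. \<exists>a\<in>P. Key k \<in> set (\<mu> a)}"
proof (induction rule: stored_tree.induct)
  case (2 a ks ps ts)
  have "set ks \<subseteq> {k. \<exists>a\<in>P. Key k \<in> set (\<mu> a)}"
    using 2(1,3) by (auto simp: pad_def intro!: bexI[of _ a])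
  moreover have "keys t \<subseteq> {k. \<exists>a\<in>P. Key k \<in> set (\<mu> a)}" if "t \<in> set ts" for t
    using 2(5) that by (induction rule: list_all2_induct) auto
  ultimately show ?case by auto
qed simp

text \<open>Every key is a word in one of \<open>fp\<close> blocks of \<open>B\<close> words. This
  bounds the height, and thereby all addresses, by numbers known to the program.\<close>

lemma stored_tree_card_keys:
  assumes "stored_tree B \<mu> {..<fp} p t" "\<And>a. length (\<mu> a) = B" "finite (keys t)"
  shows "card (keys t) \<le> B * fp"
proof -
  have "card (keys t) = card (Key ` keys t)" by (intro card_image[symmetric] inj_onI) simp
  also have "\<dots> \<le> card (\<Union>a\<in>{..<fp}. set (\<mu> a))"
    using stored_tree_keys[OF assms(1)] by (intro card_mono) auto
  also have "\<dots> \<le> (\<Sum>a<fp. card (set (\<mu> a)))" by (intro card_UN_le) simp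
  also have "\<dots> \<le> (\<Sum>a<fp. B)"
    using card_length[of "\<mu> _"] assms(2) by (intro sum_mono) simp
  finally show ?thesis by (simp add: mult.commute)
qed

lemma stored_keys_length:
  assumes "stored_keys B \<mu> {..<fp} kp ks" "0 < B" "ks \<noteq> []"
  shows "length ks \<le> B * fp" "kp < fp"
proof -
  let ?j = "(length ks - 1) div B"
  have "?j * B \<le> length ks - 1" by (rule div_times_less_eq_dividend)
  moreover have "length ks - 1 < length ks" using assms(3) by simp
  ultimately have "?j * B < length ks" by (rule le_less_trans)
  then have "kp + ?j < fp" using assms(1) unfolding stored_keys_def by auto
  then have "(?j + 1) * B \<le> fp * B" by (intro mult_le_mono1) simp
  moreover have "length ks - 1 < ?j * B + B" using assms(2) by (metis add.commute dividend_less_div_times)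
  ultimately show "length ks \<le> B * fp" by (simp add: algebra_simps)
  show "kp < fp" using \<open>kp + ?j < fp\<close> by simp
qed

text \<open>Addresses are at most \<open>49 * X\<^sup>2\<close> for
  \<open>X = B * fp \<ge> 3\<close>, and \<open>49 \<le> 3 ^ 4\<close>.\<close>

lemma region_le_power:
  assumes "3 \<le> B" "0 < fp" "d \<le> B * fp" "6 \<le> c"
  shows "region B d fp (d + 1) \<le> (B * fp) ^ c"
proof -
  define X where "X = B * fp"
  have "3 * 1 \<le> B * fp" using assms(1,2) by (intro mult_le_mono) auto
  then have X: "3 \<le> X" by (simp add: X_def)
  have "1 * fp \<le> B * fp" using assms(1) by (intro mult_le_mono1) simp
  then have "fp \<le> X" by (simp add: X_def)
  have "(d + 1) * (10 * X + 40) \<le> (2 * X) * (24 * X)"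
    using X assms(3) by (intro mult_le_mono) (auto simp: X_def)
  moreover have "fp + d + 1 \<le> 3 * X" using \<open>fp \<le> X\<close> assms(3) X unfolding X_def[symmetric] by linarith
  moreover have "3 * X \<le> X * X" using X by (rule mult_le_mono1)
  moreover have "(2 * X) * (24 * X) = 48 * (X * X)" by simp
  moreover have "region B d fp (d + 1) = fp + d + 1 + (d + 1) * (10 * X + 40)"
    by (simp add: region_def X_def)
  ultimately have "region B d fp (d + 1) \<le> 49 * (X * X)" by linarith
  also have "\<dots> \<le> X ^ 4 * (X * X)"
    using power_mono[OF X, of 4] by (intro mult_le_mono1) simp
  also have "\<dots> = X ^ 6" by (simp add: eval_nat_numeral)
  also have "\<dots> \<le> X ^ c" using X assms(4) by (intro power_increasing) auto
  finally show ?thesis by (simp add: X_def)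
qed

text \<open>The minimal degree is at least 2 and at least half of \<open>B\<close>, so its square is
  at least \<open>B\<close>: this is the factor 2.\<close>

lemma height_log:
  assumes "sh B 2 h t" "3 \<le> B" "0 < length (ino t)"
  shows "real h \<le> 1 + 2 * log (real B) (real (length (ino t)))"
proof (cases "h = 0")
  case True
  have "0 \<le> log (real B) (real (length (ino t)))" using assms(2,3) by (intro zero_le_log_cancel_iff[THEN iffD2]) (auto simp: Suc_le_eq)
  then show ?thesis using True by simp
next
  case False
  let ?m = "mindeg B" and ?N = "length (ino t)"
  have "2 * ?m ^ (h - 1) \<le> ?N + 1" using length_ino_root_ge[OF assms(1)] False by simp
  then have m: "?m ^ (h - 1) \<le> ?N" using assms(3) by linarith
  have "B \<le> 2 * ?m" "2 \<le> ?m" using assms(2) by auto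
  then have "B \<le> ?m\<^sup>2" unfolding power2_eq_square by (meson le_trans mult_le_mono1)
  then have "B ^ (h - 1) \<le> (?m\<^sup>2) ^ (h - 1)" by (rule power_mono) simp
  also have "\<dots> = (?m ^ (h - 1))\<^sup>2" by (simp add: power_mult[symmetric] mult.commute)
  also have "\<dots> \<le> ?N\<^sup>2" using m by (rule power_mono) simp
  finally have "real (B ^ (h - 1)) \<le> real (?N\<^sup>2)" by (rule of_nat_mono)
  then have "log B (real B ^ (h - 1)) \<le> log B (real ?N ^ 2)"
    using assms(2,3) by (subst log_le_cancel_iff) auto
  then have "real (h - 1) \<le> 2 * log B (real ?N)"
    using assms(2,3) by (simp add: log_nat_power)
  then show ?thesis using False by simp
qed

lemma gap_exists:
  assumes "sorted_wrt (<) ks" "x \<notin> set ks"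
  shows "\<exists>i\<le>length ks. x \<in> gap ks i"
proof -
  define i where "i = length (takeWhile (\<lambda>k. k < x) ks)"
  have "i \<le> length ks" by (simp add: i_def length_takeWhile_le)
  moreover have "ks ! (i - 1) < x" if "0 < i"
  proof -
    have "i - 1 < length (takeWhile (\<lambda>k. k < x) ks)" using that by (simp add: i_def)
    then show ?thesis by (metis nth_mem set_takeWhileD takeWhile_nth)
  qed
  moreover have "x < ks ! i" if "i < length ks"
    using nth_length_takeWhile[of "\<lambda>k. k < x" ks] that assms(2) nth_mem[of i ks]
    by (metis i_def linorder_neqE)
  ultimately show ?thesis by (auto simp: gap_def)
qed

text \<open>Only the cutting keys themselves belong to no gap.\<close>

lemma card_keys_le:
  assumes "sorted_wrt (<) ks" "\<forall>i\<le>length ks. K i = A \<inter> gap ks i" "finite A"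
  shows "card A \<le> length ks + (\<Sum>i\<le>length ks. card (K i))"
proof -
  have "A \<subseteq> set ks \<union> (\<Union>i\<in>{..length ks}. K i)"
    using gap_exists[OF assms(1)] assms(2) by fastforce
  then have "card A \<le> card (set ks \<union> (\<Union>i\<in>{..length ks}. K i))"
    using assms(2,3) by (intro card_mono) auto
  also have "\<dots> \<le> card (set ks) + card (\<Union>i\<in>{..length ks}. K i)" by (rule card_Un_le)
  also have "\<dots> \<le> length ks + (\<Sum>i\<le>length ks. card (K i))"
    by (intro add_mono card_length card_UN_le) simp
  finally show ?thesis .
qed

text \<open>If \<open>d \<le> n\<close>, then \<open>N \<le> 2 * n\<close>, the height is
  logarithmic in \<open>n\<close>, and the first work bound applies with the factor
  \<open>30 * 37 * 7 = 7770\<close>. Otherwise \<open>N \<le> 2 * d\<close>, and the second one is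
  at most \<open>4590 * d\<close>. Both factors are below 8000.\<close>

lemma final_bounds:
  fixes B d n N h D E w :: nat
  assumes "3 \<le> B" "0 < d" "N \<le> n + d"
    and h: "h \<le> N" "0 < N \<Longrightarrow> real h \<le> 1 + 2 * log (real B) (real N)"
    and D: "0 < D" "B ^ (D - 1) \<le> d" and E: "E \<le> 16 * (d + 1) + D\<^sup>2 + 3 * D"
    and w: "w \<le> 30 * (1 + E) * (h + 2)" "w \<le> 30 * (h + 1) + 30 * E + 30 * (57 * N)"
  shows "real (30 * (D + h + 2)) \<le> 8000 * (log (real B) (real d) + max 1 (log (real B) (real n)))"
    and "real w \<le> 8000 * real d * max 1 (log (real B) (real n))"
proof -
  let ?l = "max 1 (log (real B) (real n))"
  have B: "1 < real B" using assms(1) by simp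
  have ld: "0 \<le> log B d" using B assms(2) by simp
  have log2: "log B 2 \<le> 1" using B assms(1) by (simp add: log_le_one_cancel_iff)
  have hlog: "real h \<le> 3 + 2 * x" if N: "N \<le> 2 * y" and y: "0 < y" "log B (real y) \<le> x" "0 \<le> x" for x y
  proof (cases "N = 0")
    case True
    then show ?thesis using h(1) that by simp
  next
    case False
    have "log B (real N) \<le> log B (2 * real y)" using N False B by (subst log_le_cancel_iff) auto
    also have "\<dots> = log B 2 + log B (real y)" using y(1) B by (simp add: log_mult)
    finally have "log B (real N) \<le> 1 + x" using log2 y by linarith
    then show ?thesis using h(2) False by simp
  qed
  have "real (D - 1) = log B (real B ^ (D - 1))" using B by (simp add: log_nat_power)
  also have "\<dots> \<le> log B (real d)"
    using B assms(2) D(2) by (subst log_le_cancel_iff) (auto simp flip: of_nat_power)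
  finally have "real (D - 1) \<le> log B d" .
  then have Dlog: "real D \<le> 1 + log B d" using D(1) by simp
  have "real h \<le> 3 + 2 * (log B d + ?l)"
  proof (cases "d \<le> n")
    case True
    then show ?thesis using assms(2,3) ld by (intro hlog[of n]) auto
  next
    case False
    then show ?thesis using assms(2,3) ld by (intro hlog[of d]) auto
  qed
  then show "real (30 * (D + h + 2)) \<le> 8000 * (log (real B) (real d) + ?l)"
    using Dlog ld by simp
  have "3 ^ (D - 1) \<le> B ^ (D - 1)" using assms(1) by (rule power_mono) simp
  then have "4 * 3 ^ (D - 1) \<le> 4 * d" using D(2) by simp
  then have "D\<^sup>2 + 3 * D \<le> 4 * d" using square_le_power3[OF D(1)] by (rule order_trans[rotated])
  then have "16 * (d + 1) + (D\<^sup>2 + 3 * D) \<le> 16 * (d + 1) + 4 * d" by (rule add_left_mono)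
  also have "\<dots> \<le> 36 * d" using assms(2) by simp
  finally have E': "E \<le> 36 * d" using E by simp
  show "real w \<le> 8000 * real d * ?l"
  proof (cases "d \<le> n")
    case True
    then have "real h \<le> 3 + 2 * ?l" using assms(2,3) by (intro hlog[of n]) auto
    then have h7: "real (h + 2) \<le> 7 * ?l" by simp
    have "real w \<le> real (30 * (1 + E)) * real (h + 2)"
      using w(1) by (metis of_nat_le_iff of_nat_mult)
    also have "\<dots> \<le> real (30 * (37 * d)) * (7 * ?l)"
      using E' assms(2) h7 by (intro mult_mono) auto
    also have "\<dots> = 7770 * (real d * ?l)" by simp
    also have "\<dots> \<le> 8000 * (real d * ?l)" by (intro mult_right_mono) auto
    finally show ?thesis by simp
  next
    case False
    then have "N \<le> 2 * d" using assms(3) by simp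
    then have "30 * (h + 1) + 30 * E + 30 * (57 * N) \<le> 30 * (2 * d + 1) + 30 * (36 * d) + 30 * (57 * (2 * d))"
      using h(1) E' by (intro add_mono mult_le_mono) auto
    also have "\<dots> \<le> 8000 * d" using assms(2) by simp
    finally have "w \<le> 8000 * d" using w(2) by simp
    then have "real w \<le> 8000 * real d * 1" by simp
    also have "\<dots> \<le> 8000 * real d * ?l" by (intro mult_left_mono) auto
    finally show ?thesis .
  qed
qed

theorem mainTheorem3:
  shows "\<exists>(prog :: 'k::linorder program) (c :: nat).
    \<forall>(B :: nat) (T :: 'k btree) (ks :: 'k list) (\<mu> :: 'k mem) (root :: 'k word) (kp :: nat) (fp :: nat).
      3 \<le> B \<longrightarrow> btree B T \<longrightarrow> ks \<noteq> [] \<longrightarrow> sorted_wrt (<) ks \<longrightarrow>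
      (\<forall>a. length (\<mu> a) = B) \<longrightarrow>
      stored_tree B \<mu> {..<fp} root T \<longrightarrow>
      stored_keys B \<mu> {..<fp} kp ks \<longrightarrow>
      (\<exists>(Ts :: 'k btree list) (n :: nat) (L :: nat) (r :: 'k outcome).
         length Ts = length ks + 1 \<and>
         (\<forall>i\<le>length ks. btree B (Ts ! i) \<and> keys (Ts ! i) = keys T \<inter> gap ks i) \<and>
         n = (\<Sum>i\<le>length ks. card (keys (Ts ! i))) \<and>
         real L \<le> real c * max 1 (log 2 (real n)) \<and>
         run B L c
           ({Blank} \<union> Key ` (keys T \<union> set ks) \<union> Num ` {..(B * fp) ^ c})
           prog \<mu> [Num B, root, Num (length ks), Num kp, Num fp] r \<and>
         (\<forall>i\<le>length ks. \<exists>p. final_mem r (fp + i) = pad B [p] \<and>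
            stored_tree B (final_mem r) UNIV p (Ts ! i)) \<and>
         real (io_span r) \<le>
           real c * (log (real B) (real (length ks)) + max 1 (log (real B) (real n))) \<and>
         real (io_work r) \<le>
           real c * real (length ks) * max 1 (log (real B) (real n)))"
proof -
  \<comment> \<open>An opaque \<open>c\<close> with a lower bound keeps powers such as
    \<open>(B * fp) ^ c\<close> symbolic.\<close>
  obtain c :: nat where c8000: "8000 \<le> c" by blast
  show ?thesis
  proof (rule exI[of _ "interp body start"], rule exI[of _ c], intro allI impI, goal_cases)
    case (1 B T ks \<mu> root kp fp)
    note B = 1(1) and T = 1(2) and ks = 1(3,4) and rooted = 1(6) and arr = 1(7)
    have len: "\<And>a. length (\<mu> a) = B" using 1(5) by blast
    let ?d = "length ks" and ?M = "(B * fp) ^ c" and ?KS = "keys T \<union> set ks"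
    let ?V = "{Blank} \<union> Key ` ?KS \<union> Num ` {..?M}"
    obtain h where h: "sh B 2 h T" and sortedT: "sorted_wrt (<) (ino T)"
      using T unfolding btree_iff_sh by blast
    have keysT: "keys T = set (ino T)" using set_ino[OF h] by simp
    have "distinct (ino T)" using sortedT by (simp add: strict_sorted_iff)
    then have cardT: "card (keys T) = length (ino T)" unfolding keysT by (rule distinct_card)
    have fin: "finite (keys T)" unfolding keysT by simp
    have dX: "?d \<le> B * fp" "kp < fp" using stored_keys_length[OF arr _ ks(1)] B by auto
    have hN: "h \<le> length (ino T)" using height_le_length_ino[OF h] B by simp
    have NX: "length (ino T) \<le> B * fp" using stored_tree_card_keys[OF rooted len fin] cardT by simp
    have regM: "region B ?d fp (?d + 1) \<le> ?M" using region_le_power[OF B _ dX(1)] dX(2) c8000 by simp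
    have fpM: "fp + B * fp + 20 \<le> region B ?d fp (?d + 1)" by (simp add: region_def)
    have "B * 1 \<le> B * fp" using dX(2) by (intro mult_le_mono2) simp
    \<comment> \<open>A frame has at most 13 arguments and 3 further words, so 20 words suffice;
      with 20 blocks for the history this makes 40, a constant number of local blocks.\<close>
    interpret splitting B 40 20 ?V ?KS ?M T h ks \<mu> kp fp
    proof unfold_locales
      show "B \<le> ?M" "20 \<le> ?M" "kp \<le> ?M" using regM fpM \<open>B * 1 \<le> B * fp\<close> dX(2) by linarith+
    qed (use B h sortedT keysT ks arr hN NX regM in auto)
    define D where "D = (LEAST D. ?d < B ^ D)"
    have "?d < B ^ ?d" using B by (intro less_le_trans[OF less_exp[of ?d]] power_mono) auto
    then have D: "?d < B ^ D" "D \<le> ?d" unfolding D_def by (rule LeastI, rule Least_le)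
    have "D \<noteq> 0"
    proof
      assume "D = 0"
      then show False using D(1) ks(1) by simp
    qed
    then have "0 < D" by simp
    have Dd: "B ^ (D - 1) \<le> ?d"
      using not_less_Least[of "D - 1" "\<lambda>D. ?d < B ^ D"] \<open>0 < D\<close> unfolding D_def[symmetric] by simp
    have "st B False \<mu> {..<fp} root T" using rooted by (simp add: st_def)
    from start_run[OF this len D_def D(2)] obtain r where r: "runs \<mu> [Num B, root, Num ?d, Num kp, Num fp] r"
        "io_work r \<le> work 0 D h" "io_span r \<le> 30 * (D + h + 2)" "\<forall>j\<le>?d. gap_done j (final_mem r)"
      by blast
    then obtain t p h' where t: "\<And>j. j \<le> ?d \<Longrightarrow> final_mem r (fp + j) = pad B [p j] \<and>
        st B False (final_mem r) ({..<fp} \<union> reg j) (p j) (t j) \<and> sh B 2 (h' j) (t j) \<and>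
        sorted_wrt (<) (ino (t j)) \<and> set (ino (t j)) = set (ino T) \<inter> gap ks j"
      unfolding gap_done_def by metis
    define Ts where "Ts = map t [0..<?d + 1]"
    have Ts: "length Ts = ?d + 1" "\<And>i. i \<le> ?d \<Longrightarrow> Ts ! i = t i"
      by (simp_all add: Ts_def del: upt_Suc)
    define n where "n = (\<Sum>i\<le>?d. card (keys (Ts ! i)))"
    have trees: "\<forall>i\<le>?d. btree B (Ts ! i) \<and> keys (Ts ! i) = keys T \<inter> gap ks i"
      using t set_ino[OF t[THEN conjunct2, THEN conjunct2, THEN conjunct1]] unfolding btree_iff_sh keysT
      by (simp add: Ts(2)) blast
    have "card (keys T) \<le> ?d + n"
      unfolding n_def using trees fin by (intro card_keys_le ks(2)) auto
    then have N: "length (ino T) \<le> n + ?d" using cardT by simp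
    have E: "range_cost B ?d D 0 \<le> 16 * (?d + 1) + D\<^sup>2 + 3 * D"
      using range_cost_le[of B 0 ?d D] B by simp
    have w1: "io_work r \<le> 30 * (1 + range_cost B ?d D 0) * (h + 2)"
      using r(2) unfolding work_def by simp
    have w2: "io_work r \<le> 30 * (h + 1) + 30 * range_cost B ?d D 0 + 30 * (57 * length (ino T))"
      using r(2) pot_le[of 0 D] unfolding work_def by linarith
    have "0 < ?d" using ks(1) by simp
    note bounds = final_bounds[OF B this N hN height_log[OF h B] \<open>0 < D\<close> Dd E w1 w2]
    let ?l = "max 1 (log (real B) (real n))"
    have logd: "0 \<le> log B ?d" using B \<open>0 < ?d\<close> by (simp add: Suc_le_eq)
    have "real (io_span r) \<le> 8000 * (log (real B) (real ?d) + ?l)"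
      using bounds(1) r(3) by (meson of_nat_le_iff order_trans)
    also have "\<dots> \<le> real c * (log (real B) (real ?d) + ?l)"
      using c8000 logd by (intro mult_right_mono) auto
    finally have span: "real (io_span r) \<le> real c * (log (real B) (real ?d) + ?l)" .
    have "8000 * real ?d * ?l \<le> real c * real ?d * ?l"
      using c8000 by (intro mult_right_mono) auto
    with bounds(2) have work: "real (io_work r) \<le> real c * real ?d * ?l" by linarith
    have "real 40 \<le> real c * 1" using c8000 by simp
    also have "\<dots> \<le> real c * max 1 (log 2 (real n))" by (intro mult_left_mono) auto
    finally have L: "real 40 \<le> real c * max 1 (log 2 (real n))" .
    have "run B 40 c ?V (interp body start) \<mu> [Num B, root, Num ?d, Num kp, Num fp] r"
      using r(1) by (rule run_mono) (use c8000 in simp)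
    moreover have "\<forall>i\<le>?d. \<exists>p. final_mem r (fp + i) = pad B [p] \<and> stored_tree B (final_mem r) UNIV p (Ts ! i)"
    proof (intro allI impI)
      fix i assume "i \<le> ?d"
      moreover from this have "stored_tree B (final_mem r) UNIV (p i) (t i)"
        using t[of i] by (auto simp: st_def elim: stored_tree_mono)
      ultimately show "\<exists>p. final_mem r (fp + i) = pad B [p] \<and> stored_tree B (final_mem r) UNIV p (Ts ! i)"
        using t[of i] Ts(2) by auto
    qed
    ultimately show ?case
      using Ts(1) trees n_def L span work by blast
  qed
qed

end
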